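(* Let $G$ and $G'$ be finite groups. Let $\mathcal C$ (resp. $\mathcal C'$) be a set of conjugacy classes of $G$ (resp. $G'$) and $B$ (resp. $B'$) a union of $\mathcal C$-blocks of $G$ (resp. of $\mathcal C'$-blocks of $G'$). Suppose that: (1) $G$ has an MN-structure with respect to $\mathcal C$ and $B$, and $G'$ has an MN-structure with respect to $\mathcal C'$ and $B'$ (objects attached to $G'$ are denoted with a prime). (2) There are subsets $\Lambda_0\subseteq\Lambda$ and $\Lambda_0'\subseteq\Lambda'$ such that: (a) for every $\lambda\in\Lambda$ with $\lambda\notin\Lambda_0$ one has $r^{\lambda}=0$, and for every $\lambda'\in\Lambda'$ with $\lambda'\notin\Lambda'_0$ one has $r'^{\lambda'}=0$; (b) there is a bijection $\sigma:\Lambda_0\to\Lambda_0'$ with $\sigma(\{1\})=\{1\}$ and, for every $\lambda\in\Lambda_0$, an isometry $I_\lambda:\mathbb C\operatorname{Irr}(B_\lambda)\to\mathbb C\operatorname{Irr}(B'_{\sigma(\lambda)})$ such that $I_\lambda\circ r^\lambda=r'^{\sigma(\lambda)}\circ I_{\{1\}}$. (3) For every $\lambda\in\Lambda_0$ one has $I_\lambda(\mathbb C b_\lambda^\vee)=\mathbb C {b'}_{\sigma(\lambda)}^{\vee}$; write $J_\lambda=I_\lambda|_{\mathbb C b_\lambda^\vee}$. Then for all $x\in G$ and $x'\in G'$, $$\widehat I_{\{1\}}(x,x')=\sum_{\lambda\in\Lambda_0}\ \sum_{\phi\in\mathfrak b_\lambda^{\mathcal C}}\overline{e_\lambda(\Phi_\phi)(x)}\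 l'_{\sigma(\lambda)}\bigl(J_\lambda^{*-1}(\phi)\bigr)(x').$$
   Context: **Restriction and blocks.** For a finite group $G$, $\mathbb C\operatorname{Irr}(G)$ is the space of complex class functions with usual hermitian product $\langle\,,\rangle_G$. For a set $\mathcal C$ of conjugacy classes put $C=\bigcup_{c\in\mathcal C}c$ and let $\operatorname{res}_C(\varphi)$ be equal to $\varphi$ on $C$ and to $0$ off $C$. For a set $X$ of class functions, $X^{\mathcal C}=\{\operatorname{res}_C(\chi):\chi\in X\}$. Fix a $\mathbb Z$-basis $b$ of $\mathbb Z\operatorname{Irr}(G)^{\mathcal C}$ and write $\operatorname{res}_C(\chi)=\sum_{\varphi\in b}d_{\chi\varphi}\varphi$ ($d_{\chi\varphi}\in\mathbb Z$) for $\chi\in\operatorname{Irr}(G)$. The $\mathcal C$-blocks of $G$ (with respect to $b$) are the connected components of the graph with vertex set $\operatorname{Irr}(G)$ in which $\chi,\chi'$ are joined if $d_{\chi\varphi}\ne0\ne d_{\chi'\varphi}$ for some $\varphi\in b$. For a union $B$ of $\mathcal C$-blocks, $\operatorname{Irr}(B)$ is the set of its characters, $b_B=\{\varphi\in b: d_{\chi\varphi}\neq0\text{ for some }\chi\in\operatorname{Irr}(B)\}$, and $b_B^\vee$ is the basis of $\mathbb C b_B$ dual to $b_B$ for $\langle\,,\rangle_G$. One has $\mathbb C b_B=\mathbb C\operatorname{Irr}(B)^{\mathcal C}$. **MN-structure.** Write ${}^gx=gxg^{-1}$. $G$ has an MN-structure with respect to $\mathcal C$ and $B$ if: 1. There is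 a subset $S\subseteq G$ containing $1$ and stable under $G$-conjugation. 2. There is a bijection from a subset $A\subseteq S\times C$ onto $G$, $(x_S,x_C)\mapsto x_S\cdot x_C$, such that for $(x_S,x_C)\in A$ and $g\in G$: ${}^g(x_S\cdot x_C)=({}^gx_S)\cdot({}^gx_C)$ and $x_S\cdot x_C=x_Sx_C=x_Cx_S$. Moreover $(x_S,1)\in A$ and $(1,x_C)\in A$ for all $x_S\in S$, $x_C\in C$. 3. For each $x_S\in S$ there is a subgroup $G_{x_S}\le \operatorname{C}_G(x_S)$ with $G_{x_S}\cap C=\{x_C\in C:(x_S,x_C)\in A\}$; let $\mathcal C_{x_S}$ be the set of $G_{x_S}$-conjugacy classes of $G_{x_S}\cap C$. 4. For each $x_S\in S$ there are a union $B_{x_S}$ of $\mathcal C_{x_S}$-blocks of $G_{x_S}$ and a linear map $r^{x_S}:\mathbb C\operatorname{Irr}(B)\to\mathbb C\operatorname{Irr}(B_{x_S})$ with $r^{x_S}(\chi)(x_C)=\chi(x_S\cdot x_C)$ for all $\chi\in\mathbb C\operatorname{Irr}(B)$ and $(x_S,x_C)\in A$. Moreover $G_1=G$, $B_1=B$, $r^1=\mathrm{id}$. **Further notation.** $\Lambda$ is the set of $G$-conjugacy classes contained in $S$. For each $\lambda\in\Lambda$ choose $x_\lambda\in\lambda$ and put $G_\lambda=G_{x_\lambda}$, $B_\lambda=B_{x_\lambda}$, $r^\lambda=r^{x_\lambda}$, $\mathcal C_\lambda=\mathcal C_{x_\lambda}$. Let $b_\lambda$ be the part, belonging to $B_\lambda$,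 of the $\mathbb Z$-basis of $\mathbb Z\operatorname{Irr}(G_\lambda)^{\mathcal C_\lambda}$ used to define the $\mathcal C_\lambda$-blocks of $G_\lambda$, and $b_\lambda^\vee$ its dual basis. - $d_\lambda=\operatorname{res}_{C\cap G_\lambda}\circ r^\lambda:\mathbb C\operatorname{Irr}(B)\to\mathbb C\operatorname{Irr}(B_\lambda)^{\mathcal C_\lambda}$, and $e_\lambda:\mathbb C b_\lambda^\vee\to\mathbb C\operatorname{Irr}(B)$ is its adjoint: $\langle e_\lambda(\phi),\chi\rangle_G=\langle\phi,d_\lambda(\chi)\rangle_{G_\lambda}$. - For $g=g_S\cdot g_C\in G$ with $g_S\in\lambda$, the set $X=\{{}^tg_C: t\in G,\ {}^tg_S=x_\lambda\}\subseteq G_\lambda$ is stable under $G_\lambda$-conjugation; $\mathcal E^\lambda_{g_S,g_C}$ denotes a set of representatives of the $G_\lambda$-classes in $X$. - $l_\lambda:\mathbb C\operatorname{Irr}(G_\lambda)^{\mathcal C_\lambda}\to\mathbb C\operatorname{Irr}(G)$ is given by $l_\lambda(\psi)(g)=\frac1{|\mathcal E^\lambda_{g_S,g_C}|}\sum_{x_C\in\mathcal E^\lambda_{g_S,g_C}}\psi(x_C)$ if $g_S\in\lambda$, and $l_\lambda(\psi)(g)=0$ otherwise. - $\mathbb Z b_\lambda(\mathcal C)$ is the submodule of $\mathbb Z b_\lambda$ of functions constant on $\mathcal E^\lambda_{x_\lambda,y}$ for every $y\in C\cap G_\lambda$. One can choose a $\mathbb Z$-basis $\mathfrak b_\lambda=\{b_1,\dots,b_N\}$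 of $\mathbb Z b_\lambda$ such that $\mathfrak b_\lambda^{\mathcal C}=\{b_1,\dots,b_K\}$ is a $\mathbb Z$-basis of $\mathbb Z b_\lambda(\mathcal C)$; $\{\Phi_\phi:\phi\in\mathfrak b_\lambda\}$ is the basis of $\mathbb C b_\lambda$ dual to $\mathfrak b_\lambda$, i.e. $\langle\Phi_\phi,\vartheta\rangle_{G_\lambda}=\delta_{\phi\vartheta}$. - $J_\lambda^*:\mathbb C b'_{\sigma(\lambda)}\to\mathbb C b_\lambda$ is the adjoint of $J_\lambda$: $\langle J_\lambda(\alpha),\beta\rangle_{G'_{\sigma(\lambda)}}=\langle\alpha,J_\lambda^*(\beta)\rangle_{G_\lambda}$; $J_\lambda^{*-1}$ is its inverse. - "Isometry" means a $\mathbb C$-linear bijection preserving the hermitian products. - For a linear map $I:\mathbb C\operatorname{Irr}(B)\to\mathbb C\operatorname{Irr}(B')$, $\widehat I(x,x')=\sum_{\chi\in\operatorname{Irr}(B)}\overline{\chi(x)}\,I(\chi)(x')$ for $x\in G$, $x'\in G'$.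
   Formalization: The integral bases defining the blocks of G_λ (λ in Λ_0) and G'_λ' (λ' in Λ'_0) are assumed linearly independent over ℂ, so that the dual bases exist; this fails for some sets of classes, e.g. G cyclic of order 5 and C = {1, g}. *)

theory Defs
  imports "Jordan_Normal_Form.VS_Connect" "HOL-Library.Function_Algebras"
begin

section \<open>Complex-valued functions as a vector space and as an abelian group\<close>

text \<open>
  A function on a finite group \<open>H\<close> is a total function \<open>'a \<Rightarrow> complex\<close> that vanishes off
  \<open>carrier H\<close>.  In particular functions on a subgroup are extended by zero.
\<close>

definition cscale :: "complex \<Rightarrow> ('a \<Rightarrow> complex) \<Rightarrow> 'a \<Rightarrow> complex"
  where "cscale c f = (\<lambda>x. c * f x)"

definition zscale :: "int \<Rightarrow> ('a \<Rightarrow> complex) \<Rightarrow> 'a \<Rightarrow> complex"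
  where "zscale n f = (\<lambda>x. of_int n * f x)"

global_interpretation cfun: Vector_Spaces.vector_space cscale
  by unfold_locales (auto simp: cscale_def fun_eq_iff algebra_simps)

global_interpretation zfun: Modules.module zscale
  by unfold_locales (auto simp: zscale_def fun_eq_iff algebra_simps)

definition z_basis :: "('a \<Rightarrow> complex) set \<Rightarrow> ('a \<Rightarrow> complex) set \<Rightarrow> bool"
  where "z_basis b L \<longleftrightarrow> zfun.independent b \<and> zfun.span b = L"

definition linear_on :: "('a \<Rightarrow> complex) set \<Rightarrow> (('a \<Rightarrow> complex) \<Rightarrow> 'b \<Rightarrow> complex) \<Rightarrow> bool"
  where "linear_on V T \<longleftrightarrow>
    (\<forall>u\<in>V. \<forall>v\<in>V. T (u + v) = T u + T v) \<and> (\<forall>c. \<forall>v\<in>V. T (cscale c v) = cscale c (T v))"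

definition herm :: "('a, 'm) monoid_scheme \<Rightarrow> ('a \<Rightarrow> complex) \<Rightarrow> ('a \<Rightarrow> complex) \<Rightarrow> complex"
  where "herm H f h = (\<Sum>x\<in>carrier H. f x * cnj (h x)) / of_nat (card (carrier H))"

definition isometry ::
  "('a, 'm) monoid_scheme \<Rightarrow> ('b, 'n) monoid_scheme \<Rightarrow> ('a \<Rightarrow> complex) set \<Rightarrow> ('b \<Rightarrow> complex) set
    \<Rightarrow> (('a \<Rightarrow> complex) \<Rightarrow> 'b \<Rightarrow> complex) \<Rightarrow> bool"
  where "isometry H K V W T \<longleftrightarrow>
    linear_on V T \<and> bij_betw T V W \<and> (\<forall>u\<in>V. \<forall>v\<in>V. herm K (T u) (T v) = herm H u v)"

text \<open>
  The adjoint of \<open>T\<close>, a map from \<open>V\<close> to functions on \<open>K\<close>, with values in a space \<open>U\<close> of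
  functions on \<open>H\<close> that the hermitian product pairs perfectly with \<open>V\<close>:
  \<open>\<langle>adjoint T \<phi>, \<chi>\<rangle>\<^sub>H = \<langle>\<phi>, T \<chi>\<rangle>\<^sub>K\<close> for all \<open>\<chi> \<in> V\<close>.
\<close>

definition adjoint ::
  "('a, 'm) monoid_scheme \<Rightarrow> ('b, 'n) monoid_scheme \<Rightarrow> ('a \<Rightarrow> complex) set \<Rightarrow> ('a \<Rightarrow> complex) set
    \<Rightarrow> (('a \<Rightarrow> complex) \<Rightarrow> 'b \<Rightarrow> complex) \<Rightarrow> ('b \<Rightarrow> complex) \<Rightarrow> 'a \<Rightarrow> complex"
  where "adjoint H K U V T \<phi> = (THE \<psi>. \<psi> \<in> U \<and> (\<forall>\<chi>\<in>V. herm H \<psi> \<chi> = herm K \<phi> (T \<chi>)))"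

text \<open>\<open>dual_elt H b \<phi>\<close> is the member \<open>\<Phi>\<^sub>\<phi>\<close> of the basis of the complex span of \<open>b\<close> dual to \<open>b\<close>.
  It exists only if \<open>b\<close> is linearly independent over the complex numbers, which for an integral
  basis of \<open>res C ` zfun.span (Irr H)\<close> is not automatic: for \<open>H\<close> cyclic of order 5 and \<open>C\<close> a
  single non-identity element the integral rank is 4 but the complex dimension is 1.\<close>

definition dual_elt ::
  "('a, 'm) monoid_scheme \<Rightarrow> ('a \<Rightarrow> complex) set \<Rightarrow> ('a \<Rightarrow> complex) \<Rightarrow> 'a \<Rightarrow> complex"
  where "dual_elt H b \<phi> =
    (THE \<psi>. \<psi> \<in> cfun.span b \<and> (\<forall>\<theta>\<in>b. herm H \<psi> \<theta> = (if \<theta> = \<phi> then 1 else 0)))"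

definition dual_basis :: "('a, 'm) monoid_scheme \<Rightarrow> ('a \<Rightarrow> complex) set \<Rightarrow> ('a \<Rightarrow> complex) set"
  where "dual_basis H b = dual_elt H b ` b"


section \<open>Conjugacy classes and irreducible characters\<close>

definition cj :: "('a, 'm) monoid_scheme \<Rightarrow> 'a \<Rightarrow> 'a \<Rightarrow> 'a"
  where "cj H g x = g \<otimes>\<^bsub>H\<^esub> x \<otimes>\<^bsub>H\<^esub> inv\<^bsub>H\<^esub> g"

definition conj_class :: "('a, 'm) monoid_scheme \<Rightarrow> 'a \<Rightarrow> 'a set"
  where "conj_class H x = (\<lambda>g. cj H g x) ` carrier H"

definition conj_classes :: "('a, 'm) monoid_scheme \<Rightarrow> 'a set set"
  where "conj_classes H = conj_class H ` carrier H"

definition matrix_rep :: "('a, 'm) monoid_scheme \<Rightarrow> nat \<Rightarrow> ('a \<Rightarrow> complex mat) \<Rightarrow> bool"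
  where "matrix_rep H n \<rho> \<longleftrightarrow>
    (\<forall>g\<in>carrier H. \<rho> g \<in> carrier_mat n n) \<and> \<rho> \<one>\<^bsub>H\<^esub> = 1\<^sub>m n \<and>
    (\<forall>g\<in>carrier H. \<forall>h\<in>carrier H. \<rho> (g \<otimes>\<^bsub>H\<^esub> h) = \<rho> g * \<rho> h)"

definition irreducible_rep :: "('a, 'm) monoid_scheme \<Rightarrow> nat \<Rightarrow> ('a \<Rightarrow> complex mat) \<Rightarrow> bool"
  where "irreducible_rep H n \<rho> \<longleftrightarrow> matrix_rep H n \<rho> \<and> 0 < n \<and>
    (\<forall>W. VectorSpace.subspace class_ring W (module_vec TYPE(complex) n) \<longrightarrow>
       (\<forall>g\<in>carrier H. \<forall>w\<in>W. \<rho> g *\<^sub>v w \<in> W) \<longrightarrow> W = {0\<^sub>v n} \<or> W = carrier_vec n)"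

definition rep_character ::
  "('a, 'm) monoid_scheme \<Rightarrow> nat \<Rightarrow> ('a \<Rightarrow> complex mat) \<Rightarrow> 'a \<Rightarrow> complex"
  where "rep_character H n \<rho> = (\<lambda>g. if g \<in> carrier H then \<Sum>i<n. \<rho> g $$ (i, i) else 0)"

definition Irr :: "('a, 'm) monoid_scheme \<Rightarrow> ('a \<Rightarrow> complex) set"
  where "Irr H = {rep_character H n \<rho> | n \<rho>. irreducible_rep H n \<rho>}"


section \<open>Restriction and blocks\<close>

definition res :: "'a set \<Rightarrow> ('a \<Rightarrow> complex) \<Rightarrow> 'a \<Rightarrow> complex"
  where "res C f = (\<lambda>x. if x \<in> C then f x else 0)"

definition d_coeff ::
  "'a set set \<Rightarrow> ('a \<Rightarrow> complex) set \<Rightarrow> ('a \<Rightarrow> complex) \<Rightarrow> ('a \<Rightarrow> complex) \<Rightarrow> int"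
  where "d_coeff \<C> b \<chi> \<phi> = zfun.representation b (res (\<Union>\<C>) \<chi>) \<phi>"

definition block_link ::
  "('a, 'm) monoid_scheme \<Rightarrow> 'a set set \<Rightarrow> ('a \<Rightarrow> complex) set \<Rightarrow> ('a \<Rightarrow> complex) rel"
  where "block_link H \<C> b = {(\<chi>, \<chi>'). \<chi> \<in> Irr H \<and> \<chi>' \<in> Irr H \<and>
    (\<exists>\<phi>\<in>b. d_coeff \<C> b \<chi> \<phi> \<noteq> 0 \<and> d_coeff \<C> b \<chi>' \<phi> \<noteq> 0)}"

definition blocks ::
  "('a, 'm) monoid_scheme \<Rightarrow> 'a set set \<Rightarrow> ('a \<Rightarrow> complex) set \<Rightarrow> ('a \<Rightarrow> complex) set set"
  where "blocks H \<C> b = Irr H // (block_link H \<C> b)\<^sup>*"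

text \<open>
  A union \<open>B\<close> of blocks is represented by its set \<open>Irr(B)\<close> of irreducible characters, so that
  \<open>cfun.span B\<close> is the space usually written \<open>\<complex>Irr(B)\<close>.
\<close>

definition block_union ::
  "('a, 'm) monoid_scheme \<Rightarrow> 'a set set \<Rightarrow> ('a \<Rightarrow> complex) set \<Rightarrow> ('a \<Rightarrow> complex) set \<Rightarrow> bool"
  where "block_union H \<C> b B \<longleftrightarrow> (\<exists>\<B>. \<B> \<subseteq> blocks H \<C> b \<and> B = \<Union>\<B>)"

definition basis_part ::
  "'a set set \<Rightarrow> ('a \<Rightarrow> complex) set \<Rightarrow> ('a \<Rightarrow> complex) set \<Rightarrow> ('a \<Rightarrow> complex) set"
  where "basis_part \<C> b B = {\<phi>\<in>b. \<exists>\<chi>\<in>B. d_coeff \<C> b \<chi> \<phi> \<noteq> 0}"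


section \<open>MN-structures\<close>

text \<open>
  The data of an MN-structure.  For \<open>x\<close> in \<open>mn_S M\<close>: \<open>mn_sub M x\<close> is (the carrier of) the subgroup
  \<open>G\<^sub>x\<close>, \<open>mn_basis M x\<close> the integral basis with respect to which the blocks of \<open>G\<^sub>x\<close> are formed,
  \<open>mn_block M x\<close> the set of irreducible characters of the union of blocks \<open>B\<^sub>x\<close>, and
  \<open>mn_r M x\<close> the map \<open>r\<^sup>x\<close>.
\<close>

record 'a mn_data =
  mn_S :: "'a set"
  mn_A :: "('a \<times> 'a) set"
  mn_sub :: "'a \<Rightarrow> 'a set"
  mn_basis :: "'a \<Rightarrow> ('a \<Rightarrow> complex) set"
  mn_block :: "'a \<Rightarrow> ('a \<Rightarrow> complex) set"
  mn_r :: "'a \<Rightarrow> ('a \<Rightarrow> complex) \<Rightarrow> 'a \<Rightarrow> complex"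

definition mn_grp :: "('a, 'm) monoid_scheme \<Rightarrow> 'a mn_data \<Rightarrow> 'a \<Rightarrow> ('a, 'm) monoid_scheme"
  where "mn_grp G M x = G\<lparr>carrier := mn_sub M x\<rparr>"

definition mn_classes :: "('a, 'm) monoid_scheme \<Rightarrow> 'a set set \<Rightarrow> 'a mn_data \<Rightarrow> 'a \<Rightarrow> 'a set set"
  where "mn_classes G \<C> M x = conj_class (mn_grp G M x) ` (mn_sub M x \<inter> \<Union>\<C>)"

text \<open>
  The product \<open>x\<^sub>S \<cdot> x\<^sub>C\<close> of a pair in \<open>A\<close> is required to be the group product, so no separate symbol
  is introduced for it.  The equivariance \<open>\<^sup>g(x\<^sub>S \<cdot> x\<^sub>C) = (\<^sup>gx\<^sub>S) \<cdot> (\<^sup>gx\<^sub>C)\<close> then says that \<open>A\<close> is stable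
  under simultaneous conjugation.  \<open>b\<close> is the basis used to define the blocks making up \<open>B\<close>; it is
  also the basis attached to \<open>\<one>\<close>, since \<open>G\<^sub>1 = G\<close> and \<open>B\<^sub>1 = B\<close>.
\<close>

definition mn_structure ::
  "('a, 'm) monoid_scheme \<Rightarrow> 'a set set \<Rightarrow> ('a \<Rightarrow> complex) set \<Rightarrow> ('a \<Rightarrow> complex) set
    \<Rightarrow> 'a mn_data \<Rightarrow> bool"
  where "mn_structure G \<C> b B M \<longleftrightarrow>
    mn_S M \<subseteq> carrier G \<and> \<one>\<^bsub>G\<^esub> \<in> mn_S M \<and>
    (\<forall>g\<in>carrier G. \<forall>s\<in>mn_S M. cj G g s \<in> mn_S M) \<and>

    mn_A M \<subseteq> mn_S M \<times> \<Union>\<C> \<and>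
    bij_betw (\<lambda>(s, c). s \<otimes>\<^bsub>G\<^esub> c) (mn_A M) (carrier G) \<and>
    (\<forall>(s, c)\<in>mn_A M. \<forall>g\<in>carrier G. (cj G g s, cj G g c) \<in> mn_A M \<and>
       cj G g (s \<otimes>\<^bsub>G\<^esub> c) = cj G g s \<otimes>\<^bsub>G\<^esub> cj G g c) \<and>
    (\<forall>(s, c)\<in>mn_A M. s \<otimes>\<^bsub>G\<^esub> c = c \<otimes>\<^bsub>G\<^esub> s) \<and>
    (\<forall>s\<in>mn_S M. (s, \<one>\<^bsub>G\<^esub>) \<in> mn_A M) \<and> (\<forall>c\<in>\<Union>\<C>. (\<one>\<^bsub>G\<^esub>, c) \<in> mn_A M) \<and>

    (\<forall>s\<in>mn_S M. subgroup (mn_sub M s) G \<and> (\<forall>h\<in>mn_sub M s. h \<otimes>\<^bsub>G\<^esub> s = s \<otimes>\<^bsub>G\<^esub> h) \<and>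
       mn_sub M s \<inter> \<Union>\<C> = {c \<in> \<Union>\<C>. (s, c) \<in> mn_A M}) \<and>

    (\<forall>s\<in>mn_S M.
       z_basis (mn_basis M s)
         (res (\<Union>(mn_classes G \<C> M s)) ` zfun.span (Irr (mn_grp G M s))) \<and>
       block_union (mn_grp G M s) (mn_classes G \<C> M s) (mn_basis M s) (mn_block M s) \<and>
       linear_on (cfun.span B) (mn_r M s) \<and>
       mn_r M s ` cfun.span B \<subseteq> cfun.span (mn_block M s) \<and>
       (\<forall>\<chi>\<in>cfun.span B. \<forall>c. (s, c) \<in> mn_A M \<longrightarrow> mn_r M s \<chi> c = \<chi> (s \<otimes>\<^bsub>G\<^esub> c))) \<and>
    mn_sub M \<one>\<^bsub>G\<^esub> = carrier G \<and> mn_basis M \<one>\<^bsub>G\<^esub> = b \<and> mn_block M \<one>\<^bsub>G\<^esub> = B \<and>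
    (\<forall>\<chi>\<in>cfun.span B. mn_r M \<one>\<^bsub>G\<^esub> \<chi> = \<chi>)"

definition mn_Lambda :: "('a, 'm) monoid_scheme \<Rightarrow> 'a mn_data \<Rightarrow> 'a set set"
  where "mn_Lambda G M = {lam \<in> conj_classes G. lam \<subseteq> mn_S M}"

text \<open>
  In the following definitions \<open>x\<close> is the chosen representative \<open>x\<^sub>\<lambda>\<close> of a class \<open>\<lambda>\<close>, so that
  \<open>mn_b\<close>, \<open>mn_d\<close> and \<open>mn_e\<close> are \<open>b\<^sub>\<lambda>\<close>, \<open>d\<^sub>\<lambda>\<close> and \<open>e\<^sub>\<lambda>\<close>.
\<close>

definition mn_b :: "('a, 'm) monoid_scheme \<Rightarrow> 'a set set \<Rightarrow> 'a mn_data \<Rightarrow> 'a \<Rightarrow> ('a \<Rightarrow> complex) set"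
  where "mn_b G \<C> M x = basis_part (mn_classes G \<C> M x) (mn_basis M x) (mn_block M x)"

definition mn_d ::
  "'a set set \<Rightarrow> 'a mn_data \<Rightarrow> 'a \<Rightarrow> ('a \<Rightarrow> complex) \<Rightarrow> 'a \<Rightarrow> complex"
  where "mn_d \<C> M x = res (\<Union>\<C> \<inter> mn_sub M x) \<circ> mn_r M x"

definition mn_e ::
  "('a, 'm) monoid_scheme \<Rightarrow> 'a set set \<Rightarrow> ('a \<Rightarrow> complex) set \<Rightarrow> 'a mn_data \<Rightarrow> 'a
    \<Rightarrow> ('a \<Rightarrow> complex) \<Rightarrow> 'a \<Rightarrow> complex"
  where "mn_e G \<C> B M x =
    adjoint G (mn_grp G M x) (cfun.span B) (cfun.span B) (mn_d \<C> M x)"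

definition transporter_set :: "('a, 'm) monoid_scheme \<Rightarrow> 'a \<Rightarrow> 'a \<Rightarrow> 'a \<Rightarrow> 'a set"
  where "transporter_set G x s c = {cj G t c | t. t \<in> carrier G \<and> cj G t s = x}"

definition class_reps :: "('a, 'm) monoid_scheme \<Rightarrow> 'a set \<Rightarrow> 'a set \<Rightarrow> bool"
  where "class_reps H X R \<longleftrightarrow> R \<subseteq> X \<and> (\<forall>y\<in>X. \<exists>!z. z \<in> R \<and> z \<in> conj_class H y)"

text \<open>
  \<open>mn_reps G M x E\<close>: for \<open>\<lambda> \<in> \<Lambda>\<close> and \<open>(s, c) \<in> A\<close> with \<open>s \<in> \<lambda>\<close>, the set \<open>E \<lambda> s c\<close> is a choice of
  \<open>\<E>\<^sup>\<lambda>\<close> with lower indices \<open>s, c\<close>.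
\<close>

definition mn_reps ::
  "('a, 'm) monoid_scheme \<Rightarrow> 'a mn_data \<Rightarrow> ('a set \<Rightarrow> 'a) \<Rightarrow> ('a set \<Rightarrow> 'a \<Rightarrow> 'a \<Rightarrow> 'a set) \<Rightarrow> bool"
  where "mn_reps G M x E \<longleftrightarrow> (\<forall>lam\<in>mn_Lambda G M. \<forall>(s, c)\<in>mn_A M. s \<in> lam \<longrightarrow>
    class_reps (mn_grp G M (x lam)) (transporter_set G (x lam) s c) (E lam s c))"

definition mn_parts :: "('a, 'm) monoid_scheme \<Rightarrow> 'a mn_data \<Rightarrow> 'a \<Rightarrow> 'a \<times> 'a"
  where "mn_parts G M = the_inv_into (mn_A M) (\<lambda>(s, c). s \<otimes>\<^bsub>G\<^esub> c)"

definition mn_l ::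
  "('a, 'm) monoid_scheme \<Rightarrow> 'a mn_data \<Rightarrow> ('a set \<Rightarrow> 'a \<Rightarrow> 'a \<Rightarrow> 'a set) \<Rightarrow> 'a set
    \<Rightarrow> ('a \<Rightarrow> complex) \<Rightarrow> 'a \<Rightarrow> complex"
  where "mn_l G M E lam \<psi> g =
    (let (s, c) = mn_parts G M g in
      if g \<in> carrier G \<and> s \<in> lam
      then (\<Sum>y\<in>E lam s c. \<psi> y) / of_nat (card (E lam s c)) else 0)"

definition mn_Zb_const ::
  "('a, 'm) monoid_scheme \<Rightarrow> 'a set set \<Rightarrow> 'a mn_data \<Rightarrow> ('a set \<Rightarrow> 'a)
    \<Rightarrow> ('a set \<Rightarrow> 'a \<Rightarrow> 'a \<Rightarrow> 'a set) \<Rightarrow> 'a set \<Rightarrow> ('a \<Rightarrow> complex) set"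
  where "mn_Zb_const G \<C> M x E lam = {f \<in> zfun.span (mn_b G \<C> M (x lam)).
    \<forall>y \<in> \<Union>\<C> \<inter> mn_sub M (x lam).
      \<forall>u \<in> E lam (x lam) y. \<forall>v \<in> E lam (x lam) y. f u = f v}"

definition kernel_hat ::
  "('a \<Rightarrow> complex) set \<Rightarrow> (('a \<Rightarrow> complex) \<Rightarrow> 'b \<Rightarrow> complex) \<Rightarrow> 'a \<Rightarrow> 'b \<Rightarrow> complex"
  where "kernel_hat B T x x' = (\<Sum>\<chi>\<in>B. cnj (\<chi> x) * T \<chi> x')"

end

theory Submission
  imports Defs "Jordan_Normal_Form.Schur_Decomposition" "HOL-Algebra.Multiplicative_Group"
begin

text \<open>
  Write \<open>I\<close> for the isometry attached to the class \<open>{1}\<close>.  The value at \<open>x' = s \<cdot> c\<close> of a function \<open>f\<close>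
  in \<open>\<complex>Irr(B')\<close> can be read off after moving \<open>s\<close> to the representative of its class \<open>\<lambda>'\<close>: it is the
  value of \<open>d'\<^bsub>\<lambda>'\<^esub> f\<close> at each of the conjugates of \<open>c\<close> that arise.  As \<open>l'\<^bsub>\<lambda>'\<^esub>\<close> averages over these
  conjugates, \<open>f\<close> is the sum of all \<open>l'\<^bsub>\<lambda>'\<^esub>(d'\<^bsub>\<lambda>'\<^esub> f)\<close>, and only the classes in \<open>\<Lambda>\<^sub>0'\<close> contribute
  (\<open>value_decomposition\<close>).  For \<open>f = I(\<chi>)\<close> one has \<open>d'\<^bsub>\<sigma>(\<lambda>)\<^esub>(I(\<chi>)) = I\<^sub>\<lambda>(d\<^sub>\<lambda> \<chi>)\<close>, because \<open>I\<^sub>\<lambda>\<close> is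
  compatible with the maps \<open>r\<close> and commutes with restriction to \<open>C\<close> (\<open>res_commute\<close>), and \<open>I\<^sub>\<lambda>\<close>
  restricted to \<open>\<complex>b\<^sub>\<lambda>\<close> is the inverse of the adjoint of \<open>J\<^sub>\<lambda>\<close> (\<open>adjoint_inverse\<close>).  Expanding \<open>d\<^sub>\<lambda> \<chi>\<close> in
  the adapted basis produces the coefficients \<open>\<langle>d\<^sub>\<lambda> \<chi>, \<Phi>\<^sub>\<phi>\<rangle>\<close>; multiplied by the conjugate of \<open>\<chi>(x)\<close> and
  summed over the orthonormal set \<open>Irr(B)\<close>, they become the conjugate of \<open>e\<^sub>\<lambda>(\<Phi>\<^sub>\<phi>)(x)\<close> (\<open>mn_e_eq\<close>).

  Two points go beyond linear algebra.  First, \<open>I\<^sub>\<lambda>\<close> is an isometry on \<open>\<complex>Irr(B\<^sub>\<lambda>)\<close>, so it must be known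
  that \<open>\<complex>b\<^sub>\<lambda>\<close> lies in this space (\<open>part_in_block\<close>).  The vector dual to \<open>\<phi>\<close> with respect to the
  whole integral basis is \<open>\<Sum>\<^sub>\<chi> d\<^sub>\<chi>\<^sub>\<phi> \<chi>\<close>, since irreducible characters form an
  orthonormal basis of the class functions, and all \<open>\<chi>\<close> with \<open>d\<^sub>\<chi>\<^sub>\<phi> \<noteq> 0\<close> belong to one block.

  Secondly, the asserted sum runs over \<open>\<bb>\<^sub>\<lambda>\<^sup>\<C>\<close> instead of \<open>\<bb>\<^sub>\<lambda>\<close>.  The function \<open>d\<^sub>\<lambda> \<chi>\<close> is a complex
  combination of \<open>b\<^sub>\<lambda>\<close> that is constant on the sets \<open>\<E>\<close>, whereas \<open>\<bb>\<^sub>\<lambda>\<^sup>\<C>\<close> spans the integral combinations with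
  this property.  Constancy is a system of linear equations with cyclotomic coefficients, whose complex
  solutions need not be spanned by integral ones in general.  They are here, because the system is
  stable under Galois conjugation, which replaces an equation for \<open>(u, v)\<close> by the one for
  \<open>(u\<^sup>k, v\<^sup>k)\<close> (\<open>rational_descent\<close>).  That \<open>u\<^sup>k\<close> stays in \<open>C\<close> is a consequence of the assumption that
  the integral basis is linearly independent over the complex numbers (\<open>powers_closed\<close>).
\<close>

section \<open>The hermitian product and dual bases\<close>

lemma sum_fun_apply: "(\<Sum>i\<in>A. f i) x = (\<Sum>i\<in>A. f i x)"
  by (induction A rule: infinite_finite_induct) auto

lemma cscale_apply: "cscale c f x = c * f x" by (simp add: cscale_def)

locale fin_grp = group H for H :: "('a, 'm) monoid_scheme" (structure) +
  assumes fin: "finite (carrier H)"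

definition supp_on :: "('a, 'm) monoid_scheme \<Rightarrow> ('a \<Rightarrow> complex) set"
  where "supp_on H = {f. \<forall>x. x \<notin> carrier H \<longrightarrow> f x = 0}"

lemma subspace_supp_on: "cfun.subspace (supp_on H)"
  unfolding cfun.subspace_def supp_on_def by (auto simp: cscale_def)

lemma herm_add_left: "herm H (f + g) h = herm H f h + herm H g h"
  by (simp add: herm_def algebra_simps sum.distrib add_divide_distrib)
lemma herm_diff_left: "herm H (f - g) h = herm H f h - herm H g h"
  by (simp add: herm_def algebra_simps sum_subtractf diff_divide_distrib)
lemma herm_scale_left: "herm H (cscale c f) h = c * herm H f h"
  by (simp add: herm_def cscale_def sum_distrib_left mult_ac)
lemma herm_zero_left: "herm H 0 h = 0" by (simp add: herm_def)
lemma herm_sum_left: "herm H (\<Sum>i\<in>A. f i) h = (\<Sum>i\<in>A. herm H (f i) h)"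
  by (induction A rule: infinite_finite_induct) (simp_all only: not_False_eq_True sum.infinite sum.empty sum.insert herm_zero_left herm_add_left)
lemma herm_cnj: "cnj (herm H f h) = herm H h f"
  by (simp add: herm_def mult.commute)
lemma herm_add_right: "herm H h (f + g) = herm H h f + herm H h g"
  by (metis herm_cnj herm_add_left complex_cnj_add)
lemma herm_diff_right: "herm H h (f - g) = herm H h f - herm H h g"
  by (metis herm_cnj herm_diff_left complex_cnj_diff)
lemma herm_scale_right: "herm H h (cscale c f) = cnj c * herm H h f"
  by (metis herm_cnj herm_scale_left complex_cnj_mult)
lemma herm_zero_right: "herm H h 0 = 0" by (simp add: herm_def)
lemma herm_sum_right: "herm H h (\<Sum>i\<in>A. f i) = (\<Sum>i\<in>A. herm H h (f i))"
  by (induction A rule: infinite_finite_induct) (simp_all only: not_False_eq_True sum.infinite sum.empty sum.insert herm_zero_right herm_add_right)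

lemmas herm_linear = herm_add_left herm_diff_left herm_scale_left herm_zero_left herm_sum_left
  herm_add_right herm_diff_right herm_scale_right herm_zero_right herm_sum_right

lemma herm_cong:
  assumes "\<And>x. x \<in> carrier H \<Longrightarrow> f x * cnj (h x) = f' x * cnj (h' x)"
  shows "herm H f h = herm H f' h'"
  unfolding herm_def using assms by (simp cong: sum.cong)

lemma herm_span_right_zero:
  assumes "w \<in> cfun.span S" "\<And>s. s \<in> S \<Longrightarrow> herm H g s = 0"
  shows "herm H g w = 0"
  using assms(1)
  by (induction rule: cfun.span_induct) (auto simp: cfun.subspace_def herm_linear assms(2))

lemma herm_span_left_zero:
  assumes "w \<in> cfun.span S" "\<And>s. s \<in> S \<Longrightarrow> herm H s g = 0"
  shows "herm H w g = 0"
  using assms(1)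
  by (induction rule: cfun.span_induct) (auto simp: cfun.subspace_def herm_linear assms(2))

context fin_grp
begin

lemma card_pos: "card (carrier H) > 0"
  using fin one_closed card_gt_0_iff by blast

lemma herm_self_zero:
  assumes "herm H f f = 0" "x \<in> carrier H" shows "f x = 0"
proof -
  have "(\<Sum>x\<in>carrier H. f x * cnj (f x)) = 0"
    using assms(1) card_pos by (auto simp: herm_def)
  also have "(\<Sum>x\<in>carrier H. f x * cnj (f x)) = of_real (\<Sum>x\<in>carrier H. (cmod (f x))\<^sup>2)"
    by (simp add: complex_norm_square[symmetric])
  finally have "(\<Sum>x\<in>carrier H. (cmod (f x))\<^sup>2) = 0" by (metis of_real_eq_0_iff)
  thus ?thesis using assms(2) fin by (simp add: sum_nonneg_eq_0_iff)
qed

lemma herm_self_zero_supp: "herm H f f = 0 \<Longrightarrow> f \<in> supp_on H \<Longrightarrow> f = 0"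
  using herm_self_zero by (fastforce simp: supp_on_def fun_eq_iff)

text \<open>
  Gram-Schmidt, one vector at a time.  The set may be dependent: a vector that reduces to one of
  length zero vanishes on the group, and then the division by zero below harmlessly yields zero.
\<close>

lemma projection_exists:
  assumes "finite S"
  shows "\<exists>w\<in>cfun.span S. \<forall>s\<in>S. herm H (f - w) s = 0"
  using assms
proof (induction S arbitrary: f rule: finite_induct)
  case empty
  then show ?case by (auto simp: cfun.span_zero)
next
  case (insert s S)
  obtain ws where ws: "ws \<in> cfun.span S" "\<And>t. t \<in> S \<Longrightarrow> herm H (s - ws) t = 0"
    using insert.IH by blast
  obtain wf where wf: "wf \<in> cfun.span S" "\<And>t. t \<in> S \<Longrightarrow> herm H (f - wf) t = 0"
    using insert.IH by blast
  define q where "q = s - ws"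
  define g where "g = f - wf"
  \<comment> \<open>The coefficient is zero when \<open>q\<close> has length zero, by the convention on division by zero.\<close>
  define c where "c = herm H g q / herm H q q"
  have cq: "herm H g q = c * herm H q q"
  proof (cases "herm H q q = 0")
    case True
    then have "\<And>x. x \<in> carrier H \<Longrightarrow> q x = 0" by (rule herm_self_zero)
    hence "herm H g q = 0" by (simp add: herm_def)
    thus ?thesis using True by simp
  qed (simp add: c_def)
  have sub: "cfun.span S \<subseteq> cfun.span (insert s S)" by (rule cfun.span_mono) auto
  have s_in: "s \<in> cfun.span (insert s S)" by (rule cfun.span_base) simp
  define w where "w = wf + cscale c q"
  have "w \<in> cfun.span (insert s S)"
    unfolding w_def q_def using sub ws(1) wf(1) s_in
    by (intro cfun.span_add cfun.span_scale cfun.span_diff) auto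
  moreover have fw: "f - w = g - cscale c q" by (simp add: w_def g_def)
  have perp: "herm H (f - w) t = 0" if "t \<in> S" for t
    using ws(2)[OF that] wf(2)[OF that] unfolding fw g_def[symmetric] q_def[symmetric]
    by (simp add: herm_linear)
  moreover have "herm H (f - w) s = 0"
  proof -
    have "herm H (f - w) ws = 0" using herm_span_right_zero[OF ws(1)] perp by blast
    moreover have "herm H (f - w) q = 0" unfolding fw using cq by (simp add: herm_linear)
    moreover have "s = q + ws" by (simp add: q_def)
    ultimately show ?thesis by (simp add: herm_add_right)
  qed
  ultimately show ?case by blast
qed

lemma span_nondegenerate:
  assumes "b \<subseteq> supp_on H" "\<psi> \<in> cfun.span b" "\<And>\<theta>. \<theta> \<in> b \<Longrightarrow> herm H \<psi> \<theta> = 0"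
  shows "\<psi> = 0"
proof -
  have "\<psi> \<in> supp_on H"
    using assms(1,2) cfun.span_minimal[OF _ subspace_supp_on] by blast
  thus ?thesis using herm_span_right_zero[OF assms(2,3)] herm_self_zero_supp by blast
qed

text \<open>
  The dual vector is the component of \<open>\<phi>\<close> orthogonal to the other members of \<open>b\<close>, rescaled.
\<close>

lemma dual_exists:
  assumes b: "finite b" "cfun.independent b" "b \<subseteq> supp_on H" and "\<phi> \<in> b"
  shows "\<exists>\<psi>\<in>cfun.span b. \<forall>\<theta>\<in>b. herm H \<psi> \<theta> = (if \<theta> = \<phi> then 1 else 0)"
proof -
  obtain w where w: "w \<in> cfun.span (b - {\<phi>})" "\<And>s. s \<in> b - {\<phi>} \<Longrightarrow> herm H (\<phi> - w) s = 0"
    using projection_exists[of "b - {\<phi>}" \<phi>] b(1) by auto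
  define q where "q = \<phi> - w"
  have w_b: "w \<in> cfun.span b" using w(1) cfun.span_mono[of "b - {\<phi>}" b] by blast
  have q_in: "q \<in> cfun.span b" unfolding q_def
    using w_b \<open>\<phi> \<in> b\<close> by (intro cfun.span_diff) (auto intro: cfun.span_base)
  have "q \<noteq> 0"
  proof
    assume "q = 0"
    hence "\<phi> \<in> cfun.span (b - {\<phi>})" using w(1) by (simp add: q_def)
    thus False using b(2) \<open>\<phi> \<in> b\<close> cfun.dependent_def by blast
  qed
  moreover have "q \<in> supp_on H"
    using q_in b(3) cfun.span_minimal[OF _ subspace_supp_on] by blast
  ultimately have nz: "herm H q q \<noteq> 0" using herm_self_zero_supp by blast
  have "herm H q w = 0" using herm_span_right_zero[OF w(1)] w(2) q_def by blast
  hence "herm H q \<phi> = herm H q q" by (simp add: q_def herm_linear)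
  hence "\<forall>\<theta>\<in>b. herm H (cscale (1 / herm H q q) q) \<theta> = (if \<theta> = \<phi> then 1 else 0)"
    using w(2) nz by (auto simp: herm_linear q_def)
  thus ?thesis using q_in cfun.span_scale by blast
qed

lemma dual_elt:
  assumes b: "finite b" "cfun.independent b" "b \<subseteq> supp_on H" and "\<phi> \<in> b"
  shows dual_elt_in_span: "dual_elt H b \<phi> \<in> cfun.span b"
    and herm_dual_elt: "\<theta> \<in> b \<Longrightarrow> herm H (dual_elt H b \<phi>) \<theta> = (if \<theta> = \<phi> then 1 else 0)"
proof -
  let ?P = "\<lambda>\<psi>. \<psi> \<in> cfun.span b \<and> (\<forall>\<theta>\<in>b. herm H \<psi> \<theta> = (if \<theta> = \<phi> then 1 else 0))"
  have "\<exists>!\<psi>. ?P \<psi>"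
  proof (rule ex_ex1I)
    show "\<exists>\<psi>. ?P \<psi>" using dual_exists[OF assms] by blast
  next
    fix u v assume uv: "?P u" "?P v"
    have "u - v = 0"
      by (rule span_nondegenerate[OF b(3)]) (use uv in \<open>auto simp: cfun.span_diff herm_linear\<close>)
    thus "u = v" by simp
  qed
  from theI'[OF this] have "?P (dual_elt H b \<phi>)" unfolding dual_elt_def .
  thus "dual_elt H b \<phi> \<in> cfun.span b"
    "\<theta> \<in> b \<Longrightarrow> herm H (dual_elt H b \<phi>) \<theta> = (if \<theta> = \<phi> then 1 else 0)" by auto
qed

lemma herm_dual_elt_right:
  assumes "finite b" "cfun.independent b" "b \<subseteq> supp_on H" "\<phi> \<in> b" "\<theta> \<in> b"
  shows "herm H \<theta> (dual_elt H b \<phi>) = (if \<theta> = \<phi> then 1 else 0)"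
  using arg_cong[OF herm_dual_elt[OF assms(1-4) assms(5)], of cnj] by (simp add: herm_cnj)

lemma span_expand_dual:
  assumes b: "finite b" "cfun.independent b" "b \<subseteq> supp_on H" and f: "f \<in> cfun.span b"
  shows "f = (\<Sum>\<phi>\<in>b. cscale (herm H f \<phi>) (dual_elt H b \<phi>))"
proof -
  have "f - (\<Sum>\<phi>\<in>b. cscale (herm H f \<phi>) (dual_elt H b \<phi>)) = 0"
  proof (rule span_nondegenerate[OF b(3)])
    show "f - (\<Sum>\<phi>\<in>b. cscale (herm H f \<phi>) (dual_elt H b \<phi>)) \<in> cfun.span b"
      using dual_elt_in_span[OF b] f
      by (intro cfun.span_diff cfun.span_sum cfun.span_scale) auto
    show "herm H (f - (\<Sum>\<phi>\<in>b. cscale (herm H f \<phi>) (dual_elt H b \<phi>))) \<theta> = 0" if "\<theta> \<in> b" for \<theta>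
      using b(1) that
      by (simp add: herm_linear herm_dual_elt[OF b] if_distrib cong: if_cong sum.cong)
  qed
  thus ?thesis by simp
qed

lemma span_expand:
  assumes b: "finite b" "cfun.independent b" "b \<subseteq> supp_on H" and f: "f \<in> cfun.span b"
  shows "f = (\<Sum>\<phi>\<in>b. cscale (herm H f (dual_elt H b \<phi>)) \<phi>)"
proof -
  obtain r where r: "f = (\<Sum>\<phi>\<in>b. cscale (r \<phi>) \<phi>)"
    using f cfun.span_finite[OF b(1)] by auto
  have "herm H f (dual_elt H b \<phi>) = r \<phi>" if "\<phi> \<in> b" for \<phi>
    using b(1) that
    by (simp add: r herm_linear herm_dual_elt_right[OF b] if_distrib cong: if_cong sum.cong)
  thus ?thesis using r by (simp cong: sum.cong)
qed

lemma span_dual_basis: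
  assumes b: "finite b" "cfun.independent b" "b \<subseteq> supp_on H"
  shows "cfun.span (dual_basis H b) = cfun.span b"
proof
  show "cfun.span (dual_basis H b) \<subseteq> cfun.span b"
    by (rule cfun.span_minimal) (auto simp: dual_basis_def dual_elt_in_span[OF b])
  show "cfun.span b \<subseteq> cfun.span (dual_basis H b)"
  proof
    fix f assume "f \<in> cfun.span b"
    from span_expand_dual[OF b this] show "f \<in> cfun.span (dual_basis H b)"
      by (metis (no_types, lifting) cfun.span_base cfun.span_scale cfun.span_sum dual_basis_def imageI)
  qed
qed

lemma supp_on_indicators:
  "supp_on H \<subseteq> cfun.span ((\<lambda>a x. if x = a then 1 else 0) ` carrier H)"
proof
  fix f assume f: "f \<in> supp_on H"
  have "f = (\<Sum>a\<in>carrier H. cscale (f a) (\<lambda>x. if x = a then 1 else 0))"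
    using f fin by (auto simp: fun_eq_iff sum_fun_apply cscale_apply supp_on_def if_distrib cong: if_cong)
  also have "\<dots> \<in> cfun.span ((\<lambda>a x. if x = a then 1 else 0) ` carrier H)"
    by (intro cfun.span_sum cfun.span_scale cfun.span_base) auto
  finally show "f \<in> \<dots>" .
qed

lemma finite_independent:
  assumes "cfun.independent b" "b \<subseteq> supp_on H" shows "finite b"
  using cfun.independent_span_bound[OF _ assms(1)] supp_on_indicators assms(2) fin by blast

end

lemma adjointI:
  assumes "\<psi> \<in> U" "\<And>\<chi>. \<chi> \<in> V \<Longrightarrow> herm H \<psi> \<chi> = herm K \<phi> (T \<chi>)"
    and "cfun.subspace U" "\<And>u. u \<in> U \<Longrightarrow> (\<And>v. v \<in> V \<Longrightarrow> herm H u v = 0) \<Longrightarrow> u = 0"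
  shows "adjoint H K U V T \<phi> = \<psi>"
  unfolding adjoint_def
proof (rule the_equality)
  show "\<psi> \<in> U \<and> (\<forall>\<chi>\<in>V. herm H \<psi> \<chi> = herm K \<phi> (T \<chi>))" using assms by blast
  fix \<psi>' assume *: "\<psi>' \<in> U \<and> (\<forall>\<chi>\<in>V. herm H \<psi>' \<chi> = herm K \<phi> (T \<chi>))"
  have "\<psi>' - \<psi> = 0" using * assms by (intro assms(4)) (auto simp: herm_linear cfun.subspace_diff)
  thus "\<psi>' = \<psi>" by simp
qed

section \<open>Integral lattices and rational independence\<close>

definition rat_independent :: "'i set \<Rightarrow> ('i \<Rightarrow> complex) \<Rightarrow> bool"
  where "rat_independent B \<gamma> \<longleftrightarrow>
    (\<forall>m. (\<Sum>i\<in>B. of_rat (m i) * \<gamma> i) = 0 \<longrightarrow> (\<forall>i\<in>B. m i = 0))"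

lemma rat_independentD_int:
  assumes "rat_independent B \<gamma>" "(\<Sum>i\<in>B. of_int (m i) * \<gamma> i) = 0" "i \<in> B"
  shows "m i = 0"
proof -
  have "(\<Sum>i\<in>B. of_rat (of_int (m i)) * \<gamma> i) = 0" using assms(2) by simp
  then show ?thesis using assms(1,3) unfolding rat_independent_def by (metis of_int_eq_0_iff)
qed

lemma common_denominator:
  fixes X :: "rat set"
  assumes "finite X"
  shows "\<exists>D::int. D > 0 \<and> (\<forall>x\<in>X. of_int D * x \<in> \<int>)"
  using assms
proof (induction X rule: finite_induct)
  case (insert x X)
  then obtain D :: int where D: "D > 0" "\<And>y. y \<in> X \<Longrightarrow> of_int D * y \<in> \<int>" by blast
  obtain p q where x: "x = of_int p / of_int q" "q > 0"
    by (metis quotient_of_denom_pos quotient_of_div surj_pair)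
  have "of_int (D * q) * y \<in> \<int>" if "y \<in> insert x X" for y
  proof (cases "y = x")
    case True
    then have "of_int (D * q) * y = of_int (D * p)" using x by simp
    then show ?thesis by (metis Ints_of_int)
  next
    case False
    then have "of_int q * (of_int D * y) \<in> \<int>" using D(2)[of y] that False Ints_mult[OF Ints_of_int] by blast
    moreover have "of_int q * (of_int D * y) = of_int (D * q) * y" by simp
    ultimately show ?thesis by metis
  qed
  moreover have "D * q > 0" using D x by simp
  ultimately show ?case by blast
qed (auto intro: exI[of _ 1])

text \<open>
  Finitely many complex numbers span a finite-dimensional rational space.  Coordinates with respect to
  a rational basis, after clearing denominators, split one complex linear relation with integral
  coefficients into several integral ones.  All descent arguments below rest on this device.
\<close>

lemma rational_coordinates:
  fixes a :: "'s \<Rightarrow> complex"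
  assumes "finite S"
  obtains B :: "complex set" and \<gamma> and n :: "'s \<Rightarrow> complex \<Rightarrow> int"
  where "finite B" "rat_independent B \<gamma>" "\<And>s. s \<in> S \<Longrightarrow> a s = (\<Sum>i\<in>B. of_int (n s i) * \<gamma> i)"
proof -
  interpret q: Vector_Spaces.vector_space "\<lambda>(r::rat) (z::complex). of_rat r * z"
    by unfold_locales (simp_all add: ring_distribs of_rat_add of_rat_mult)
  obtain B where B: "B \<subseteq> a ` S" "q.independent B" "a ` S \<subseteq> q.span B"
    using q.maximal_independent_subset by blast
  have finB: "finite B" using B(1) assms finite_subset by blast
  have "\<forall>s\<in>S. \<exists>r. a s = (\<Sum>v\<in>B. of_rat (r v) * v)"
    using B(3) q.span_finite[OF finB] by blast
  then obtain r where r: "\<And>s. s \<in> S \<Longrightarrow> a s = (\<Sum>v\<in>B. of_rat (r s v) * v)" by metis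
  obtain D :: int where D: "D > 0" "\<And>s v. s \<in> S \<Longrightarrow> v \<in> B \<Longrightarrow> of_int D * r s v \<in> \<int>"
    using common_denominator[of "(\<lambda>(s, v). r s v) ` (S \<times> B)"] assms finB by auto
  have "\<forall>s v. \<exists>k. s \<in> S \<longrightarrow> v \<in> B \<longrightarrow> of_int D * r s v = of_int k"
    using D(2) by (meson Ints_cases)
  then obtain n where n: "\<And>s v. s \<in> S \<Longrightarrow> v \<in> B \<Longrightarrow> of_int D * r s v = of_int (n s v)" by metis
  have n': "(of_rat (r s v) :: complex) = of_int (n s v) / of_int D" if "s \<in> S" "v \<in> B" for s v
  proof -
    have "r s v = of_int (n s v) / of_int D" using n[OF that] D(1) by (simp add: field_simps)
    then show ?thesis by (simp add: of_rat_divide)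
  qed
  show thesis
  proof (rule that)
    show "finite B" by fact
    \<comment> \<open>Dividing the basis by the common denominator makes the coordinates integral.\<close>
    show "rat_independent B (\<lambda>v. v / of_int D)"
      unfolding rat_independent_def
    proof (intro allI impI ballI)
      fix m v assume *: "(\<Sum>i\<in>B. of_rat (m i) * (i / of_int D)) = 0" "v \<in> B"
      have "(\<Sum>i\<in>B. of_rat (m i) * (i / of_int D)) = (\<Sum>i\<in>B. of_rat (m i) * i) / of_int D"
        by (simp add: sum_divide_distrib)
      then have "(\<Sum>i\<in>B. of_rat (m i) * i) = 0" using *(1) D(1) by simp
      then show "m v = 0" using B(2) finB *(2) q.independent_explicit_module by blast
    qed
    show "a s = (\<Sum>i\<in>B. of_int (n s i) * (i / of_int D))" if "s \<in> S" for s
      using r[OF that] n'[OF that] by simp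
  qed
qed

lemma zscale_eq_cscale: "zscale n f = cscale (of_int n) f"
  by (simp add: zscale_def cscale_def)

lemma zspan_subset_cspan: "zfun.span b \<subseteq> cfun.span b"
proof (rule zfun.span_minimal)
  show "b \<subseteq> cfun.span b" by (rule cfun.span_superset)
  show "zfun.subspace (cfun.span b)"
    unfolding zfun.subspace_def zscale_eq_cscale
    by (blast intro: cfun.span_zero cfun.span_add cfun.span_scale)
qed

lemma zspan_common_support:
  assumes "finite B" "\<And>i. i \<in> B \<Longrightarrow> w i \<in> zfun.span b"
  obtains T m where "finite T" "T \<subseteq> b" "\<And>i. i \<in> B \<Longrightarrow> w i = (\<Sum>\<theta>\<in>T. zscale (m i \<theta>) \<theta>)"
proof -
  have "\<forall>i\<in>B. \<exists>T. finite T \<and> T \<subseteq> b \<and> w i \<in> zfun.span T"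
  proof
    fix i assume "i \<in> B"
    from assms(2)[OF this] obtain t r
      where t: "finite t" "t \<subseteq> b" "w i = (\<Sum>a\<in>t. zscale (r a) a)"
      unfolding zfun.span_explicit by blast
    then have "w i \<in> zfun.span t" by (auto intro: zfun.span_sum zfun.span_scale zfun.span_base)
    then show "\<exists>T. finite T \<and> T \<subseteq> b \<and> w i \<in> zfun.span T" using t by blast
  qed
  then obtain T where T: "\<And>i. i \<in> B \<Longrightarrow> finite (T i) \<and> T i \<subseteq> b \<and> w i \<in> zfun.span (T i)"
    unfolding bchoice_iff by blast
  define U where "U = \<Union>(T ` B)"
  have U: "finite U" "U \<subseteq> b" using T assms(1) by (auto simp: U_def)
  have "w i \<in> zfun.span U" if "i \<in> B" for i
    using T[OF that] zfun.span_mono[of "T i" U] that by (auto simp: U_def)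
  then have "\<forall>i\<in>B. \<exists>m. w i = (\<Sum>\<theta>\<in>U. zscale (m \<theta>) \<theta>)"
    using zfun.span_finite[OF U(1)] by blast
  then obtain m where "\<And>i. i \<in> B \<Longrightarrow> w i = (\<Sum>\<theta>\<in>U. zscale (m i \<theta>) \<theta>)"
    unfolding bchoice_iff by blast
  then show thesis by (rule that[OF U])
qed

text \<open>
  Coordinates in \<open>b\<close> reduce the statement to one for integers: every coordinate of the sum is a
  combination of the numbers \<open>\<gamma> i\<close> with integral coefficients.
\<close>

lemma lattice_independent:
  assumes b: "cfun.independent b" and B: "finite B" "rat_independent B \<gamma>"
    and w: "\<And>i. i \<in> B \<Longrightarrow> w i \<in> zfun.span b"
    and sum: "(\<Sum>i\<in>B. cscale (\<gamma> i) (w i)) = 0" and "i \<in> B"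
  shows "w i = 0"
proof -
  obtain T m where T: "finite T" "T \<subseteq> b" "\<And>i. i \<in> B \<Longrightarrow> w i = (\<Sum>\<theta>\<in>T. zscale (m i \<theta>) \<theta>)"
    by (rule zspan_common_support[of B w b, OF B(1)]) (erule w, rule that)
  have "(\<Sum>\<theta>\<in>T. cscale (\<Sum>i\<in>B. of_int (m i \<theta>) * \<gamma> i) \<theta>) = (\<Sum>i\<in>B. cscale (\<gamma> i) (w i))"
  proof -
    have "(\<Sum>i\<in>B. cscale (\<gamma> i) (w i)) = (\<Sum>i\<in>B. \<Sum>\<theta>\<in>T. cscale (of_int (m i \<theta>) * \<gamma> i) \<theta>)"
      by (intro sum.cong refl) (simp add: T(3) fun_eq_iff cscale_def zscale_def sum_fun_apply
          sum_distrib_left mult_ac)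
    also have "\<dots> = (\<Sum>\<theta>\<in>T. \<Sum>i\<in>B. cscale (of_int (m i \<theta>) * \<gamma> i) \<theta>)" by (rule sum.swap)
    finally show ?thesis by (simp add: cfun.scale_sum_left)
  qed
  then have "(\<Sum>\<theta>\<in>T. cscale (\<Sum>i\<in>B. of_int (m i \<theta>) * \<gamma> i) \<theta>) = 0" using sum by simp
  then have "(\<Sum>i\<in>B. of_int (m i \<theta>) * \<gamma> i) = 0" if "\<theta> \<in> T" for \<theta>
    using b T(1,2) that
      cfun.independentD[of b T "\<lambda>\<theta>. \<Sum>i\<in>B. of_int (m i \<theta>) * \<gamma> i" \<theta>] by blast
  then have "m i \<theta> = 0" if "\<theta> \<in> T" for \<theta>
    using rat_independentD_int[OF B(2) _ \<open>i \<in> B\<close>, of "\<lambda>i. m i \<theta>"] that by blast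
  then show ?thesis using T(3)[OF \<open>i \<in> B\<close>] by (simp add: fun_eq_iff sum_fun_apply zscale_def)
qed

lemma combination_split:
  assumes "finite S" "\<And>s. s \<in> S \<Longrightarrow> a s = (\<Sum>i\<in>B. of_int (n s i) * \<gamma> i)"
  shows "(\<Sum>s\<in>S. cscale (a s) (v s)) = (\<Sum>i\<in>B. cscale (\<gamma> i) (\<Sum>s\<in>S. zscale (n s i) (v s)))"
proof
  fix x
  have "(\<Sum>s\<in>S. cscale (a s) (v s)) x = (\<Sum>s\<in>S. \<Sum>i\<in>B. of_int (n s i) * \<gamma> i * v s x)"
    by (simp add: sum_fun_apply cscale_def assms sum_distrib_right)
  also have "\<dots> = (\<Sum>i\<in>B. \<Sum>s\<in>S. of_int (n s i) * \<gamma> i * v s x)" by (rule sum.swap)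
  finally show "(\<Sum>s\<in>S. cscale (a s) (v s)) x = (\<Sum>i\<in>B. cscale (\<gamma> i) (\<Sum>s\<in>S. zscale (n s i) (v s))) x"
    by (simp add: sum_fun_apply cscale_def zscale_def sum_distrib_left mult_ac)
qed

text \<open>
  Independence over the integers is in general weaker than over the complex numbers; inside a lattice
  that has a complex-independent basis they agree.  This gives the adapted bases their dual bases.
\<close>

lemma lattice_basis_independent:
  assumes b: "cfun.independent b" and v: "zfun.independent v" "v \<subseteq> zfun.span b"
  shows "cfun.independent v"
  unfolding cfun.independent_explicit_module
proof (intro allI impI)
  fix t a s assume t: "finite t" "t \<subseteq> v" "(\<Sum>v\<in>t. cscale (a v) v) = 0" "s \<in> t"
  obtain B :: "complex set" and \<gamma> and n where B: "finite B" "rat_independent B \<gamma>"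
    "\<And>s. s \<in> t \<Longrightarrow> a s = (\<Sum>i\<in>B. of_int (n s i) * \<gamma> i)"
    by (rule rational_coordinates[OF t(1), of a]) (rule that)
  have "(\<Sum>i\<in>B. cscale (\<gamma> i) (\<Sum>s\<in>t. zscale (n s i) s)) = 0"
    using combination_split[OF t(1) B(3), where v = "\<lambda>x. x"] t(3) by simp
  moreover have "(\<Sum>s\<in>t. zscale (n s i) s) \<in> zfun.span b" for i
    using t(2) v(2) by (intro zfun.span_sum zfun.span_scale) auto
  ultimately have "(\<Sum>s\<in>t. zscale (n s i) s) = 0" if "i \<in> B" for i
    using lattice_independent[OF b B(1,2), where w = "\<lambda>i. \<Sum>s\<in>t. zscale (n s i) s"] that by blast
  then have "n s i = 0" if "i \<in> B" for i
    using that zfun.independentD[OF v(1) t(1,2), of "\<lambda>s. n s i" s] t(4) by blast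
  then show "a s = 0" using B(3)[OF t(4)] by simp
qed

section \<open>Galois conjugates of a root of unity\<close>

definition rpoly :: "rat poly \<Rightarrow> complex \<Rightarrow> complex"
  where "rpoly p z = poly (map_poly of_rat p) z"

lemma rpoly_0 [simp]: "rpoly 0 z = 0" by (simp add: rpoly_def)
lemma rpoly_pCons: "rpoly (pCons a p) z = of_rat a + z * rpoly p z"
  unfolding rpoly_def by (simp add: Polynomial.map_poly_pCons[where f = of_rat])
lemma rpoly_1 [simp]: "rpoly 1 z = 1" by (simp add: rpoly_def)
lemma rpoly_add: "rpoly (p + q) z = rpoly p z + rpoly q z"
  by (induction p q rule: poly_induct2) (auto simp: rpoly_pCons of_rat_add algebra_simps)
lemma rpoly_smult: "rpoly (Polynomial.smult c p) z = of_rat c * rpoly p z"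
  by (induction p) (auto simp: rpoly_pCons of_rat_mult algebra_simps)
lemma rpoly_mult: "rpoly (p * q) z = rpoly p z * rpoly q z"
  by (induction p) (auto simp: rpoly_pCons rpoly_add rpoly_smult algebra_simps)
lemma rpoly_monom: "rpoly (Polynomial.monom c k) z = of_rat c * z ^ k"
  by (simp add: rpoly_def map_poly_monom poly_monom)
lemma rpoly_diff: "rpoly (p - q) z = rpoly p z - rpoly q z"
  using rpoly_add[of "p - q" q z] by simp
lemma rpoly_sum: "rpoly (\<Sum>i\<in>A. p i) z = (\<Sum>i\<in>A. rpoly (p i) z)"
  by (induction A rule: infinite_finite_induct) (auto simp: rpoly_add)

text \<open>
  \<open>K\<close> consists of the exponents \<open>k\<close> for which \<open>\<zeta>\<^sup>k\<close> is a root of the minimal polynomial \<open>f\<close> of \<open>\<zeta>\<close>, so that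
  \<open>P(\<zeta>) \<mapsto> P(\<zeta>\<^sup>k)\<close> is a Galois conjugation.  The second property is the descent: reduce
  all \<open>P\<^sub>i\<close> modulo \<open>f\<close>; the combination of the remainders has degree less than that of \<open>f\<close> but vanishes
  at all conjugates of \<open>\<zeta>\<close>.  There are at least \<open>deg f\<close> of these, since \<open>f\<close> divides \<open>X\<^sup>m - 1\<close>, which has \<open>m\<close>
  distinct roots.  So the combination is zero, and rational independence kills each remainder.
\<close>

lemma cyclotomic_exponents:
  assumes "m > 0"
  defines "\<zeta> \<equiv> cis (2 * pi / real m)"
  obtains K :: "nat set"
  where "\<And>P k. rpoly P \<zeta> = 0 \<Longrightarrow> k \<in> K \<Longrightarrow> rpoly P (\<zeta> ^ k) = 0"
    and "\<And>(B :: complex set) \<gamma> P i. \<lbrakk>finite B; rat_independent B \<gamma>;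
      \<And>k. k \<in> K \<Longrightarrow> (\<Sum>i\<in>B. \<gamma> i * rpoly (P i) (\<zeta> ^ k)) = 0; i \<in> B\<rbrakk> \<Longrightarrow> rpoly (P i) \<zeta> = 0"
proof -
  define X :: "rat poly" where "X = Polynomial.monom 1 m - 1"
  have rX: "rpoly X z = z ^ m - 1" for z
    by (simp add: X_def rpoly_diff rpoly_monom)
  have zm: "\<zeta> ^ m = 1" using assms by (simp add: DeMoivre)
  have degX: "Polynomial.degree X = m"
    using degree_add_eq_left[of "-1" "Polynomial.monom (1::rat) m"] assms(1)
    by (simp add: X_def degree_monom_eq)
  let ?P = "\<lambda>d. \<exists>p. p \<noteq> 0 \<and> rpoly p \<zeta> = 0 \<and> Polynomial.degree p = d"
  have "?P m" using degX rX zm assms(1) by (intro exI[of _ X]) auto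
  then have "?P (LEAST d. ?P d)" by (rule LeastI)
  then obtain f where f: "f \<noteq> 0" "rpoly f \<zeta> = 0" "Polynomial.degree f = (LEAST d. ?P d)" by blast
  have f_min: "Polynomial.degree f \<le> Polynomial.degree p" if "p \<noteq> 0" "rpoly p \<zeta> = 0" for p
    unfolding f(3) by (rule Least_le) (use that in blast)
  have mod: "rpoly p z = rpoly (p div f) z * rpoly f z + rpoly (p mod f) z" for p z
    by (metis div_mult_mod_eq rpoly_add rpoly_mult)
  have mod0: "p mod f = 0" if "rpoly p \<zeta> = 0" for p
  proof (rule ccontr)
    assume nz: "p mod f \<noteq> 0"
    have "rpoly (p mod f) \<zeta> = 0" using mod[of p \<zeta>] f(2) that by simp
    then have "Polynomial.degree f \<le> Polynomial.degree (p mod f)" using f_min nz by blast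
    then show False using degree_mod_less[OF f(1), of p] nz by simp
  qed
  define K where "K = {k. rpoly f (\<zeta> ^ k) = 0}"
  define Z where "Z = {z. rpoly f z = 0}"
  have deg_map: "Polynomial.degree (map_poly of_rat p :: complex poly) = Polynomial.degree p" for p
    by (rule degree_map_poly) auto
  have nz_map: "(map_poly of_rat p :: complex poly) \<noteq> 0" if "p \<noteq> 0" for p
    using that by (subst map_poly_eq_0_iff) auto
  have roots_bound: "finite {z. rpoly p z = 0} \<and> card {z. rpoly p z = 0} \<le> Polynomial.degree p"
    if "p \<noteq> 0" for p
    using card_poly_roots_bound[OF nz_map[OF that]] poly_roots_finite[OF nz_map[OF that]]
    unfolding rpoly_def deg_map by blast
  have "X mod f = 0" using mod0 rX zm by simp
  then obtain g where g: "X = f * g" by auto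
  have "X \<noteq> 0" using degX assms(1) by auto
  then have g0: "g \<noteq> 0" using g by auto
  have roots_X: "{z. rpoly X z = 0} = Z \<union> {z. rpoly g z = 0}"
    unfolding Z_def g by (auto simp: rpoly_mult)
  have "m = card {z. rpoly X z = 0}" using card_roots_unity_eq[OF assms(1)] by (simp add: rX)
  also have "\<dots> \<le> card Z + card {z. rpoly g z = 0}" unfolding roots_X by (rule card_Un_le)
  also have "\<dots> \<le> card Z + Polynomial.degree g" using roots_bound[OF g0] by simp
  finally have "m \<le> card Z + Polynomial.degree g" .
  moreover have "m = Polynomial.degree f + Polynomial.degree g"
    using degX g f(1) g0 by (simp add: degree_mult_eq)
  ultimately have cardZ: "Polynomial.degree f \<le> card Z" by simp
  have ZK: "\<exists>k\<in>K. z = \<zeta> ^ k" if "z \<in> Z" for z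
  proof -
    have "z ^ m = 1" using that roots_X rX by auto
    then have "z \<in> (\<lambda>k. cis (2 * pi * real k / real m)) ` {..<m}"
      using bij_betw_roots_unity[OF assms(1)] by (auto simp: bij_betw_def)
    then obtain k where k: "z = cis (2 * pi * real k / real m)" by blast
    then have "z = \<zeta> ^ k" by (simp add: \<zeta>_def DeMoivre mult_ac)
    then show ?thesis using that by (auto simp: K_def Z_def)
  qed
  show thesis
  proof (rule that)
    fix P k assume "rpoly P \<zeta> = 0" "k \<in> K"
    then show "rpoly P (\<zeta> ^ k) = 0" using mod[of P "\<zeta> ^ k"] mod0 by (simp add: K_def)
  next
    fix B :: "complex set" and \<gamma> P i
    assume B: "finite B" "rat_independent B \<gamma>" "i \<in> B"
      and sum: "\<And>k. k \<in> K \<Longrightarrow> (\<Sum>i\<in>B. \<gamma> i * rpoly (P i) (\<zeta> ^ k)) = 0"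
    define R where "R = (\<lambda>i. P i mod f)"
    define S where "S = (\<Sum>i\<in>B. Polynomial.smult (\<gamma> i) (map_poly of_rat (R i)))"
    have PR: "rpoly (P i) (\<zeta> ^ k) = rpoly (R i) (\<zeta> ^ k)" if "k \<in> K" for i k
      using mod[of "P i" "\<zeta> ^ k"] that by (simp add: K_def R_def)
    have "poly S z = 0" if "z \<in> Z" for z
    proof -
      obtain k where k: "k \<in> K" "z = \<zeta> ^ k" using ZK[OF \<open>z \<in> Z\<close>] by blast
      then show ?thesis using sum[OF k(1)]
        by (simp add: S_def poly_sum PR rpoly_def[symmetric])
    qed
    then have Z_sub: "Z \<subseteq> {z. poly S z = 0}" by blast
    have S0: "S = 0"
    proof (rule ccontr)
      assume S: "S \<noteq> 0"
      have fpos: "Polynomial.degree f > 0"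
      proof (rule ccontr)
        assume "\<not> Polynomial.degree f > 0"
        then obtain c where c: "f = [:c:]" using degree_eq_zeroE by (metis neq0_conv)
        then show False using f(1,2) by (simp add: rpoly_pCons)
      qed
      have "Polynomial.degree (Polynomial.smult (\<gamma> i) (map_poly of_rat (R i))) < Polynomial.degree f" for i
      proof -
        have "Polynomial.degree (Polynomial.smult (\<gamma> i) (map_poly of_rat (R i))) \<le> Polynomial.degree (R i)"
          by (metis degree_smult_le deg_map)
        also have "\<dots> < Polynomial.degree f"
          using degree_mod_less[OF f(1), of "P i"] fpos by (auto simp: R_def)
        finally show ?thesis .
      qed
      then have "Polynomial.degree S < Polynomial.degree f"
        unfolding S_def by (intro degree_sum_less fpos)
      moreover have "card Z \<le> Polynomial.degree S"
        using card_mono[OF poly_roots_finite[OF S] Z_sub] card_poly_roots_bound[OF S] by linarith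
      ultimately show False using cardZ by simp
    qed
    have "poly.coeff (R i) j = 0" for j
    proof -
      have "poly.coeff S j = (\<Sum>i\<in>B. of_rat (poly.coeff (R i) j) * \<gamma> i)"
        by (simp add: S_def coeff_sum coeff_map_poly mult.commute)
      then have "(\<Sum>i\<in>B. of_rat (poly.coeff (R i) j) * \<gamma> i) = 0" using S0 by simp
      then show ?thesis
        using B(2)[unfolded rat_independent_def, rule_format, of "\<lambda>i. poly.coeff (R i) j" i] B(3) by blast
    qed
    then have "R i = 0" by (simp add: poly_eq_iff)
    then show "rpoly (P i) \<zeta> = 0" using mod[of "P i" \<zeta>] f(2) by (simp add: R_def)
  qed
qed

section \<open>Traces of powers of a matrix of finite order\<close>

definition mtrace :: "complex mat \<Rightarrow> complex"
  where "mtrace A = (\<Sum>i<dim_row A. A $$ (i, i))"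

lemma mat_mult_entry:
  assumes "A \<in> carrier_mat n m" "B \<in> carrier_mat m k" "i < n" "j < k"
  shows "(A * B) $$ (i, j) = (\<Sum>l<m. A $$ (i, l) * B $$ (l, j))"
  using assms by (auto simp: scalar_prod_def atLeast0LessThan intro!: sum.cong)

lemma mtrace_mult_comm:
  assumes "A \<in> carrier_mat n m" "B \<in> carrier_mat m n"
  shows "mtrace (A * B) = mtrace (B * A)"
proof -
  have "mtrace (A * B) = (\<Sum>i<n. \<Sum>l<m. A $$ (i, l) * B $$ (l, i))"
    unfolding mtrace_def using assms by (simp add: mat_mult_entry[OF assms] del: index_mult_mat(1))
  also have "\<dots> = (\<Sum>l<m. \<Sum>i<n. B $$ (l, i) * A $$ (i, l))"
    by (subst sum.swap) (simp add: mult.commute)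
  also have "\<dots> = mtrace (B * A)"
    unfolding mtrace_def using assms by (simp add: mat_mult_entry[OF assms(2,1)] del: index_mult_mat(1))
  finally show ?thesis .
qed

lemma upper_triangular_mult:
  assumes "A \<in> carrier_mat n n" "B \<in> carrier_mat n n" "upper_triangular A" "upper_triangular B"
  shows "upper_triangular (A * B)" and "i < n \<Longrightarrow> (A * B) $$ (i, i) = A $$ (i, i) * B $$ (i, i)"
proof -
  have term0: "A $$ (i, l) * B $$ (l, j) = 0" if "i < n" "l < n" "j \<le> i" "l \<noteq> i \<or> j \<noteq> i" for i j l
  proof (cases "l < i")
    case True
    then show ?thesis using assms(1,3) that by (auto simp: upper_triangular_def)
  next
    case False
    then have "j < l" using that by auto
    then show ?thesis using assms(2,4) that by (auto simp: upper_triangular_def)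
  qed
  show "upper_triangular (A * B)"
  proof (rule upper_triangularI)
    fix i j assume ij: "j < i" "i < dim_row (A * B)"
    then have "i < n" "j < n" using assms(1) by auto
    then show "(A * B) $$ (i, j) = 0"
      using ij term0[of i _ j] by (simp add: mat_mult_entry[OF assms(1,2)] del: index_mult_mat(1))
  qed
  show "(A * B) $$ (i, i) = A $$ (i, i) * B $$ (i, i)" if "i < n"
  proof -
    have "(A * B) $$ (i, i) = (\<Sum>l<n. if l = i then A $$ (i, i) * B $$ (i, i) else 0)"
      unfolding mat_mult_entry[OF assms(1,2) that that]
    proof (rule sum.cong[OF refl])
      fix l assume "l \<in> {..<n}"
      then show "A $$ (i, l) * B $$ (l, i) = (if l = i then A $$ (i, i) * B $$ (i, i) else 0)"
        using term0[OF that, of l i] by (cases "l = i") simp_all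
    qed
    then show ?thesis using that by simp
  qed
qed

lemma upper_triangular_pow:
  assumes "A \<in> carrier_mat n n" "upper_triangular A"
  shows "upper_triangular (A ^\<^sub>m k) \<and> (\<forall>i<n. (A ^\<^sub>m k) $$ (i, i) = (A $$ (i, i)) ^ k)"
proof (induction k)
  case 0
  then show ?case using assms by auto
next
  case (Suc k)
  then show ?case
    using upper_triangular_mult[of "A ^\<^sub>m k" n A] assms by (simp add: pow_carrier_mat power_commutes)
qed

text \<open>
  After triangularization the diagonal entries are \<open>m\<close>-th roots of unity, and the \<open>k\<close>-th power of the
  matrix has their \<open>k\<close>-th powers on the diagonal.
\<close>

lemma finite_order_mat_trace:
  fixes A :: "complex mat"
  assumes A: "A \<in> carrier_mat n n" and m: "m > 0" and pow: "A ^\<^sub>m m = 1\<^sub>m n"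
  obtains j :: "nat \<Rightarrow> nat"
  where "\<And>k. mtrace (A ^\<^sub>m k) = (\<Sum>i<n. cis (2 * pi / real m) ^ (j i * k))"
proof -
  obtain as where "char_poly A = (\<Prod>a\<leftarrow>as. [:- a, 1:])" using char_poly_factorized[OF A] by blast
  then obtain T where T: "T \<in> carrier_mat n n" "upper_triangular T" "similar_mat A T"
    using schur_decomposition_exists[OF A] by blast
  then obtain P Q where PQ: "similar_mat_wit A T P Q" unfolding similar_mat_def by blast
  note D = similar_mat_witD2[OF A PQ]
  have Apow: "A ^\<^sub>m k = P * T ^\<^sub>m k * Q" for k by (rule similar_mat_wit_pow_id[OF PQ])
  have Tk: "T ^\<^sub>m k \<in> carrier_mat n n" for k using T(1) by (rule pow_carrier_mat)
  have QAP: "Q * (P * X * Q) * P = X" if X: "X \<in> carrier_mat n n" for X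
  proof -
    have c: "P \<in> carrier_mat n n" "Q \<in> carrier_mat n n" "P * X \<in> carrier_mat n n" using D X by auto
    have "Q * (P * X * Q) * P = Q * ((P * X * Q) * P)"
      using c by (intro assoc_mult_mat[of _ n n _ n _ n]) auto
    also have "(P * X * Q) * P = (P * X) * (Q * P)"
      using c by (intro assoc_mult_mat[of _ n n _ n _ n]) auto
    also have "\<dots> = P * X" by (simp only: D(2) right_mult_one_mat[OF c(3)])
    also have "Q * (P * X) = (Q * P) * X"
      using c X by (intro assoc_mult_mat[of _ n n _ n _ n, symmetric]) auto
    finally show ?thesis using D X by simp
  qed
  have "T ^\<^sub>m m = Q * 1\<^sub>m n * P" using QAP[OF Tk[of m]] Apow[of m] pow by simp
  then have Tm: "T ^\<^sub>m m = 1\<^sub>m n" using D by simp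
  have root: "(T $$ (i, i)) ^ m = 1" if "i < n" for i
    using upper_triangular_pow[OF T(1,2), of m] Tm that by auto
  have "\<exists>j. T $$ (i, i) = cis (2 * pi / real m) ^ j" if "i < n" for i
  proof -
    have "T $$ (i, i) \<in> (\<lambda>k. cis (2 * pi * real k / real m)) ` {..<m}"
      using bij_betw_roots_unity[OF m] root[OF that] by (auto simp: bij_betw_def)
    then obtain k where "T $$ (i, i) = cis (2 * pi * real k / real m)" by blast
    then have "T $$ (i, i) = cis (2 * pi / real m) ^ k" by (simp add: DeMoivre mult_ac)
    then show ?thesis by blast
  qed
  then obtain j where j: "\<And>i. i < n \<Longrightarrow> T $$ (i, i) = cis (2 * pi / real m) ^ j i" by metis
  show thesis
  proof (rule that)
    fix k
    have "mtrace (A ^\<^sub>m k) = mtrace ((P * T ^\<^sub>m k) * Q)" by (simp add: Apow)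
    also have "\<dots> = mtrace (Q * (P * T ^\<^sub>m k))"
      using D Tk by (intro mtrace_mult_comm[of _ n n]) auto
    also have "Q * (P * T ^\<^sub>m k) = T ^\<^sub>m k"
      using D Tk[of k] by (simp add: assoc_mult_mat[of Q n n P n _ n, symmetric])
    also have "mtrace (T ^\<^sub>m k) = (\<Sum>i<n. cis (2 * pi / real m) ^ (j i * k))"
      using upper_triangular_pow[OF T(1,2), of k] Tk[of k] T(1) j
      by (auto simp: mtrace_def power_mult intro!: sum.cong)
    finally show "mtrace (A ^\<^sub>m k) = (\<Sum>i<n. cis (2 * pi / real m) ^ (j i * k))" .
  qed
qed

section \<open>Schur's lemma\<close>

lemma mat_vec_zero: "A \<in> carrier_mat n m \<Longrightarrow> A *\<^sub>v 0\<^sub>v m = 0\<^sub>v n" for A :: "complex mat"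
  by (intro eq_vecI) auto

lemma mat_unit_vec_col: "A \<in> carrier_mat n m \<Longrightarrow> j < m \<Longrightarrow> A *\<^sub>v unit_vec m j = col A j"
  for A :: "complex mat"
  by (intro eq_vecI) auto

lemma zero_matI:
  fixes A :: "complex mat"
  assumes A: "A \<in> carrier_mat n m" and "\<And>j. j < m \<Longrightarrow> A *\<^sub>v unit_vec m j = 0\<^sub>v n"
  shows "A = 0\<^sub>m n m"
proof (rule eq_matI)
  fix i j assume "i < dim_row (0\<^sub>m n m)" "j < dim_col (0\<^sub>m n m)"
  then have ij: "i < n" "j < m" by auto
  then have "col A j = 0\<^sub>v n" using assms(2)[of j] by (simp add: mat_unit_vec_col[OF A])
  then have "col A j $ i = 0" using ij by simp
  then show "A $$ (i, j) = 0\<^sub>m n m $$ (i, j)" using A ij by simp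
qed (use A in auto)

lemma smult_one_mat_vec:
  fixes v :: "complex vec"
  assumes "v \<in> carrier_vec n" shows "(c \<cdot>\<^sub>m 1\<^sub>m n) *\<^sub>v v = c \<cdot>\<^sub>v v"
proof (rule eq_vecI)
  fix i assume "i < dim_vec (c \<cdot>\<^sub>v v)"
  then have i: "i < n" using assms by simp
  have "((c \<cdot>\<^sub>m 1\<^sub>m n) *\<^sub>v v) $ i = (\<Sum>k\<in>{0..<n}. if k = i then c * v $ i else 0)"
    using i assms by (auto simp: scalar_prod_def if_distrib if_distribR intro!: sum.cong cong: if_cong)
  then show "((c \<cdot>\<^sub>m 1\<^sub>m n) *\<^sub>v v) $ i = (c \<cdot>\<^sub>v v) $ i" using i assms by simp
qed (use assms in auto)

lemma subspace_module_vecI: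
  assumes "W \<subseteq> carrier_vec n" "0\<^sub>v n \<in> W" "\<And>u v. u \<in> W \<Longrightarrow> v \<in> W \<Longrightarrow> u + v \<in> W"
    "\<And>c v. v \<in> W \<Longrightarrow> c \<cdot>\<^sub>v v \<in> W"
  shows "VectorSpace.subspace class_ring W (module_vec TYPE(complex) n)"
proof -
  interpret vec_space "TYPE(complex)" n .
  have "submodule class_ring W V"
    using assms by (auto simp: submodule_def module_vec_simps vec_module)
  then show ?thesis using vec_vs by (simp add: VectorSpace.subspace_def)
qed

lemma subspace_module_vecD:
  assumes "VectorSpace.subspace class_ring W (module_vec TYPE(complex) n)"
  shows "W \<subseteq> carrier_vec n" "0\<^sub>v n \<in> W" "\<And>u v. u \<in> W \<Longrightarrow> v \<in> W \<Longrightarrow> u + v \<in> W"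
    "\<And>c v. v \<in> W \<Longrightarrow> c \<cdot>\<^sub>v v \<in> W"
  using assms by (auto simp: VectorSpace.subspace_def submodule_def module_vec_simps)

lemma irreducible_invariant:
  assumes "irreducible_rep H n \<rho>" "W \<subseteq> carrier_vec n" "0\<^sub>v n \<in> W"
    "\<And>u v. u \<in> W \<Longrightarrow> v \<in> W \<Longrightarrow> u + v \<in> W" "\<And>c v. v \<in> W \<Longrightarrow> c \<cdot>\<^sub>v v \<in> W"
    "\<And>g w. g \<in> carrier H \<Longrightarrow> w \<in> W \<Longrightarrow> \<rho> g *\<^sub>v w \<in> W"
  shows "W = {0\<^sub>v n} \<or> W = carrier_vec n"
  using assms(1) subspace_module_vecI[OF assms(2-5)] assms(6)
  unfolding irreducible_rep_def by blast

lemma matrix_repD: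
  assumes "matrix_rep H n \<rho>"
  shows "g \<in> carrier H \<Longrightarrow> \<rho> g \<in> carrier_mat n n" "\<rho> \<one>\<^bsub>H\<^esub> = 1\<^sub>m n"
    "g \<in> carrier H \<Longrightarrow> h \<in> carrier H \<Longrightarrow> \<rho> (g \<otimes>\<^bsub>H\<^esub> h) = \<rho> g * \<rho> h"
  using assms by (auto simp: matrix_rep_def)

text \<open>
  The kernel of an intertwiner is an invariant subspace.
\<close>

lemma schur_kernel:
  assumes irr: "irreducible_rep H n \<rho>" and A: "A \<in> carrier_mat n' n"
    and \<rho>': "\<And>g. g \<in> carrier H \<Longrightarrow> \<rho>' g \<in> carrier_mat n' n'"
    and int: "\<And>g. g \<in> carrier H \<Longrightarrow> \<rho>' g * A = A * \<rho> g"
    and nz: "v \<in> carrier_vec n" "v \<noteq> 0\<^sub>v n" "A *\<^sub>v v = 0\<^sub>v n'"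
  shows "A = 0\<^sub>m n' n"
proof -
  have rep: "matrix_rep H n \<rho>" using irr by (simp add: irreducible_rep_def)
  define W where "W = {w \<in> carrier_vec n. A *\<^sub>v w = 0\<^sub>v n'}"
  have "W = {0\<^sub>v n} \<or> W = carrier_vec n"
  proof (rule irreducible_invariant[OF irr])
    show "W \<subseteq> carrier_vec n" "0\<^sub>v n \<in> W" using A by (auto simp: W_def)
    show "u + v \<in> W" if "u \<in> W" "v \<in> W" for u v
      using that A by (auto simp: W_def mult_add_distrib_mat_vec[of A n' n])
    show "c \<cdot>\<^sub>v v \<in> W" if "v \<in> W" for c v
      using that A by (auto simp: W_def mult_mat_vec[of A n' n])
    show "\<rho> g *\<^sub>v w \<in> W" if "g \<in> carrier H" "w \<in> W" for g w
    proof -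
      have w: "w \<in> carrier_vec n" "A *\<^sub>v w = 0\<^sub>v n'" using that by (auto simp: W_def)
      have \<rho>g: "\<rho> g \<in> carrier_mat n n" using matrix_repD(1)[OF rep that(1)] .
      have "A *\<^sub>v (\<rho> g *\<^sub>v w) = (\<rho>' g * A) *\<^sub>v w"
        using int[OF that(1)] w \<rho>g A by (simp add: assoc_mult_mat_vec[of A n' n])
      also have "\<dots> = 0\<^sub>v n'" using w A \<rho>'[OF that(1)]
        by (simp add: assoc_mult_mat_vec[of _ n' n' A n] mat_vec_zero[of _ n' n'])
      finally show ?thesis using w \<rho>g by (simp add: W_def)
    qed
  qed
  then have W: "W = carrier_vec n" using nz by (auto simp: W_def)
  show ?thesis
  proof (rule zero_matI[OF A])
    fix j
    have "unit_vec n j \<in> W" unfolding W by simp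
    then show "A *\<^sub>v unit_vec n j = 0\<^sub>v n'" unfolding W_def by blast
  qed
qed

text \<open>
  The image of a nonzero intertwiner is a nonzero invariant subspace, hence everything; the preimages
  of the unit vectors are the columns of a right inverse, and triviality of the kernel makes it
  two-sided.
\<close>

lemma schur_inverse:
  assumes irr: "irreducible_rep H n \<rho>" and irr': "irreducible_rep H n' \<rho>'"
    and A: "A \<in> carrier_mat n' n"
    and int: "\<And>g. g \<in> carrier H \<Longrightarrow> \<rho>' g * A = A * \<rho> g"
    and nz: "A \<noteq> 0\<^sub>m n' n"
  obtains A' where "A' \<in> carrier_mat n n'" "A * A' = 1\<^sub>m n'" "A' * A = 1\<^sub>m n"
proof -
  have rep: "matrix_rep H n \<rho>" "matrix_rep H n' \<rho>'" using irr irr' by (simp_all add: irreducible_rep_def)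
  define W where "W = (\<lambda>v. A *\<^sub>v v) ` carrier_vec n"
  have "W = {0\<^sub>v n'} \<or> W = carrier_vec n'"
  proof (rule irreducible_invariant[OF irr'])
    show "W \<subseteq> carrier_vec n'" using A by (auto simp: W_def)
    show "0\<^sub>v n' \<in> W" using A by (auto simp: W_def intro!: image_eqI[of _ _ "0\<^sub>v n"])
    show "u + v \<in> W" if "u \<in> W" "v \<in> W" for u v
      using that A by (auto simp: W_def mult_add_distrib_mat_vec[of A n' n, symmetric])
    show "c \<cdot>\<^sub>v v \<in> W" if "v \<in> W" for c v
      using that A by (auto simp: W_def mult_mat_vec[of A n' n, symmetric])
    show "\<rho>' g *\<^sub>v w \<in> W" if "g \<in> carrier H" "w \<in> W" for g w
    proof -
      from that(2) obtain v where v: "v \<in> carrier_vec n" "w = A *\<^sub>v v" by (auto simp: W_def)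
      have \<rho>g: "\<rho> g \<in> carrier_mat n n" "\<rho>' g \<in> carrier_mat n' n'"
        using matrix_repD(1)[OF rep(1) that(1)] matrix_repD(1)[OF rep(2) that(1)] .
      have "\<rho>' g *\<^sub>v w = A *\<^sub>v (\<rho> g *\<^sub>v v)"
        using int[OF that(1)] v \<rho>g A
        by (metis assoc_mult_mat_vec)
      then show ?thesis using v \<rho>g by (auto simp: W_def)
    qed
  qed
  moreover have "W \<noteq> {0\<^sub>v n'}"
  proof
    assume W0: "W = {0\<^sub>v n'}"
    have "A = 0\<^sub>m n' n"
    proof (rule zero_matI[OF A])
      fix j
      have "A *\<^sub>v unit_vec n j \<in> W" by (auto simp: W_def)
      then show "A *\<^sub>v unit_vec n j = 0\<^sub>v n'" unfolding W0 by simp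
    qed
    then show False using nz by simp
  qed
  ultimately have W: "W = carrier_vec n'" by blast
  have "\<forall>j. \<exists>v. v \<in> carrier_vec n \<and> A *\<^sub>v v = unit_vec n' j"
  proof
    fix j
    have "unit_vec n' j \<in> W" using W by simp
    then show "\<exists>v. v \<in> carrier_vec n \<and> A *\<^sub>v v = unit_vec n' j" by (auto simp: W_def)
  qed
  then obtain p where p: "\<And>j. p j \<in> carrier_vec n" "\<And>j. A *\<^sub>v p j = unit_vec n' j" by metis
  define A' where "A' = mat n n' (\<lambda>(i, j). p j $ i)"
  have A': "A' \<in> carrier_mat n n'" by (simp add: A'_def)
  have colA': "col A' j = p j" if "j < n'" for j
    using that p(1)[of j] by (auto simp: A'_def)
  have AA': "A * A' = 1\<^sub>m n'"
  proof (rule eq_matI)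
    fix i j assume "i < dim_row (1\<^sub>m n' :: complex mat)" "j < dim_col (1\<^sub>m n' :: complex mat)"
    then have ij: "i < n'" "j < n'" by auto
    have "(A * A') $$ (i, j) = (A *\<^sub>v p j) $ i" using ij A A' by (simp add: colA')
    then show "(A * A') $$ (i, j) = 1\<^sub>m n' $$ (i, j)" using p(2)[of j] ij by auto
  qed (use A A' in auto)
  have "A' * A = 1\<^sub>m n"
  proof -
    have ker: "v = 0\<^sub>v n" if "v \<in> carrier_vec n" "A *\<^sub>v v = 0\<^sub>v n'" for v
      using schur_kernel[OF irr A matrix_repD(1)[OF rep(2)] int that(1) _ that(2)] nz by blast
    have eq: "A *\<^sub>v (A' *\<^sub>v (A *\<^sub>v v)) = A *\<^sub>v v" if "v \<in> carrier_vec n" for v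
    proof -
      have "A *\<^sub>v (A' *\<^sub>v (A *\<^sub>v v)) = (A * A') *\<^sub>v (A *\<^sub>v v)"
        using A A' that by (simp add: assoc_mult_mat_vec[of A n' n A' n'])
      then show ?thesis using AA' A that by simp
    qed
    have id: "A' *\<^sub>v (A *\<^sub>v v) = v" if v: "v \<in> carrier_vec n" for v
    proof -
      have c: "A' *\<^sub>v (A *\<^sub>v v) \<in> carrier_vec n" using A A' v by simp
      have "A' *\<^sub>v (A *\<^sub>v v) - v = 0\<^sub>v n"
      proof (rule ker)
        show "A' *\<^sub>v (A *\<^sub>v v) - v \<in> carrier_vec n" using c v by simp
        have "A *\<^sub>v (A' *\<^sub>v (A *\<^sub>v v) - v) = A *\<^sub>v v - A *\<^sub>v v"
          using A c v eq[OF v] by (simp add: mult_minus_distrib_mat_vec[of A n' n])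
        then show "A *\<^sub>v (A' *\<^sub>v (A *\<^sub>v v) - v) = 0\<^sub>v n'" using A v by simp
      qed
      then have "A' *\<^sub>v (A *\<^sub>v v) - v + v = 0\<^sub>v n + v" by simp
      then show ?thesis using c v by (simp add: minus_add_uminus_vec[of _ n] assoc_add_vec[of _ n])
    qed
    show ?thesis
    proof (rule eq_matI)
      fix i j assume "i < dim_row (1\<^sub>m n :: complex mat)" "j < dim_col (1\<^sub>m n :: complex mat)"
      then have ij: "i < n" "j < n" by auto
      have "col (A' * A) j = (A' * A) *\<^sub>v unit_vec n j"
        by (rule mat_unit_vec_col[OF mult_carrier_mat[OF A' A] ij(2), symmetric])
      also have "\<dots> = unit_vec n j"
        unfolding assoc_mult_mat_vec[OF A' A unit_vec_carrier] by (rule id[OF unit_vec_carrier])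
      finally have "col (A' * A) j $ i = unit_vec n j $ i" by simp
      then show "(A' * A) $$ (i, j) = 1\<^sub>m n $$ (i, j)" using A A' ij by simp
    qed (use A A' in auto)
  qed
  then show thesis using that A' AA' by blast
qed

lemma schur_distinct:
  assumes irr: "irreducible_rep H n \<rho>" and irr': "irreducible_rep H n' \<rho>'"
    and A: "A \<in> carrier_mat n' n"
    and int: "\<And>g. g \<in> carrier H \<Longrightarrow> \<rho>' g * A = A * \<rho> g"
    and ne: "rep_character H n \<rho> \<noteq> rep_character H n' \<rho>'"
  shows "A = 0\<^sub>m n' n"
proof (rule ccontr)
  assume nz: "A \<noteq> 0\<^sub>m n' n"
  have rep: "matrix_rep H n \<rho>" "matrix_rep H n' \<rho>'" using irr irr' by (simp_all add: irreducible_rep_def)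
  obtain A' where A': "A' \<in> carrier_mat n n'" "A * A' = 1\<^sub>m n'" "A' * A = 1\<^sub>m n"
    by (rule schur_inverse[OF irr irr' A int nz])
  have "(\<Sum>i<n. \<rho> g $$ (i, i)) = (\<Sum>i<n'. \<rho>' g $$ (i, i))" if g: "g \<in> carrier H" for g
  proof -
    have \<rho>g: "\<rho> g \<in> carrier_mat n n" "\<rho>' g \<in> carrier_mat n' n'"
      using matrix_repD(1)[OF rep(1) g] matrix_repD(1)[OF rep(2) g] .
    have "mtrace (\<rho>' g) = mtrace (\<rho>' g * (A * A'))" using \<rho>g A' by simp
    also have "\<rho>' g * (A * A') = (\<rho>' g * A) * A'"
      by (rule assoc_mult_mat[OF \<rho>g(2) A A'(1), symmetric])
    also have "\<dots> = (A * \<rho> g) * A'" by (simp only: int[OF g])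
    also have "mtrace \<dots> = mtrace (A' * (A * \<rho> g))"
      using \<rho>g A A' by (intro mtrace_mult_comm[of _ n' n]) auto
    also have "A' * (A * \<rho> g) = \<rho> g"
      using \<rho>g A A' by (simp add: assoc_mult_mat[of A' n n' A n "\<rho> g" n, symmetric])
    finally show ?thesis using \<rho>g by (simp add: mtrace_def)
  qed
  then have "rep_character H n \<rho> = rep_character H n' \<rho>'"
    by (auto simp: rep_character_def fun_eq_iff)
  then show False using ne by simp
qed

lemma schur_scalar:
  assumes irr: "irreducible_rep H n \<rho>" and A: "A \<in> carrier_mat n n"
    and int: "\<And>g. g \<in> carrier H \<Longrightarrow> \<rho> g * A = A * \<rho> g"
  obtains c where "A = c \<cdot>\<^sub>m 1\<^sub>m n"
proof -
  have rep: "matrix_rep H n \<rho>" and n: "n > 0" using irr by (simp_all add: irreducible_rep_def)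
  obtain c where "poly (char_poly A) c = 0"
    using degree_monic_char_poly[OF A] n fundamental_theorem_of_algebra[of "char_poly A"]
    by (metis constant_degree neq0_conv)
  then have "eigenvalue A c" using eigenvalue_root_char_poly[OF A] by simp
  then obtain v where v: "v \<in> carrier_vec n" "v \<noteq> 0\<^sub>v n" "A *\<^sub>v v = c \<cdot>\<^sub>v v"
    using A by (auto simp: eigenvalue_def eigenvector_def)
  have c1: "(c \<cdot>\<^sub>m 1\<^sub>m n) \<in> carrier_mat n n" by simp
  have "A - c \<cdot>\<^sub>m 1\<^sub>m n = 0\<^sub>m n n"
  proof (rule schur_kernel[OF irr _ matrix_repD(1)[OF rep] _ v(1,2)])
    show "A - c \<cdot>\<^sub>m 1\<^sub>m n \<in> carrier_mat n n" using A by auto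
    show "\<rho> g * (A - c \<cdot>\<^sub>m 1\<^sub>m n) = (A - c \<cdot>\<^sub>m 1\<^sub>m n) * \<rho> g" if "g \<in> carrier H" for g
    proof -
      have \<rho>g: "\<rho> g \<in> carrier_mat n n" using matrix_repD(1)[OF rep that] .
      show ?thesis using int[OF that] A \<rho>g
        by (simp add: mult_minus_distrib_mat[OF \<rho>g A c1] minus_mult_distrib_mat[OF A c1 \<rho>g]
            mult_smult_distrib[OF \<rho>g one_carrier_mat] mult_smult_assoc_mat[OF one_carrier_mat \<rho>g])
    qed
    have "(A - c \<cdot>\<^sub>m 1\<^sub>m n) *\<^sub>v v = A *\<^sub>v v - (c \<cdot>\<^sub>m 1\<^sub>m n) *\<^sub>v v"
      by (rule minus_mult_distrib_mat_vec[OF A c1 v(1)])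
    also have "(c \<cdot>\<^sub>m 1\<^sub>m n) *\<^sub>v v = c \<cdot>\<^sub>v v"
      by (rule smult_one_mat_vec[OF v(1)])
    finally show "(A - c \<cdot>\<^sub>m 1\<^sub>m n) *\<^sub>v v = 0\<^sub>v n" using v by simp
  qed
  then have "A - c \<cdot>\<^sub>m 1\<^sub>m n + c \<cdot>\<^sub>m 1\<^sub>m n = 0\<^sub>m n n + c \<cdot>\<^sub>m 1\<^sub>m n" by simp
  moreover have "A - c \<cdot>\<^sub>m 1\<^sub>m n + c \<cdot>\<^sub>m 1\<^sub>m n = A" using A by (intro eq_matI) auto
  ultimately have "A = c \<cdot>\<^sub>m 1\<^sub>m n" by simp
  then show thesis by (rule that)
qed

section \<open>Orthogonality of irreducible characters\<close>

definition class_funs :: "('a, 'm) monoid_scheme \<Rightarrow> ('a \<Rightarrow> complex) set"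
  where "class_funs H = {f \<in> supp_on H. \<forall>g\<in>carrier H. \<forall>x\<in>carrier H. f (cj H g x) = f x}"

context fin_grp
begin

lemma cj_closed: "g \<in> carrier H \<Longrightarrow> x \<in> carrier H \<Longrightarrow> cj H g x \<in> carrier H"
  by (simp add: cj_def)

lemma cj_cj:
  assumes "g \<in> carrier H" "h \<in> carrier H" "x \<in> carrier H"
  shows "cj H g (cj H h x) = cj H (g \<otimes> h) x"
  using assms by (simp add: cj_def inv_mult_group m_assoc)

lemma cj_inv_cj: "g \<in> carrier H \<Longrightarrow> x \<in> carrier H \<Longrightarrow> cj H (inv g) (cj H g x) = x"
  by (simp add: cj_cj) (simp add: cj_def)

lemma cj_cj_inv: "g \<in> carrier H \<Longrightarrow> x \<in> carrier H \<Longrightarrow> cj H g (cj H (inv g) x) = x"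
  by (simp add: cj_cj) (simp add: cj_def)

lemma cj_mem_iff:
  assumes "\<And>g x. g \<in> carrier H \<Longrightarrow> x \<in> X \<Longrightarrow> cj H g x \<in> X" "g \<in> carrier H" "x \<in> carrier H"
  shows "cj H g x \<in> X \<longleftrightarrow> x \<in> X"
proof
  assume "cj H g x \<in> X"
  then have "cj H (inv g) (cj H g x) \<in> X" using assms(1)[OF inv_closed[OF assms(2)]] by blast
  then show "x \<in> X" using assms(2,3) by (simp add: cj_inv_cj)
qed (use assms in blast)

lemma cj_mult:
  assumes "g \<in> carrier H" "x \<in> carrier H" "y \<in> carrier H"
  shows "cj H g (x \<otimes> y) = cj H g x \<otimes> cj H g y"
proof -
  have "g \<otimes> (x \<otimes> y) \<otimes> inv g = g \<otimes> x \<otimes> (inv g \<otimes> g) \<otimes> y \<otimes> inv g"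
    using assms by (simp add: m_assoc)
  then show ?thesis using assms by (simp only: cj_def m_assoc inv_closed m_closed)
qed

lemma cj_pow:
  assumes "g \<in> carrier H" "x \<in> carrier H"
  shows "cj H g (x [^] (k::nat)) = cj H g x [^] k"
proof (induction k)
  case 0
  then show ?case using assms by (simp add: cj_def)
next
  case (Suc k)
  then show ?case using assms by (simp add: cj_mult)
qed

lemma self_in_conj_class: "x \<in> carrier H \<Longrightarrow> x \<in> conj_class H x"
  by (auto simp: conj_class_def cj_def intro!: image_eqI[of _ _ \<one>])

lemma cj_conj_class:
  assumes "g \<in> carrier H" "x \<in> carrier H" "z \<in> conj_class H x"
  shows "cj H g z \<in> conj_class H x"
proof -
  obtain t where "t \<in> carrier H" "z = cj H t x" using assms(3) by (auto simp: conj_class_def)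
  then have "cj H g z = cj H (g \<otimes> t) x" "g \<otimes> t \<in> carrier H" using assms cj_cj by auto
  then show ?thesis by (auto simp: conj_class_def)
qed

lemma conj_class_eqI:
  assumes "x \<in> carrier H" "z \<in> conj_class H x"
  shows "conj_class H z = conj_class H x"
proof -
  obtain t where t: "t \<in> carrier H" "z = cj H t x" using assms by (auto simp: conj_class_def)
  have z: "z \<in> carrier H" using t assms cj_closed by simp
  have "cj H (inv t) z = x" using t assms cj_inv_cj by simp
  then have x: "x \<in> conj_class H z" using t(1) by (auto simp: conj_class_def)
  have "conj_class H z \<subseteq> conj_class H x"
    using cj_conj_class[OF _ assms] by (auto simp: conj_class_def[of H z])
  moreover have "conj_class H x \<subseteq> conj_class H z"
    using cj_conj_class[OF _ z x] by (auto simp: conj_class_def[of H x])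
  ultimately show ?thesis by blast
qed

lemma rep_pow:
  assumes "matrix_rep H n \<rho>" "u \<in> carrier H"
  shows "\<rho> (u [^] (k::nat)) = \<rho> u ^\<^sub>m k"
  using assms(2) by (induction k)
    (auto simp: matrix_repD[OF assms(1)] carrier_matD[OF matrix_repD(1)[OF assms]])

lemma character_power:
  assumes rep: "matrix_rep H n \<rho>" and u: "u \<in> carrier H"
  obtains j :: "nat \<Rightarrow> nat"
  where "\<And>k. rep_character H n \<rho> (u [^] (k::nat)) = (\<Sum>i<n. cis (2 * pi / real (Coset.order H)) ^ (j i * k))"
proof -
  have \<rho>u: "\<rho> u \<in> carrier_mat n n" using matrix_repD(1)[OF rep u] .
  have m: "Coset.order H > 0" using card_pos by (simp add: Coset.order_def)
  have "\<rho> u ^\<^sub>m Coset.order H = 1\<^sub>m n"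
    using rep_pow[OF rep u, of "Coset.order H"] pow_order_eq_1[OF u] matrix_repD(2)[OF rep] by simp
  from finite_order_mat_trace[OF \<rho>u m this] obtain j where
    j: "\<And>k. mtrace (\<rho> u ^\<^sub>m k) = (\<Sum>i<n. cis (2 * pi / real (Coset.order H)) ^ (j i * k))" by blast
  show thesis
  proof (rule that)
    fix k :: nat
    have "rep_character H n \<rho> (u [^] k) = mtrace (\<rho> u ^\<^sub>m k)"
      using u \<rho>u by (simp add: rep_character_def mtrace_def rep_pow[OF rep u] pow_carrier_mat)
    then show "rep_character H n \<rho> (u [^] k) = (\<Sum>i<n. cis (2 * pi / real (Coset.order H)) ^ (j i * k))"
      using j by simp
  qed
qed

lemma character_inv:
  assumes rep: "matrix_rep H n \<rho>" and u: "u \<in> carrier H"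
  shows "rep_character H n \<rho> (inv u) = cnj (rep_character H n \<rho> u)"
proof -
  define \<zeta> where "\<zeta> = cis (2 * pi / real (Coset.order H))"
  obtain j where j: "\<And>k. rep_character H n \<rho> (u [^] (k::nat)) = (\<Sum>i<n. \<zeta> ^ (j i * k))"
    unfolding \<zeta>_def using character_power[OF assms] by blast
  have m: "Coset.order H > 0" using card_pos by (simp add: Coset.order_def)
  have "u [^] (Coset.order H - 1) \<otimes> u = \<one>"
    using pow_order_eq_1[OF u] m u by (metis Suc_diff_1 nat_pow_Suc)
  then have inv: "inv u = u [^] (Coset.order H - 1)" using u by (metis inv_equality nat_pow_closed)
  have \<zeta>1: "\<zeta> * cnj \<zeta> = 1" by (simp add: \<zeta>_def cis_cnj cis_mult)
  have \<zeta>m: "\<zeta> ^ Coset.order H = 1" using m by (simp add: \<zeta>_def DeMoivre)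
  have c: "\<zeta> ^ (Coset.order H - 1) = cnj \<zeta>"
  proof -
    have "\<zeta> ^ (Coset.order H - 1) = \<zeta> ^ (Coset.order H - 1) * (\<zeta> * cnj \<zeta>)" using \<zeta>1 by simp
    also have "\<dots> = \<zeta> ^ (Suc (Coset.order H - 1)) * cnj \<zeta>" by (simp add: mult_ac)
    finally show ?thesis using \<zeta>m m by simp
  qed
  have "rep_character H n \<rho> (inv u) = (\<Sum>i<n. (\<zeta> ^ (Coset.order H - 1)) ^ j i)"
    unfolding inv j by (simp add: power_mult[symmetric] mult.commute)
  also have "\<dots> = cnj (\<Sum>i<n. \<zeta> ^ (j i * 1))"
    by (simp add: c del: One_nat_def)
  also have "\<dots> = cnj (rep_character H n \<rho> u)" using j[of 1] u by simp
  finally show ?thesis .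
qed

lemma sum_mult_left:
  assumes "h \<in> carrier H"
  shows "(\<Sum>g\<in>carrier H. F (h \<otimes> g)) = (\<Sum>g\<in>carrier H. F g)"
proof (rule sum.reindex_bij_witness[of _ "\<lambda>g. inv h \<otimes> g" "\<lambda>g. h \<otimes> g"])
qed (use assms in \<open>auto simp: m_assoc[symmetric]\<close>)

text \<open>
  The sum of \<open>\<rho>(g) E\<^sub>i\<^sub>j \<rho>'(g\<inverse>)\<close> over the group, where \<open>E\<^sub>i\<^sub>j\<close> is a matrix unit; it intertwines
  \<open>\<rho>'\<close> and \<open>\<rho>\<close>.
\<close>

definition avg_mat where
  "avg_mat n \<rho> n' \<rho>' i j = mat n n' (\<lambda>(a, b). \<Sum>g\<in>carrier H. \<rho> g $$ (a, i) * \<rho>' (inv g) $$ (j, b))"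

lemma avg_mat_intertwines:
  assumes rep: "matrix_rep H n \<rho>" "matrix_rep H n' \<rho>'" and h: "h \<in> carrier H" and ij: "i < n" "j < n'"
  shows "\<rho> h * avg_mat n \<rho> n' \<rho>' i j = avg_mat n \<rho> n' \<rho>' i j * \<rho>' h"
proof (rule eq_matI)
  let ?A = "avg_mat n \<rho> n' \<rho>' i j"
  have A: "?A \<in> carrier_mat n n'" by (simp add: avg_mat_def)
  note \<rho> = matrix_repD[OF rep(1)]
  note \<rho>' = matrix_repD[OF rep(2)]
  fix a b assume "a < dim_row (?A * \<rho>' h)" "b < dim_col (?A * \<rho>' h)"
  then have ab: "a < n" "b < n'" using A \<rho>'(1)[OF h] by auto
  have "(\<rho> h * ?A) $$ (a, b) = (\<Sum>c<n. \<rho> h $$ (a, c) * ?A $$ (c, b))"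
    by (rule mat_mult_entry[OF \<rho>(1)[OF h] A ab])
  also have "\<dots> = (\<Sum>c<n. \<Sum>g\<in>carrier H. \<rho> h $$ (a, c) * \<rho> g $$ (c, i) * \<rho>' (inv g) $$ (j, b))"
    using ab by (simp add: avg_mat_def sum_distrib_left mult.assoc)
  also have "\<dots> = (\<Sum>g\<in>carrier H. (\<Sum>c<n. \<rho> h $$ (a, c) * \<rho> g $$ (c, i)) * \<rho>' (inv g) $$ (j, b))"
    by (subst sum.swap) (simp add: sum_distrib_right)
  also have "\<dots> = (\<Sum>g\<in>carrier H. \<rho> (h \<otimes> g) $$ (a, i) * \<rho>' (inv (h \<otimes> g) \<otimes> h) $$ (j, b))"
  proof (rule sum.cong[OF refl])
    fix g assume g: "g \<in> carrier H"
    have "inv (h \<otimes> g) \<otimes> h = inv g" using h g by (simp add: inv_mult_group m_assoc)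
    then show "(\<Sum>c<n. \<rho> h $$ (a, c) * \<rho> g $$ (c, i)) * \<rho>' (inv g) $$ (j, b) =
        \<rho> (h \<otimes> g) $$ (a, i) * \<rho>' (inv (h \<otimes> g) \<otimes> h) $$ (j, b)"
      by (simp add: \<rho>(3)[OF h g] mat_mult_entry[OF \<rho>(1)[OF h] \<rho>(1)[OF g] ab(1) ij(1)] del: index_mult_mat(1))
  qed
  also have "\<dots> = (\<Sum>g\<in>carrier H. \<rho> g $$ (a, i) * \<rho>' (inv g \<otimes> h) $$ (j, b))"
    by (rule sum_mult_left[OF h])
  also have "\<dots> = (\<Sum>g\<in>carrier H. \<rho> g $$ (a, i) * (\<Sum>c<n'. \<rho>' (inv g) $$ (j, c) * \<rho>' h $$ (c, b)))"
    using h ab ij by (intro sum.cong refl)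
      (simp add: \<rho>'(3) mat_mult_entry[OF \<rho>'(1) \<rho>'(1)] del: index_mult_mat(1))
  also have "\<dots> = (\<Sum>c<n'. (\<Sum>g\<in>carrier H. \<rho> g $$ (a, i) * \<rho>' (inv g) $$ (j, c)) * \<rho>' h $$ (c, b))"
    by (simp add: sum_distrib_left sum_distrib_right mult.assoc) (rule sum.swap)
  also have "\<dots> = (\<Sum>c<n'. ?A $$ (a, c) * \<rho>' h $$ (c, b))"
    using ab by (simp add: avg_mat_def)
  also have "\<dots> = (?A * \<rho>' h) $$ (a, b)"
    by (rule mat_mult_entry[OF A \<rho>'(1)[OF h] ab, symmetric])
  finally show "(\<rho> h * ?A) $$ (a, b) = (?A * \<rho>' h) $$ (a, b)" .
qed (use matrix_repD(1)[OF rep(1) h] matrix_repD(1)[OF rep(2) h] in \<open>auto simp: avg_mat_def\<close>)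

text \<open>
  The conjugate of a character value is the value at the inverse, so the product of two characters
  is a sum of diagonal entries of intertwiners, which Schur's lemma evaluates.
\<close>

lemma herm_characters:
  assumes rep: "matrix_rep H n \<rho>" "matrix_rep H n' \<rho>'"
  shows "herm H (rep_character H n \<rho>) (rep_character H n' \<rho>') =
    (\<Sum>i<n. \<Sum>j<n'. avg_mat n \<rho> n' \<rho>' i j $$ (i, j)) / of_nat (card (carrier H))"
proof -
  have "(\<Sum>g\<in>carrier H. rep_character H n \<rho> g * cnj (rep_character H n' \<rho>' g)) =
      (\<Sum>g\<in>carrier H. \<Sum>i<n. \<Sum>j<n'. \<rho> g $$ (i, i) * \<rho>' (inv g) $$ (j, j))"
    by (intro sum.cong refl)
      (simp add: character_inv[OF rep(2), symmetric], simp add: rep_character_def sum_product)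
  also have "\<dots> = (\<Sum>i<n. \<Sum>g\<in>carrier H. \<Sum>j<n'. \<rho> g $$ (i, i) * \<rho>' (inv g) $$ (j, j))"
    by (rule sum.swap)
  also have "\<dots> = (\<Sum>i<n. \<Sum>j<n'. \<Sum>g\<in>carrier H. \<rho> g $$ (i, i) * \<rho>' (inv g) $$ (j, j))"
    by (intro sum.cong refl sum.swap)
  also have "\<dots> = (\<Sum>i<n. \<Sum>j<n'. avg_mat n \<rho> n' \<rho>' i j $$ (i, j))"
    by (simp add: avg_mat_def)
  finally show ?thesis by (simp add: herm_def)
qed

lemma Irr_orthonormal:
  assumes "\<chi> \<in> Irr H" "\<chi>' \<in> Irr H"
  shows "herm H \<chi> \<chi>' = (if \<chi> = \<chi>' then 1 else 0)"
proof -
  obtain n \<rho> n' \<rho>' where c: "\<chi> = rep_character H n \<rho>" "irreducible_rep H n \<rho>"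
    "\<chi>' = rep_character H n' \<rho>'" "irreducible_rep H n' \<rho>'"
    using assms by (auto simp: Irr_def)
  have rep: "matrix_rep H n \<rho>" "matrix_rep H n' \<rho>'" and n: "n > 0"
    using c by (auto simp: irreducible_rep_def)
  show ?thesis
  proof (cases "\<chi> = \<chi>'")
    case False
    have "avg_mat n \<rho> n' \<rho>' i j = 0\<^sub>m n n'" if "i < n" "j < n'" for i j
    proof (rule schur_distinct[OF c(4) c(2)])
      show "avg_mat n \<rho> n' \<rho>' i j \<in> carrier_mat n n'" by (simp add: avg_mat_def)
      show "rep_character H n' \<rho>' \<noteq> rep_character H n \<rho>" using False c(1,3) by metis
    qed (rule avg_mat_intertwines[OF rep _ that])
    then have "(\<Sum>i<n. \<Sum>j<n'. avg_mat n \<rho> n' \<rho>' i j $$ (i, j)) = 0"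
      by (intro sum.neutral ballI) simp
    then have "herm H \<chi> \<chi>' = 0" unfolding c(1,3) herm_characters[OF rep] by simp
    then show ?thesis using False by simp
  next
    case True
    note \<rho> = matrix_repD[OF rep(1)]
    have "avg_mat n \<rho> n \<rho> i j $$ (i, j) = (if i = j then of_nat (card (carrier H)) / of_nat n else 0)"
      if ij: "i < n" "j < n" for i j
    proof -
      let ?A = "avg_mat n \<rho> n \<rho> i j"
      obtain z where z: "?A = z \<cdot>\<^sub>m 1\<^sub>m n"
      proof (rule schur_scalar[OF c(2), of ?A])
        show "?A \<in> carrier_mat n n" by (simp add: avg_mat_def)
      qed (rule avg_mat_intertwines[OF rep(1,1) _ ij], assumption, rule that)
      have "of_nat n * z = (\<Sum>a<n. ?A $$ (a, a))" by (simp add: z)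
      also have "\<dots> = (\<Sum>a<n. \<Sum>g\<in>carrier H. \<rho> (inv g) $$ (j, a) * \<rho> g $$ (a, i))"
        by (simp add: avg_mat_def mult.commute)
      also have "\<dots> = (\<Sum>g\<in>carrier H. (\<rho> (inv g) * \<rho> g) $$ (j, i))"
        using ij by (subst sum.swap)
          (simp add: mat_mult_entry[OF \<rho>(1) \<rho>(1)] del: index_mult_mat(1))
      also have "\<dots> = (\<Sum>g\<in>carrier H. 1\<^sub>m n $$ (j, i))"
        by (intro sum.cong refl) (simp add: \<rho>(3)[symmetric] \<rho>(2) del: index_mult_mat(1))
      also have "\<dots> = (if i = j then of_nat (card (carrier H)) else 0)" using ij by auto
      finally have "of_nat n * z = (if i = j then of_nat (card (carrier H)) else 0)" .
      then have "z = (if i = j then of_nat (card (carrier H)) / of_nat n else 0)"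
        using n by (auto simp: field_simps)
      then show ?thesis using ij by (auto simp: z)
    qed
    then have "(\<Sum>i<n. \<Sum>j<n. avg_mat n \<rho> n \<rho> i j $$ (i, j)) =
        (\<Sum>i<n. \<Sum>j<n. if i = j then of_nat (card (carrier H)) / of_nat n else 0)"
      by (intro sum.cong refl) auto
    also have "\<dots> = (of_nat (card (carrier H)) :: complex)" using n by simp
    finally have "herm H \<chi> \<chi> = 1"
      unfolding c(1) herm_characters[OF rep(1,1)] using card_pos by simp
    then show ?thesis using True by simp
  qed
qed

lemma Irr_supp: "Irr H \<subseteq> supp_on H"
  by (auto simp: Irr_def supp_on_def rep_character_def)

lemma rep_character_cj:
  assumes rep: "matrix_rep H n \<rho>" and g: "g \<in> carrier H" "x \<in> carrier H"
  shows "rep_character H n \<rho> (cj H g x) = rep_character H n \<rho> x"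
proof -
  note \<rho> = matrix_repD[OF rep]
  have c: "\<rho> g \<in> carrier_mat n n" "\<rho> x \<in> carrier_mat n n" "\<rho> (inv g) \<in> carrier_mat n n"
    using \<rho>(1) g by auto
  have "mtrace (\<rho> (cj H g x)) = mtrace ((\<rho> g * \<rho> x) * \<rho> (inv g))"
    using g by (simp add: cj_def \<rho>(3))
  also have "\<dots> = mtrace (\<rho> (inv g) * (\<rho> g * \<rho> x))"
    using c by (intro mtrace_mult_comm[of _ n n]) auto
  also have "\<rho> (inv g) * (\<rho> g * \<rho> x) = \<rho> (inv g \<otimes> (g \<otimes> x))"
    using g by (simp add: \<rho>(3))
  also have "inv g \<otimes> (g \<otimes> x) = x" using g by (simp add: m_assoc[symmetric])
  finally show ?thesis
    using g c \<rho>(1)[of "cj H g x"] by (simp add: mtrace_def rep_character_def cj_def)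
qed

lemma Irr_class_fun: "Irr H \<subseteq> class_funs H"
  using Irr_supp rep_character_cj by (auto simp: Irr_def class_funs_def irreducible_rep_def)

lemma subspace_class_fun: "cfun.subspace (class_funs H)"
  unfolding cfun.subspace_def class_funs_def supp_on_def by (auto simp: cscale_def)

lemma Irr_independent: "cfun.independent (Irr H)"
  unfolding cfun.independent_explicit_module
proof (intro allI impI)
  fix t u \<chi> assume t: "finite t" "t \<subseteq> Irr H" "(\<Sum>v\<in>t. cscale (u v) v) = 0" "\<chi> \<in> t"
  have "0 = herm H (\<Sum>v\<in>t. cscale (u v) v) \<chi>" using t by (simp add: herm_zero_left)
  also have "\<dots> = (\<Sum>v\<in>t. u v * (if v = \<chi> then 1 else 0))"
    unfolding herm_sum_left herm_scale_left
  proof (rule sum.cong[OF refl])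
    fix v assume "v \<in> t"
    then have "v \<in> Irr H" "\<chi> \<in> Irr H" using t(2,4) by auto
    then show "u v * herm H v \<chi> = u v * (if v = \<chi> then 1 else 0)"
      by (simp add: Irr_orthonormal)
  qed
  also have "\<dots> = u \<chi>" using t by (simp add: if_distrib cong: if_cong)
  finally show "u \<chi> = 0" by simp
qed

lemma finite_Irr: "finite (Irr H)"
  using finite_independent[OF Irr_independent Irr_supp] .

end

section \<open>Irreducible characters span the class functions\<close>

context fin_grp
begin

definition ltrans :: "'a \<Rightarrow> ('a \<Rightarrow> complex) \<Rightarrow> 'a \<Rightarrow> complex"
  where "ltrans h v = (\<lambda>x. if x \<in> carrier H then v (inv h \<otimes> x) else 0)"

definition invariant_subspace :: "('a \<Rightarrow> complex) set \<Rightarrow> bool"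
  where "invariant_subspace W \<longleftrightarrow> cfun.subspace W \<and> W \<subseteq> supp_on H \<and>
    (\<forall>h\<in>carrier H. \<forall>w\<in>W. ltrans h w \<in> W)"

lemma ltrans_supp: "ltrans h v \<in> supp_on H" by (simp add: ltrans_def supp_on_def)

lemma ltrans_add: "ltrans h (u + v) = ltrans h u + ltrans h v"
  by (auto simp: ltrans_def fun_eq_iff)
lemma ltrans_scale: "ltrans h (cscale c v) = cscale c (ltrans h v)"
  by (auto simp: ltrans_def fun_eq_iff cscale_def)
lemma ltrans_zero: "ltrans h 0 = 0"
  by (auto simp: ltrans_def fun_eq_iff)
lemma ltrans_sum: "ltrans h (\<Sum>i\<in>A. v i) = (\<Sum>i\<in>A. ltrans h (v i))"
proof (induction A rule: infinite_finite_induct)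
  case (insert x F)
  then show ?case by (simp only: sum.insert[OF insert.hyps] ltrans_add)
qed (simp_all only: not_False_eq_True sum.infinite sum.empty ltrans_zero)

lemma ltrans_mult:
  assumes "h \<in> carrier H" "k \<in> carrier H"
  shows "ltrans (h \<otimes> k) v = ltrans h (ltrans k v)"
  using assms by (auto simp: ltrans_def fun_eq_iff inv_mult_group m_assoc)

lemma ltrans_one: "v \<in> supp_on H \<Longrightarrow> ltrans \<one> v = v"
  by (auto simp: ltrans_def fun_eq_iff supp_on_def)

lemma herm_ltrans:
  assumes "h \<in> carrier H"
  shows "herm H (ltrans h u) v = herm H u (ltrans (inv h) v)"
proof -
  have "(\<Sum>x\<in>carrier H. ltrans h u x * cnj (v x)) =
      (\<Sum>x\<in>carrier H. ltrans h u (h \<otimes> x) * cnj (v (h \<otimes> x)))"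
    by (rule sum_mult_left[OF assms, symmetric])
  also have "\<dots> = (\<Sum>x\<in>carrier H. u x * cnj (ltrans (inv h) v x))"
    using assms by (intro sum.cong refl) (auto simp: ltrans_def m_assoc[symmetric])
  finally show ?thesis by (simp add: herm_def)
qed

text \<open>
  A space of least dimension will do: a smaller invariant space of the same dimension contains a
  basis of the larger one.
\<close>

lemma minimal_invariant_exists:
  assumes M: "invariant_subspace M" "M \<noteq> {0}"
  obtains W where "invariant_subspace W" "W \<subseteq> M" "W \<noteq> {0}"
    "\<And>W'. invariant_subspace W' \<Longrightarrow> W' \<subseteq> W \<Longrightarrow> W' \<noteq> {0} \<Longrightarrow> W' = W"
proof -
  let ?P = "\<lambda>W. invariant_subspace W \<and> W \<subseteq> M \<and> W \<noteq> {0}"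
  obtain W where W: "?P W" "\<And>W'. ?P W' \<Longrightarrow> cfun.dim W \<le> cfun.dim W'"
    using ex_has_least_nat[of ?P M cfun.dim] M by blast
  show thesis
  proof (rule that)
    show "invariant_subspace W" "W \<subseteq> M" "W \<noteq> {0}" using W(1) by auto
    fix W' assume W': "invariant_subspace W'" "W' \<subseteq> W" "W' \<noteq> {0}"
    obtain B' where B': "B' \<subseteq> W'" "cfun.independent B'" "W' \<subseteq> cfun.span B'" "card B' = cfun.dim W'"
      using cfun.basis_exists by blast
    have "B' \<subseteq> W" using B'(1) W'(2) by blast
    then obtain B where B: "B' \<subseteq> B" "B \<subseteq> W" "cfun.independent B" "W \<subseteq> cfun.span B"
      using cfun.maximal_independent_subset_extend[OF _ B'(2)] by metis
    have "finite B"
      using W(1) B(2) by (intro finite_independent[OF B(3)]) (auto simp: invariant_subspace_def)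
    moreover have "card B = cfun.dim W" using cfun.basis_card_eq_dim[OF B(2,4,3)] .
    moreover have "cfun.dim W \<le> cfun.dim W'" using W' W by blast
    ultimately have "B' = B" using B(1) B'(4) by (simp add: card_seteq)
    then have "W \<subseteq> cfun.span W'" using B(4) B'(1) cfun.span_mono by blast
    moreover have "cfun.span W' = W'" using W'(1) by (simp add: invariant_subspace_def cfun.span_eq_iff)
    ultimately show "W' = W" using W'(2) by blast
  qed
qed

text \<open>
  Left translation on a minimal invariant space of functions, written in coordinates, is an
  irreducible matrix representation.  This passes from abstract invariant subspaces to the matrices
  by which irreducible characters are defined.
\<close>

lemma minimal_invariant_rep:
  assumes W: "invariant_subspace W" "W \<noteq> {0}"
    and min: "\<And>W'. invariant_subspace W' \<Longrightarrow> W' \<subseteq> W \<Longrightarrow> W' \<noteq> {0} \<Longrightarrow> W' = W"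
  obtains n \<rho> w where "irreducible_rep H n \<rho>"
    and "\<And>j. j < n \<Longrightarrow> w j \<in> W \<and> w j \<noteq> 0"
    and "\<And>h j. h \<in> carrier H \<Longrightarrow> j < n \<Longrightarrow> ltrans h (w j) = (\<Sum>i<n. cscale (\<rho> h $$ (i, j)) (w i))"
proof -
  have subW: "cfun.subspace W" and suppW: "W \<subseteq> supp_on H"
    and invW: "\<And>h v. h \<in> carrier H \<Longrightarrow> v \<in> W \<Longrightarrow> ltrans h v \<in> W"
    using W(1) by (auto simp: invariant_subspace_def)
  obtain B where B: "B \<subseteq> W" "cfun.independent B" "W \<subseteq> cfun.span B"
    using cfun.basis_exists[of W] by metis
  have finB: "finite B" using finite_independent[OF B(2)] B(1) suppW by blast
  define n where "n = card B"
  obtain w where w: "bij_betw w {..<n} B"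
    using ex_bij_betw_nat_finite[OF finB] by (auto simp: n_def atLeast0LessThan)
  have wB: "w j \<in> B" if "j < n" for j using w that by (auto simp: bij_betw_def)
  \<comment> \<open>The coordinate isomorphism from column vectors onto \<open>W\<close>.\<close>
  define comb where "comb = (\<lambda>u::complex vec. \<Sum>i<n. cscale (u $ i) (w i))"
  have comb_W: "comb u \<in> W" for u
    unfolding comb_def using wB B(1)
    by (intro cfun.subspace_sum[OF subW] cfun.subspace_scale[OF subW]) auto
  have comb_add: "comb (u + v) = comb u + comb v" if "u \<in> carrier_vec n" "v \<in> carrier_vec n" for u v
    using that by (auto simp: comb_def fun_eq_iff sum_fun_apply cscale_def algebra_simps sum.distrib)
  have comb_scale: "comb (c \<cdot>\<^sub>v v) = cscale c (comb v)" if "v \<in> carrier_vec n" for c v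
    using that by (auto simp: comb_def fun_eq_iff sum_fun_apply cscale_def sum_distrib_left mult_ac)
  have comb_zero: "comb (0\<^sub>v n) = 0"
    by (auto simp: comb_def fun_eq_iff sum_fun_apply cscale_def)
  have comb_0: "u = 0\<^sub>v n" if u: "u \<in> carrier_vec n" "comb u = 0" for u
  proof -
    define a where "a = (\<lambda>b. u $ the_inv_into {..<n} w b)"
    have aw: "a (w i) = u $ i" if "i < n" for i
      using w that by (simp add: a_def bij_betw_def the_inv_into_f_f)
    have "(\<Sum>b\<in>B. cscale (a b) b) = (\<Sum>i<n. cscale (a (w i)) (w i))"
      using sum.reindex_bij_betw[OF w, of "\<lambda>b. cscale (a b) b"] by simp
    also have "\<dots> = comb u" unfolding comb_def by (intro sum.cong refl) (simp add: aw)
    finally have "(\<Sum>b\<in>B. cscale (a b) b) = 0" using u(2) by simp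
    then have "a b = 0" if "b \<in> B" for b
      using cfun.independentD[OF B(2) finB subset_refl _ that, of a] by blast
    then have "u $ i = 0" if "i < n" for i using aw[OF that] wB[OF that] by metis
    then show ?thesis using u(1) by (intro eq_vecI) auto
  qed
  have comb_inj: "u = v" if uv: "u \<in> carrier_vec n" "v \<in> carrier_vec n" "comb u = comb v" for u v
  proof -
    have neg: "u - v = u + (- 1) \<cdot>\<^sub>v v" using uv by (intro eq_vecI) auto
    have "comb (u - v) = comb u + cscale (- 1) (comb v)"
      unfolding neg using uv by (simp add: comb_add comb_scale)
    then have "comb (u - v) = 0" using uv(3) by (simp add: fun_eq_iff cscale_def)
    then have "u - v = 0\<^sub>v n" using uv by (intro comb_0) auto
    then have "u $ i = v $ i" if "i < n" for i
      using uv that by (metis carrier_vecD eq_iff_diff_eq_0 index_minus_vec(1) index_zero_vec(1))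
    then show ?thesis using uv by (intro eq_vecI) auto
  qed
  have comb_surj: "\<exists>u\<in>carrier_vec n. v = comb u" if v: "v \<in> W" for v
  proof -
    obtain r where r: "v = (\<Sum>b\<in>B. cscale (r b) b)"
      using v B(3) cfun.span_finite[OF finB] by auto
    also have "\<dots> = (\<Sum>i<n. cscale (r (w i)) (w i))"
      using sum.reindex_bij_betw[OF w, of "\<lambda>b. cscale (r b) b"] by simp
    also have "\<dots> = comb (vec n (\<lambda>i. r (w i)))"
      unfolding comb_def by (intro sum.cong refl) simp
    finally show ?thesis by (intro bexI[of _ "vec n (\<lambda>i. r (w i))"]) auto
  qed
  have comb_unit: "comb (unit_vec n j) = w j" if "j < n" for j
  proof -
    have "comb (unit_vec n j) = (\<Sum>i<n. if i = j then w j else 0)"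
      unfolding comb_def using that by (intro sum.cong refl) (auto simp: cscale_def fun_eq_iff)
    then show ?thesis using that by simp
  qed
  have "\<forall>h j. \<exists>u. u \<in> carrier_vec n \<and> (h \<in> carrier H \<longrightarrow> j < n \<longrightarrow> ltrans h (w j) = comb u)"
  proof (intro allI)
    fix h j
    show "\<exists>u. u \<in> carrier_vec n \<and> (h \<in> carrier H \<longrightarrow> j < n \<longrightarrow> ltrans h (w j) = comb u)"
    proof (cases "h \<in> carrier H \<and> j < n")
      case True
      then have "ltrans h (w j) \<in> W" using invW wB B(1) by blast
      then show ?thesis using comb_surj by blast
    qed (auto intro: exI[of _ "0\<^sub>v n"])
  qed
  then obtain c where c: "\<And>h j. c h j \<in> carrier_vec n"
    "\<And>h j. h \<in> carrier H \<Longrightarrow> j < n \<Longrightarrow> ltrans h (w j) = comb (c h j)"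
    by metis
  define \<rho> where "\<rho> = (\<lambda>h. mat n n (\<lambda>(i, j). c h j $ i))"
  have \<rho>c: "\<rho> h \<in> carrier_mat n n" for h by (simp add: \<rho>_def)
  have \<rho>u: "\<rho> h *\<^sub>v unit_vec n j = c h j" if "j < n" for h j
    unfolding mat_unit_vec_col[OF \<rho>c that] using that c(1)[of h j] by (auto simp: \<rho>_def)
  have \<rho>w: "ltrans h (w j) = (\<Sum>i<n. cscale (\<rho> h $$ (i, j)) (w i))" if "h \<in> carrier H" "j < n" for h j
    unfolding c(2)[OF that] comb_def using that by (intro sum.cong refl) (simp add: \<rho>_def)
  have \<rho>comb: "ltrans h (comb u) = comb (\<rho> h *\<^sub>v u)" if h: "h \<in> carrier H" and u: "u \<in> carrier_vec n" for h u
  proof -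
    have "ltrans h (comb u) = (\<Sum>j<n. cscale (u $ j) (\<Sum>i<n. cscale (\<rho> h $$ (i, j)) (w i)))"
      unfolding comb_def ltrans_sum ltrans_scale using \<rho>w[OF h] by (intro sum.cong refl) simp
    also have "\<dots> = (\<Sum>j<n. \<Sum>i<n. cscale (\<rho> h $$ (i, j) * u $ j) (w i))"
      by (simp add: cfun.scale_sum_right mult.commute)
    also have "\<dots> = (\<Sum>i<n. \<Sum>j<n. cscale (\<rho> h $$ (i, j) * u $ j) (w i))" by (rule sum.swap)
    also have "\<dots> = (\<Sum>i<n. cscale ((\<rho> h *\<^sub>v u) $ i) (w i))"
      using u by (intro sum.cong refl)
        (simp add: cfun.scale_sum_left[symmetric] scalar_prod_def \<rho>_def atLeast0LessThan)
    finally show ?thesis by (simp add: comb_def)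
  qed
  have mat_eq: "X = Y" if XY: "X \<in> carrier_mat n n" "Y \<in> carrier_mat n n"
      "\<And>j. j < n \<Longrightarrow> X *\<^sub>v unit_vec n j = Y *\<^sub>v unit_vec n j" for X Y :: "complex mat"
  proof (rule mat_col_eqI)
    fix j assume "j < dim_col Y"
    then have "j < n" using XY by simp
    then show "col X j = col Y j" using XY(3)[of j] by (simp add: mat_unit_vec_col[OF XY(1)] mat_unit_vec_col[OF XY(2)])
  qed (use XY in auto)
  have rep: "matrix_rep H n \<rho>"
    unfolding matrix_rep_def
  proof (intro conjI ballI)
    show "\<rho> h \<in> carrier_mat n n" for h by (rule \<rho>c)
    show "\<rho> \<one> = 1\<^sub>m n"
    proof (rule mat_eq)
      fix j assume j: "j < n"
      have "comb (\<rho> \<one> *\<^sub>v unit_vec n j) = ltrans \<one> (w j)" using j by (simp add: \<rho>u c(2))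
      also have "\<dots> = comb (unit_vec n j)"
        using ltrans_one[of "w j"] wB[OF j] B(1) suppW comb_unit[OF j] by auto
      finally have "\<rho> \<one> *\<^sub>v unit_vec n j = unit_vec n j"
        using \<rho>u[OF j] c(1) by (intro comb_inj) auto
      then show "\<rho> \<one> *\<^sub>v unit_vec n j = 1\<^sub>m n *\<^sub>v unit_vec n j" by simp
    qed (use \<rho>c in auto)
    show "\<rho> (h \<otimes> k) = \<rho> h * \<rho> k" if hk: "h \<in> carrier H" "k \<in> carrier H" for h k
    proof (rule mat_eq)
      fix j assume j: "j < n"
      have "comb (\<rho> (h \<otimes> k) *\<^sub>v unit_vec n j) = ltrans (h \<otimes> k) (w j)"
        using j hk by (simp add: \<rho>u c(2))
      also have "\<dots> = ltrans h (comb (\<rho> k *\<^sub>v unit_vec n j))"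
        unfolding ltrans_mult[OF hk] c(2)[OF hk(2) j] \<rho>u[OF j] ..
      also have "\<dots> = comb (\<rho> h *\<^sub>v (\<rho> k *\<^sub>v unit_vec n j))"
        using hk \<rho>u[OF j] c(1) by (intro \<rho>comb) auto
      finally have "\<rho> (h \<otimes> k) *\<^sub>v unit_vec n j = \<rho> h *\<^sub>v (\<rho> k *\<^sub>v unit_vec n j)"
        using mult_mat_vec_carrier[OF \<rho>c c(1)] by (intro comb_inj) (simp_all add: \<rho>u[OF j] c(1))
      then show "\<rho> (h \<otimes> k) *\<^sub>v unit_vec n j = (\<rho> h * \<rho> k) *\<^sub>v unit_vec n j"
        using assoc_mult_mat_vec[OF \<rho>c \<rho>c unit_vec_carrier, of h k j] by simp
    qed (rule \<rho>c mult_carrier_mat[OF \<rho>c \<rho>c])+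
  qed
  have n: "n > 0"
  proof (rule ccontr)
    assume "\<not> n > 0"
    then have "B = {}" using finB by (simp add: n_def)
    then have "W \<subseteq> {0}" using B(3) by simp
    then show False using W(2) cfun.subspace_0[OF subW] by blast
  qed
  have irr: "irreducible_rep H n \<rho>"
    unfolding irreducible_rep_def
  proof (intro conjI allI impI rep n)
    fix U assume sub: "VectorSpace.subspace class_ring U (module_vec TYPE(complex) n)"
      and inv: "\<forall>g\<in>carrier H. \<forall>w\<in>U. \<rho> g *\<^sub>v w \<in> U"
    note U = subspace_module_vecD[OF sub]
    have Uc: "u \<in> carrier_vec n" if "u \<in> U" for u using U(1) that by blast
    have invU: "invariant_subspace (comb ` U)"
      unfolding invariant_subspace_def
    proof (intro conjI ballI)
      show "cfun.subspace (comb ` U)"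
      proof (rule cfun.subspaceI)
        show "0 \<in> comb ` U" using U(2) comb_zero[symmetric] by (rule image_eqI[rotated])
      next
        fix x y assume "x \<in> comb ` U" "y \<in> comb ` U"
        then obtain u v where uv: "u \<in> U" "v \<in> U" "x = comb u" "y = comb v" by blast
        then have "x + y = comb (u + v)" using comb_add[OF Uc Uc] by simp
        then show "x + y \<in> comb ` U" using U(3)[OF uv(1,2)] by (rule image_eqI)
      next
        fix c x assume "x \<in> comb ` U"
        then obtain u where u: "u \<in> U" "x = comb u" by blast
        then have "cscale c x = comb (c \<cdot>\<^sub>v u)" using comb_scale[OF Uc] by simp
        then show "cscale c x \<in> comb ` U" using U(4)[OF u(1)] by (rule image_eqI)
      qed
      show "comb ` U \<subseteq> supp_on H" using comb_W suppW by blast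
      fix h v assume h: "h \<in> carrier H" and "v \<in> comb ` U"
      then obtain u where u: "u \<in> U" "v = comb u" by blast
      then have "ltrans h v = comb (\<rho> h *\<^sub>v u)" using \<rho>comb[OF h Uc] by simp
      then show "ltrans h v \<in> comb ` U" using inv h u(1) by blast
    qed
    show "U = {0\<^sub>v n} \<or> U = carrier_vec n"
    proof (cases "comb ` U = {0}")
      case True
      then have "U \<subseteq> {0\<^sub>v n}" using comb_0 Uc by blast
      then show ?thesis using U(2) by blast
    next
      case False
      then have eq: "comb ` U = W" using min[OF invU] comb_W by blast
      have "v \<in> U" if v: "v \<in> carrier_vec n" for v
      proof -
        have "comb v \<in> comb ` U" unfolding eq by (rule comb_W)
        then obtain u where "u \<in> U" "comb v = comb u" by blast
        then show ?thesis using comb_inj[OF v Uc] by blast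
      qed
      then show ?thesis using U(1) by blast
    qed
  qed
  show thesis
  proof (rule that[OF irr _ \<rho>w])
    show "w j \<in> W \<and> w j \<noteq> 0" if "j < n" for j
    proof
      show "w j \<in> W" using wB[OF that] B(1) by (rule rev_subsetD)
      show "w j \<noteq> 0"
      proof
        assume "w j = 0"
        then have "0 \<in> B" using wB[OF that] by simp
        then show False using cfun.dependent_zero[of B] B(2) by simp
      qed
    qed
  qed
qed

lemma sum_cj:
  assumes "k \<in> carrier H"
  shows "(\<Sum>h\<in>carrier H. F (cj H k h)) = (\<Sum>h\<in>carrier H. F h)"
  by (rule sum.reindex_bij_witness[of _ "\<lambda>h. cj H (inv k) h" "\<lambda>h. cj H k h"])
    (use assms in \<open>auto simp: cj_inv_cj cj_cj_inv cj_closed\<close>)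

text \<open>The Fourier transform of the complex conjugate of \<open>g\<close> at \<open>\<rho>\<close>.\<close>

definition fourier_mat where
  "fourier_mat g n \<rho> = mat n n (\<lambda>(i, j). \<Sum>h\<in>carrier H. cnj (g h) * \<rho> h $$ (i, j))"

lemma fourier_mat_intertwines:
  assumes rep: "matrix_rep H n \<rho>" and g: "g \<in> class_funs H" and k: "k \<in> carrier H"
  shows "\<rho> k * fourier_mat g n \<rho> = fourier_mat g n \<rho> * \<rho> k"
proof (rule eq_matI)
  let ?A = "fourier_mat g n \<rho>"
  have A: "?A \<in> carrier_mat n n" by (simp add: fourier_mat_def)
  note \<rho> = matrix_repD[OF rep]
  fix a b assume "a < dim_row (?A * \<rho> k)" "b < dim_col (?A * \<rho> k)"
  then have ab: "a < n" "b < n" using A \<rho>(1)[OF k] by auto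
  have "(\<rho> k * ?A) $$ (a, b) = (\<Sum>c<n. \<rho> k $$ (a, c) * ?A $$ (c, b))"
    by (rule mat_mult_entry[OF \<rho>(1)[OF k] A ab])
  also have "\<dots> = (\<Sum>c<n. \<Sum>h\<in>carrier H. cnj (g h) * (\<rho> k $$ (a, c) * \<rho> h $$ (c, b)))"
    using ab by (simp add: fourier_mat_def sum_distrib_left mult_ac)
  also have "\<dots> = (\<Sum>h\<in>carrier H. cnj (g h) * \<rho> (k \<otimes> h) $$ (a, b))"
    by (subst sum.swap) (simp add: sum_distrib_left[symmetric] \<rho>(3)[OF k]
        mat_mult_entry[OF \<rho>(1)[OF k] \<rho>(1) ab] del: index_mult_mat(1))
  also have "\<dots> = (\<Sum>h\<in>carrier H. cnj (g (cj H k h)) * \<rho> (cj H k h \<otimes> k) $$ (a, b))"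
  proof (rule sum.cong[OF refl])
    fix h assume h: "h \<in> carrier H"
    have "cj H k h \<otimes> k = k \<otimes> h" using h k by (simp add: cj_def m_assoc)
    then show "cnj (g h) * \<rho> (k \<otimes> h) $$ (a, b) = cnj (g (cj H k h)) * \<rho> (cj H k h \<otimes> k) $$ (a, b)"
      using g h k by (simp add: class_funs_def)
  qed
  also have "\<dots> = (\<Sum>h\<in>carrier H. cnj (g h) * \<rho> (h \<otimes> k) $$ (a, b))" by (rule sum_cj[OF k])
  also have "\<dots> = (\<Sum>h\<in>carrier H. \<Sum>c<n. cnj (g h) * \<rho> h $$ (a, c) * \<rho> k $$ (c, b))"
    by (simp add: sum_distrib_left \<rho>(3)[OF _ k] mult.assoc
        mat_mult_entry[OF \<rho>(1) \<rho>(1)[OF k] ab] del: index_mult_mat(1))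
  also have "\<dots> = (\<Sum>c<n. (\<Sum>h\<in>carrier H. cnj (g h) * \<rho> h $$ (a, c)) * \<rho> k $$ (c, b))"
    by (subst sum.swap) (simp add: sum_distrib_right)
  also have "\<dots> = (\<Sum>c<n. ?A $$ (a, c) * \<rho> k $$ (c, b))"
    using ab by (simp add: fourier_mat_def)
  also have "\<dots> = (?A * \<rho> k) $$ (a, b)"
    by (rule mat_mult_entry[OF A \<rho>(1)[OF k] ab, symmetric])
  finally show "(\<rho> k * ?A) $$ (a, b) = (?A * \<rho> k) $$ (a, b)" .
qed (use matrix_repD(1)[OF rep k] in \<open>auto simp: fourier_mat_def\<close>)

text \<open>
  For a class function the Fourier transform is an intertwiner, hence a scalar, and its trace is the
  group order times the conjugate of the inner product of \<open>g\<close> with the character.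
\<close>

lemma fourier_mat_zero:
  assumes irr: "irreducible_rep H n \<rho>" and g: "g \<in> class_funs H"
    and orth: "herm H g (rep_character H n \<rho>) = 0"
  shows "fourier_mat g n \<rho> = 0\<^sub>m n n"
proof -
  have rep: "matrix_rep H n \<rho>" and n: "n > 0" using irr by (auto simp: irreducible_rep_def)
  let ?A = "fourier_mat g n \<rho>"
  obtain z where z: "?A = z \<cdot>\<^sub>m 1\<^sub>m n"
  proof (rule schur_scalar[OF irr, of ?A])
    show "?A \<in> carrier_mat n n" by (simp add: fourier_mat_def)
  qed (rule fourier_mat_intertwines[OF rep g], assumption, rule that)
  have "of_nat n * z = (\<Sum>i<n. ?A $$ (i, i))" by (simp add: z)
  also have "\<dots> = (\<Sum>h\<in>carrier H. cnj (g h) * rep_character H n \<rho> h)"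
  proof -
    have "(\<Sum>i<n. ?A $$ (i, i)) = (\<Sum>i<n. \<Sum>h\<in>carrier H. cnj (g h) * \<rho> h $$ (i, i))"
      by (simp add: fourier_mat_def)
    also have "\<dots> = (\<Sum>h\<in>carrier H. \<Sum>i<n. cnj (g h) * \<rho> h $$ (i, i))" by (rule sum.swap)
    also have "\<dots> = (\<Sum>h\<in>carrier H. cnj (g h) * rep_character H n \<rho> h)"
      by (intro sum.cong refl) (simp add: rep_character_def sum_distrib_left)
    finally show ?thesis .
  qed
  also have "\<dots> = cnj (\<Sum>h\<in>carrier H. g h * cnj (rep_character H n \<rho> h))" by simp
  also have "\<dots> = 0" using orth card_pos by (auto simp: herm_def)
  finally have "z = 0" using n by simp
  then show ?thesis unfolding z by (intro eq_matI) auto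
qed

text \<open>
  Let \<open>T\<close> be the operator on functions on the group given by the Fourier transform of the conjugate of
  \<open>g\<close> at the regular representation.  Its kernel \<open>N\<close> and the orthogonal complement \<open>N'\<close> are invariant.  If \<open>g \<noteq> 0\<close>, then \<open>T\<close> does not
  annihilate the indicator function of the identity, so \<open>N'\<close> is not zero and contains a minimal
  invariant subspace \<open>W\<close>.  On \<open>W\<close> the operator acts by the Fourier transform of this conjugate at
  an irreducible representation, which is zero.  Thus \<open>W\<close> lies in both \<open>N\<close> and \<open>N'\<close>, a contradiction.
\<close>

lemma class_fun_orthogonal_zero:
  assumes g: "g \<in> class_funs H" and orth: "\<And>\<chi>. \<chi> \<in> Irr H \<Longrightarrow> herm H g \<chi> = 0"
  shows "g = 0"
proof (rule ccontr)
  assume g0: "g \<noteq> 0"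
  define T where "T = (\<lambda>v. \<Sum>h\<in>carrier H. cscale (cnj (g h)) (ltrans h v))"
  have T_add: "T (u + v) = T u + T v" for u v
    by (simp add: T_def ltrans_add cfun.scale_right_distrib sum.distrib)
  have T_scale: "T (cscale c v) = cscale c (T v)" for c v
    by (simp add: T_def ltrans_scale cfun.scale_sum_right mult.commute)
  have T_zero: "T 0 = 0" by (simp add: T_def ltrans_zero)
  have T_ltrans: "T (ltrans k v) = ltrans k (T v)" if k: "k \<in> carrier H" for k v
  proof -
    have "T (ltrans k v) = (\<Sum>h\<in>carrier H. cscale (cnj (g (cj H k h))) (ltrans (cj H k h) (ltrans k v)))"
      unfolding T_def by (rule sum_cj[OF k, symmetric])
    also have "\<dots> = (\<Sum>h\<in>carrier H. cscale (cnj (g h)) (ltrans k (ltrans h v)))"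
    proof (rule sum.cong[OF refl])
      fix h assume h: "h \<in> carrier H"
      have "cj H k h \<otimes> k = k \<otimes> h" "cj H k h \<in> carrier H" using h k by (simp_all add: cj_def m_assoc)
      then have "ltrans (cj H k h) (ltrans k v) = ltrans k (ltrans h v)"
        using h k by (metis ltrans_mult)
      then show "cscale (cnj (g (cj H k h))) (ltrans (cj H k h) (ltrans k v)) =
          cscale (cnj (g h)) (ltrans k (ltrans h v))"
        using g h k by (simp add: class_funs_def)
    qed
    finally show ?thesis by (simp add: T_def ltrans_sum ltrans_scale)
  qed
  define N where "N = {v \<in> supp_on H. T v = 0}"
  define N' where "N' = {u \<in> supp_on H. \<forall>v\<in>N. herm H u v = 0}"
  note sup = subspace_supp_on[of H, unfolded cfun.subspace_def]
  have N_inv: "ltrans k v \<in> N" if "k \<in> carrier H" "v \<in> N" for k v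
    using that by (simp add: N_def T_ltrans ltrans_zero ltrans_supp)
  have N_sub: "cfun.subspace N"
    using sup by (auto simp: cfun.subspace_def N_def T_add T_scale T_zero)
  have N'_inv: "invariant_subspace N'"
    unfolding invariant_subspace_def
  proof (intro conjI ballI)
    show "cfun.subspace N'"
      using sup by (auto simp: cfun.subspace_def N'_def herm_linear)
    show "N' \<subseteq> supp_on H" by (auto simp: N'_def)
    fix k u assume k: "k \<in> carrier H" and u: "u \<in> N'"
    have "herm H (ltrans k u) v = 0" if "v \<in> N" for v
      using u N_inv[OF inv_closed[OF k] that] by (simp add: herm_ltrans[OF k] N'_def)
    then show "ltrans k u \<in> N'" using ltrans_supp by (simp add: N'_def)
  qed
  define \<delta> where "\<delta> = (\<lambda>x. if x = \<one> then 1 else 0 :: complex)"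
  have \<delta>: "\<delta> \<in> supp_on H" by (auto simp: \<delta>_def supp_on_def)
  have T\<delta>: "T \<delta> x = cnj (g x)" if x: "x \<in> carrier H" for x
  proof -
    have "T \<delta> x = (\<Sum>h\<in>carrier H. if h = x then cnj (g x) else 0)"
      unfolding T_def sum_fun_apply
    proof (rule sum.cong[OF refl])
      fix h assume h: "h \<in> carrier H"
      have "inv h \<otimes> x = \<one> \<longleftrightarrow> h = x"
        using h x by (metis inv_closed inv_equality inv_inv l_inv)
      then show "cscale (cnj (g h)) (ltrans h \<delta>) x = (if h = x then cnj (g x) else 0)"
        using x by (simp add: cscale_def ltrans_def \<delta>_def)
    qed
    then show ?thesis using x fin by simp
  qed
  have \<delta>_notin: "\<delta> \<notin> N"
  proof
    assume "\<delta> \<in> N"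
    then have T0: "T \<delta> = 0" by (simp add: N_def)
    have "g x = 0" for x
    proof (cases "x \<in> carrier H")
      case True
      then have "cnj (g x) = 0" using T\<delta>[OF True] T0 by simp
      then show ?thesis by simp
    next
      case False
      then show ?thesis using g by (simp add: class_funs_def supp_on_def)
    qed
    then show False using g0 by (simp add: fun_eq_iff)
  qed
  have "N' \<noteq> {0}"
  proof -
    obtain S where S: "S \<subseteq> N" "cfun.independent S" "N \<subseteq> cfun.span S"
      using cfun.basis_exists[of N] by metis
    have "finite S" using S(1) by (intro finite_independent[OF S(2)]) (auto simp: N_def)
    then obtain p where p: "p \<in> cfun.span S" "\<And>s. s \<in> S \<Longrightarrow> herm H (\<delta> - p) s = 0"
      using projection_exists[of S \<delta>] by blast
    have pN: "p \<in> N" using p(1) cfun.span_minimal[OF S(1) N_sub] by blast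
    have "\<delta> - p \<in> supp_on H"
      using \<delta> pN cfun.subspace_diff[OF subspace_supp_on] by (auto simp: N_def)
    moreover have "herm H (\<delta> - p) v = 0" if "v \<in> N" for v
      using herm_span_right_zero[of v S H "\<delta> - p"] S(3) that p(2) by blast
    ultimately have "\<delta> - p \<in> N'" by (simp add: N'_def)
    moreover have "\<delta> - p \<noteq> 0" using \<delta>_notin pN by auto
    ultimately show ?thesis by blast
  qed
  with N'_inv obtain W where W: "invariant_subspace W" "W \<subseteq> N'" "W \<noteq> {0}"
    "\<And>W'. invariant_subspace W' \<Longrightarrow> W' \<subseteq> W \<Longrightarrow> W' \<noteq> {0} \<Longrightarrow> W' = W"
    by (rule minimal_invariant_exists) (rule that)
  obtain n \<rho> w where r: "irreducible_rep H n \<rho>" "\<And>j. j < n \<Longrightarrow> w j \<in> W \<and> w j \<noteq> 0"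
    "\<And>h j. h \<in> carrier H \<Longrightarrow> j < n \<Longrightarrow> ltrans h (w j) = (\<Sum>i<n. cscale (\<rho> h $$ (i, j)) (w i))"
    by (rule minimal_invariant_rep[OF W(1,3,4)]) (assumption, assumption, assumption, rule that)
  have n: "0 < n" using r(1) by (simp add: irreducible_rep_def)
  have "rep_character H n \<rho> \<in> Irr H" using r(1) by (auto simp: Irr_def)
  then have A0: "fourier_mat g n \<rho> = 0\<^sub>m n n" using fourier_mat_zero[OF r(1) g] orth by blast
  have "T (w 0) = (\<Sum>h\<in>carrier H. \<Sum>i<n. cscale (cnj (g h) * \<rho> h $$ (i, 0)) (w i))"
    unfolding T_def using r(3)[OF _ n] by (intro sum.cong refl) (simp add: cfun.scale_sum_right)
  also have "\<dots> = (\<Sum>i<n. \<Sum>h\<in>carrier H. cscale (cnj (g h) * \<rho> h $$ (i, 0)) (w i))" by (rule sum.swap)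
  also have "\<dots> = (\<Sum>i<n. cscale (fourier_mat g n \<rho> $$ (i, 0)) (w i))"
    using n by (intro sum.cong refl) (simp add: fourier_mat_def cfun.scale_sum_left)
  also have "\<dots> = 0" unfolding A0 using n by (intro sum.neutral ballI) simp
  finally have "T (w 0) = 0" .
  moreover have w0: "w 0 \<in> W" "w 0 \<noteq> 0" using r(2)[OF n] by auto
  ultimately have "w 0 \<in> N" "w 0 \<in> N'" using W(1,2) by (auto simp: N_def invariant_subspace_def)
  then have "herm H (w 0) (w 0) = 0" "w 0 \<in> supp_on H" by (auto simp: N'_def)
  then show False using herm_self_zero_supp w0(2) by blast
qed

lemma class_funs_span: "class_funs H \<subseteq> cfun.span (Irr H)"
proof
  fix f assume f: "f \<in> class_funs H"
  obtain p where p: "p \<in> cfun.span (Irr H)" "\<And>\<chi>. \<chi> \<in> Irr H \<Longrightarrow> herm H (f - p) \<chi> = 0"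
    using projection_exists[OF finite_Irr, of f] by blast
  have "p \<in> class_funs H" using p(1) cfun.span_minimal[OF Irr_class_fun subspace_class_fun] by blast
  then have "f - p \<in> class_funs H" using f cfun.subspace_diff[OF subspace_class_fun] by blast
  then have "f - p = 0" using class_fun_orthogonal_zero p(2) by blast
  then show "f \<in> cfun.span (Irr H)" using p(1) by simp
qed

lemma Irr_expand:
  assumes "f \<in> cfun.span (Irr H)"
  shows "f = (\<Sum>\<chi>\<in>Irr H. cscale (herm H f \<chi>) \<chi>)"
proof -
  have "f - (\<Sum>\<chi>\<in>Irr H. cscale (herm H f \<chi>) \<chi>) = 0"
  proof (rule span_nondegenerate[OF Irr_supp])
    show "f - (\<Sum>\<chi>\<in>Irr H. cscale (herm H f \<chi>) \<chi>) \<in> cfun.span (Irr H)"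
      using assms by (intro cfun.span_diff cfun.span_sum cfun.span_scale) (auto intro: cfun.span_base)
    show "herm H (f - (\<Sum>\<chi>\<in>Irr H. cscale (herm H f \<chi>) \<chi>)) \<theta> = 0" if "\<theta> \<in> Irr H" for \<theta>
      using that finite_Irr
      by (simp add: herm_linear Irr_orthonormal if_distrib cong: if_cong sum.cong)
  qed
  then show ?thesis by simp
qed

end

section \<open>Galois conjugates of character values\<close>

context fin_grp
begin

lemma zchar_values:
  assumes \<theta>: "\<theta> \<in> zfun.span (Irr H)" and u: "u \<in> carrier H"
  shows "\<exists>P. \<forall>k::nat. \<theta> (u [^] k) = rpoly P (cis (2 * pi / real (Coset.order H)) ^ k)"
proof -
  define \<zeta> where "\<zeta> = cis (2 * pi / real (Coset.order H))"
  define V where "V = {\<theta>. \<exists>P. \<forall>k::nat. \<theta> (u [^] k) = rpoly P (\<zeta> ^ k)}"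
  have "zfun.span (Irr H) \<subseteq> V"
  proof (rule zfun.span_minimal)
    show "Irr H \<subseteq> V"
    proof
      fix \<chi> assume "\<chi> \<in> Irr H"
      then obtain n \<rho> where \<rho>: "\<chi> = rep_character H n \<rho>" "matrix_rep H n \<rho>"
        by (auto simp: Irr_def irreducible_rep_def)
      obtain j where "\<And>k. rep_character H n \<rho> (u [^] (k::nat)) = (\<Sum>i<n. \<zeta> ^ (j i * k))"
        using character_power[OF \<rho>(2) u] unfolding \<zeta>_def by blast
      then have "\<forall>k::nat. \<chi> (u [^] k) = rpoly (\<Sum>i<n. Polynomial.monom 1 (j i)) (\<zeta> ^ k)"
        by (simp add: \<rho>(1) rpoly_sum rpoly_monom power_mult[symmetric] mult.commute)
      then show "\<chi> \<in> V" unfolding V_def by blast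
    qed
    show "zfun.subspace V"
    proof (rule zfun.subspaceI)
      have "\<forall>k::nat. 0 (u [^] k) = rpoly 0 (\<zeta> ^ k)" by simp
      then show "0 \<in> V" unfolding V_def by blast
    next
      fix f g assume "f \<in> V" "g \<in> V"
      then obtain P Q where "\<forall>k::nat. f (u [^] k) = rpoly P (\<zeta> ^ k)" "\<forall>k::nat. g (u [^] k) = rpoly Q (\<zeta> ^ k)"
        unfolding V_def by blast
      then have "\<forall>k::nat. (f + g) (u [^] k) = rpoly (P + Q) (\<zeta> ^ k)" by (simp add: rpoly_add)
      then show "f + g \<in> V" unfolding V_def by blast
    next
      fix c f assume "f \<in> V"
      then obtain P where "\<forall>k::nat. f (u [^] k) = rpoly P (\<zeta> ^ k)" unfolding V_def by blast
      then have "\<forall>k::nat. zscale c f (u [^] k) = rpoly (Polynomial.smult (of_int c) P) (\<zeta> ^ k)"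
        by (simp add: rpoly_smult zscale_def)
      then show "zscale c f \<in> V" unfolding V_def by blast
    qed
  qed
  then show ?thesis using \<theta> unfolding V_def \<zeta>_def by blast
qed

text \<open>
  Galois conjugation of the values of generalized characters is the power map \<open>u \<mapsto> u\<^sup>k\<close> on the group,
  for \<open>k\<close> in a set of exponents that depends only on the group order.
\<close>

lemma galois_exponents:
  obtains K :: "nat set"
  where "\<And>\<theta> u k. \<lbrakk>\<theta> \<in> zfun.span (Irr H); u \<in> carrier H; k \<in> K; \<theta> u = 0\<rbrakk> \<Longrightarrow> \<theta> (u [^] k) = 0"
    and "\<And>(Q :: complex set) \<gamma> \<theta> u v i. \<lbrakk>finite Q; rat_independent Q \<gamma>;
      \<And>i. i \<in> Q \<Longrightarrow> \<theta> i \<in> zfun.span (Irr H); u \<in> carrier H; v \<in> carrier H;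
      \<And>k. k \<in> K \<Longrightarrow> (\<Sum>i\<in>Q. \<gamma> i * (\<theta> i (u [^] k) - \<theta> i (v [^] k))) = 0; i \<in> Q\<rbrakk>
      \<Longrightarrow> \<theta> i u = \<theta> i v"
proof -
  let ?\<zeta> = "cis (2 * pi / real (Coset.order H))"
  have m: "Coset.order H > 0" using card_pos by (simp add: Coset.order_def)
  show thesis
  proof (rule cyclotomic_exponents[OF m])
    fix K :: "nat set" assume
      K1: "\<And>P k. rpoly P ?\<zeta> = 0 \<Longrightarrow> k \<in> K \<Longrightarrow> rpoly P (?\<zeta> ^ k) = 0" and
      K2: "\<And>(B :: complex set) \<gamma> P i. \<lbrakk>finite B; rat_independent B \<gamma>;
        \<And>k. k \<in> K \<Longrightarrow> (\<Sum>i\<in>B. \<gamma> i * rpoly (P i) (?\<zeta> ^ k)) = 0; i \<in> B\<rbrakk> \<Longrightarrow> rpoly (P i) ?\<zeta> = 0"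
    show thesis
    proof (rule that[of K])
      fix \<theta> u k assume a: "\<theta> \<in> zfun.span (Irr H)" "u \<in> carrier H" "k \<in> K" "\<theta> u = 0"
      obtain P where P: "\<And>k::nat. \<theta> (u [^] k) = rpoly P (?\<zeta> ^ k)"
        using zchar_values[OF a(1,2)] by blast
      have "rpoly P ?\<zeta> = 0" using P[of 1] a(2,4) by simp
      then show "\<theta> (u [^] k) = 0" using K1[OF _ a(3)] P by simp
    next
      fix Q :: "complex set" and \<gamma> \<theta> u v i
      assume Q: "finite Q" "rat_independent Q \<gamma>" and \<theta>: "\<And>i. i \<in> Q \<Longrightarrow> \<theta> i \<in> zfun.span (Irr H)"
        and uv: "u \<in> carrier H" "v \<in> carrier H"
        and sum: "\<And>k. k \<in> K \<Longrightarrow> (\<Sum>i\<in>Q. \<gamma> i * (\<theta> i (u [^] k) - \<theta> i (v [^] k))) = 0"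
        and i: "i \<in> Q"
      have "\<exists>P. \<forall>k::nat. \<theta> i (u [^] k) - \<theta> i (v [^] k) = rpoly P (?\<zeta> ^ k)" if i: "i \<in> Q" for i
      proof -
        obtain P R where "\<And>k::nat. \<theta> i (u [^] k) = rpoly P (?\<zeta> ^ k)" "\<And>k::nat. \<theta> i (v [^] k) = rpoly R (?\<zeta> ^ k)"
          using zchar_values[OF \<theta>[OF i] uv(1)] zchar_values[OF \<theta>[OF i] uv(2)] by blast
        then show ?thesis by (intro exI[of _ "P - R"]) (simp add: rpoly_diff)
      qed
      then obtain P where P: "\<And>i k. i \<in> Q \<Longrightarrow> \<theta> i (u [^] (k::nat)) - \<theta> i (v [^] k) = rpoly (P i) (?\<zeta> ^ k)"
        by metis
      have "rpoly (P i) ?\<zeta> = 0"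
      proof (rule K2[OF Q _ i])
        fix k assume "k \<in> K"
        then show "(\<Sum>i\<in>Q. \<gamma> i * rpoly (P i) (?\<zeta> ^ k)) = 0" using sum P by (simp cong: sum.cong)
      qed
      then show "\<theta> i u = \<theta> i v" using P[OF i, of 1] uv by simp
    qed
  qed
qed

end

section \<open>Blocks\<close>

lemma res_add: "res C (f + g) = res C f + res C g" by (auto simp: res_def fun_eq_iff)
lemma res_cscale: "res C (cscale c f) = cscale c (res C f)" by (auto simp: res_def fun_eq_iff cscale_def)
lemma res_zero: "res C 0 = 0" by (auto simp: res_def fun_eq_iff)
lemma res_sum: "res C (\<Sum>i\<in>A. f i) = (\<Sum>i\<in>A. res C (f i))"
  by (auto simp: res_def fun_eq_iff sum_fun_apply)
lemma res_res: "res C (res C f) = res C f" by (auto simp: res_def)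

lemma herm_res_right: "res C f = f \<Longrightarrow> herm H f (res C g) = herm H f g"
  by (rule herm_cong) (auto simp: res_def fun_eq_iff split: if_splits)

lemma herm_res_left: "res C f = f \<Longrightarrow> herm H (res C g) f = herm H g f"
  by (rule herm_cong) (auto simp: res_def fun_eq_iff split: if_splits)

lemma subspace_res_fixed: "cfun.subspace {f. res C f = f}"
  by (simp add: cfun.subspace_def res_add res_cscale res_zero)

lemma
  assumes "block_union H \<C> b B"
  shows block_union_Irr: "B \<subseteq> Irr H"
    and block_union_link: "\<lbrakk>\<chi> \<in> B; (\<chi>, \<chi>') \<in> block_link H \<C> b\<rbrakk> \<Longrightarrow> \<chi>' \<in> B"
proof -
  obtain BB where BB: "BB \<subseteq> Irr H // (block_link H \<C> b)\<^sup>*" "B = \<Union>BB"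
    using assms by (auto simp: block_union_def blocks_def)
  show "B \<subseteq> Irr H"
  proof
    fix \<chi> assume "\<chi> \<in> B"
    then obtain \<chi>0 where "\<chi>0 \<in> Irr H" "(\<chi>0, \<chi>) \<in> (block_link H \<C> b)\<^sup>*"
      using BB by (auto simp: quotient_def)
    then show "\<chi> \<in> Irr H" by (auto elim: rtranclE simp: block_link_def)
  qed
  assume \<chi>: "\<chi> \<in> B" and link: "(\<chi>, \<chi>') \<in> block_link H \<C> b"
  obtain X where X: "X \<in> BB" "\<chi> \<in> X" using \<chi> BB(2) by blast
  then obtain \<chi>0 where "X = (block_link H \<C> b)\<^sup>* `` {\<chi>0}" using BB(1) by (auto simp: quotient_def)
  then have "\<chi>' \<in> X" using X(2) link by (auto intro: rtrancl_into_rtrancl)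
  then show "\<chi>' \<in> B" using X(1) BB(2) by blast
qed

text \<open>
  A group with a union \<open>B\<close> of blocks; the complex independence of the integral basis makes dual bases
  available.
\<close>

locale block_part = fin_grp H for H :: "('a, 'm) monoid_scheme" (structure) +
  fixes \<C> :: "'a set set" and b B :: "('a \<Rightarrow> complex) set"
  assumes C_carrier: "\<Union>\<C> \<subseteq> carrier H"
    and C_cj: "\<And>g x. g \<in> carrier H \<Longrightarrow> x \<in> \<Union>\<C> \<Longrightarrow> cj H g x \<in> \<Union>\<C>"
    and basis: "z_basis b (res (\<Union>\<C>) ` zfun.span (Irr H))"
    and independent: "cfun.independent b"
    and union: "block_union H \<C> b B"
begin

abbreviation "res_C \<equiv> res (\<Union>\<C>)"
abbreviation "b_B \<equiv> basis_part \<C> b B"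

lemma zindependent: "zfun.independent b" and zspan_b: "zfun.span b = res_C ` zfun.span (Irr H)"
  using basis by (auto simp: z_basis_def)

lemma basis_lift:
  assumes "\<phi> \<in> b" obtains \<theta> where "\<theta> \<in> zfun.span (Irr H)" "\<phi> = res_C \<theta>"
proof -
  have "\<phi> \<in> res_C ` zfun.span (Irr H)" using zfun.span_base[OF assms] unfolding zspan_b .
  then show thesis using that by blast
qed

lemma res_class_fun:
  assumes "f \<in> class_funs H" shows "res_C f \<in> class_funs H"
  using assms cj_mem_iff[OF C_cj] by (auto simp: class_funs_def supp_on_def res_def)

lemma basis_class_fun: "b \<subseteq> class_funs H"
proof
  fix \<phi> assume "\<phi> \<in> b"
  then obtain \<theta> where \<theta>: "\<theta> \<in> zfun.span (Irr H)" "\<phi> = res_C \<theta>" by (rule basis_lift)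
  have "\<theta> \<in> class_funs H"
    using \<theta>(1) zspan_subset_cspan cfun.span_minimal[OF Irr_class_fun subspace_class_fun] by blast
  then show "\<phi> \<in> class_funs H" unfolding \<theta>(2) by (rule res_class_fun)
qed

lemma basis_supp: "b \<subseteq> supp_on H" using basis_class_fun by (auto simp: class_funs_def)

lemma finite_basis: "finite b" by (rule finite_independent[OF independent basis_supp])

lemma part_subset: "b_B \<subseteq> b" by (auto simp: basis_part_def)
lemma part_finite: "finite b_B" using finite_subset[OF part_subset finite_basis] .
lemma part_independent: "cfun.independent b_B" by (rule cfun.independent_mono[OF independent part_subset])
lemma part_supp: "b_B \<subseteq> supp_on H" using part_subset basis_supp by blast

lemma basis_res_fixed: "b \<subseteq> {f. res_C f = f}"
  using basis_lift res_res by (metis (mono_tags, lifting) mem_Collect_eq subsetI)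

lemma span_res_fixed: "f \<in> cfun.span b \<Longrightarrow> res_C f = f"
  using cfun.span_minimal[OF basis_res_fixed subspace_res_fixed] by blast

lemma span_part_subset: "cfun.span b_B \<subseteq> cfun.span b" by (rule cfun.span_mono[OF part_subset])

lemma res_expand:
  assumes "\<chi> \<in> Irr H"
  shows "res_C \<chi> = (\<Sum>\<phi>\<in>b. cscale (of_int (d_coeff \<C> b \<chi> \<phi>)) \<phi>)"
proof -
  have "res_C \<chi> \<in> zfun.span b" unfolding zspan_b using assms by (auto intro: zfun.span_base)
  then have "(\<Sum>\<phi>\<in>b. zscale (d_coeff \<C> b \<chi> \<phi>) \<phi>) = res_C \<chi>"
    unfolding d_coeff_def using zfun.sum_representation_eq[OF zindependent _ finite_basis subset_refl] by blast
  then show ?thesis by (simp add: zscale_eq_cscale)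
qed

lemma herm_dual_Irr:
  assumes "\<phi> \<in> b" "\<chi> \<in> Irr H"
  shows "herm H (dual_elt H b \<phi>) \<chi> = of_int (d_coeff \<C> b \<chi> \<phi>)"
proof -
  note dual = dual_elt[OF finite_basis independent basis_supp assms(1)]
  have "herm H (dual_elt H b \<phi>) \<chi> = herm H (dual_elt H b \<phi>) (res_C \<chi>)"
    by (rule herm_res_right[OF span_res_fixed[OF dual(1)], symmetric])
  also have "\<dots> = (\<Sum>\<theta>\<in>b. of_int (d_coeff \<C> b \<chi> \<theta>) * (if \<theta> = \<phi> then 1 else 0))"
    unfolding res_expand[OF assms(2)] herm_sum_right herm_scale_right
    by (intro sum.cong refl) (simp add: dual(2))
  also have "\<dots> = of_int (d_coeff \<C> b \<chi> \<phi>)"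
    using assms(1) finite_basis by (simp add: if_distrib cong: if_cong)
  finally show ?thesis .
qed

text \<open>
  Orthonormality reduces this to \<open>\<langle>\<Phi>\<^sub>\<phi>, \<chi>\<rangle> = d\<^sub>\<chi>\<^sub>\<phi>\<close>, which holds because \<open>\<Phi>\<^sub>\<phi>\<close> vanishes off \<open>C\<close>, so that \<open>\<chi>\<close> may
  be replaced by its restriction.
\<close>

lemma dual_expand:
  assumes "\<phi> \<in> b"
  shows "dual_elt H b \<phi> = (\<Sum>\<chi>\<in>Irr H. cscale (of_int (d_coeff \<C> b \<chi> \<phi>)) \<chi>)"
proof -
  have "dual_elt H b \<phi> \<in> class_funs H"
    using dual_elt_in_span[OF finite_basis independent basis_supp assms]
      cfun.span_minimal[OF basis_class_fun subspace_class_fun] by blast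
  then have "dual_elt H b \<phi> \<in> cfun.span (Irr H)" using class_funs_span by blast
  from Irr_expand[OF this] show ?thesis using herm_dual_Irr[OF assms] by (simp cong: sum.cong)
qed

lemmas block_Irr = block_union_Irr[OF union] and block_closed = block_union_link[OF union]

lemma dual_in_block:
  assumes "\<phi> \<in> b_B" shows "dual_elt H b \<phi> \<in> cfun.span B"
proof -
  obtain \<chi>0 where \<chi>0: "\<phi> \<in> b" "\<chi>0 \<in> B" "d_coeff \<C> b \<chi>0 \<phi> \<noteq> 0"
    using assms by (auto simp: basis_part_def)
  have "cscale (of_int (d_coeff \<C> b \<chi> \<phi>)) \<chi> \<in> cfun.span B" if "\<chi> \<in> Irr H" for \<chi>
  proof (cases "d_coeff \<C> b \<chi> \<phi> = 0")
    case True
    then show ?thesis using cfun.span_zero by simp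
  next
    case False
    then have "(\<chi>0, \<chi>) \<in> block_link H \<C> b" using \<chi>0 that block_Irr by (auto simp: block_link_def)
    then have "\<chi> \<in> B" by (rule block_closed[OF \<chi>0(2)])
    then show ?thesis by (intro cfun.span_scale cfun.span_base)
  qed
  then show ?thesis unfolding dual_expand[OF \<chi>0(1)] by (rule cfun.span_sum)
qed

lemma dual_off_block:
  assumes "\<phi> \<in> b - b_B" shows "dual_elt H b \<phi> \<in> cfun.span (Irr H - B)"
proof -
  have "cscale (of_int (d_coeff \<C> b \<chi> \<phi>)) \<chi> \<in> cfun.span (Irr H - B)" if "\<chi> \<in> Irr H" for \<chi>
  proof (cases "\<chi> \<in> B")
    case True
    then have "d_coeff \<C> b \<chi> \<phi> = 0" using assms by (auto simp: basis_part_def)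
    then show ?thesis using cfun.span_zero by simp
  qed (use that in \<open>auto intro: cfun.span_scale cfun.span_base\<close>)
  moreover have "\<phi> \<in> b" using assms by blast
  ultimately show ?thesis unfolding dual_expand[OF \<open>\<phi> \<in> b\<close>] by (intro cfun.span_sum)
qed

text \<open>
  Expand \<open>\<phi>\<close> in the dual basis and split the sum into the part \<open>p\<close> from \<open>b\<^sub>B\<close> and the part \<open>q\<close> from its
  complement.  The two parts are combinations of disjoint sets of irreducible characters, so
  \<open>\<langle>\<phi>, q\<rangle> = \<langle>q, q\<rangle>\<close>; and \<open>\<phi>\<close> is orthogonal to the dual vectors occurring in \<open>q\<close>.
\<close>

lemma part_in_block: "b_B \<subseteq> cfun.span B"
proof
  fix \<phi> assume \<phi>: "\<phi> \<in> b_B"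
  then have \<phi>b: "\<phi> \<in> b" using part_subset by blast
  note fb = finite_basis independent basis_supp
  define p where "p = (\<Sum>\<theta>\<in>b_B. cscale (herm H \<phi> \<theta>) (dual_elt H b \<theta>))"
  define q where "q = (\<Sum>\<theta>\<in>b - b_B. cscale (herm H \<phi> \<theta>) (dual_elt H b \<theta>))"
  have sum: "\<phi> = p + q"
    using span_expand_dual[OF fb cfun.span_base[OF \<phi>b]]
      sum.subset_diff[OF part_subset finite_basis, of "\<lambda>\<theta>. cscale (herm H \<phi> \<theta>) (dual_elt H b \<theta>)"]
    by (simp add: p_def q_def add.commute)
  have p: "p \<in> cfun.span B" unfolding p_def
    by (intro cfun.span_sum cfun.span_scale dual_in_block)
  have q: "q \<in> cfun.span (Irr H - B)" unfolding q_def
    by (intro cfun.span_sum cfun.span_scale dual_off_block)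
  have "herm H p q = 0"
  proof (rule herm_span_right_zero[OF q])
    fix s assume s: "s \<in> Irr H - B"
    show "herm H p s = 0"
    proof (rule herm_span_left_zero[OF p])
      fix t assume "t \<in> B"
      then show "herm H t s = 0" using s block_Irr Irr_orthonormal[of t s] by auto
    qed
  qed
  moreover have "herm H \<phi> q = 0"
    unfolding q_def herm_sum_right herm_scale_right
    using \<phi> \<phi>b by (intro sum.neutral ballI) (auto simp: herm_dual_elt_right[OF fb])
  ultimately have "herm H q q = 0" unfolding sum herm_add_left by simp
  moreover have "q \<in> supp_on H"
    using q cfun.span_mono[of "Irr H - B" "Irr H"] cfun.span_minimal[OF Irr_supp subspace_supp_on] by blast
  ultimately have "q = 0" by (rule herm_self_zero_supp)
  then show "\<phi> \<in> cfun.span B" using sum p by simp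
qed

lemma span_part_in_block: "cfun.span b_B \<subseteq> cfun.span B"
  by (rule cfun.span_minimal[OF part_in_block cfun.subspace_span])

lemma res_in_part:
  assumes "f \<in> cfun.span B" shows "res_C f \<in> cfun.span b_B"
proof -
  have "cfun.span B \<subseteq> {f. res_C f \<in> cfun.span b_B}"
  proof (rule cfun.span_minimal)
    show "B \<subseteq> {f. res_C f \<in> cfun.span b_B}"
    proof
      fix \<chi> assume \<chi>: "\<chi> \<in> B"
      have "cscale (of_int (d_coeff \<C> b \<chi> \<phi>)) \<phi> \<in> cfun.span b_B" if "\<phi> \<in> b" for \<phi>
      proof (cases "d_coeff \<C> b \<chi> \<phi> = 0")
        case True
        then show ?thesis using cfun.span_zero by simp
      next
        case False
        then have "\<phi> \<in> b_B" using that \<chi> by (auto simp: basis_part_def)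
        then show ?thesis by (intro cfun.span_scale cfun.span_base)
      qed
      then have "res_C \<chi> \<in> cfun.span b_B"
        unfolding res_expand[OF subsetD[OF block_Irr \<chi>]] by (rule cfun.span_sum)
      then show "\<chi> \<in> {f. res_C f \<in> cfun.span b_B}" by simp
    qed
    show "cfun.subspace {f. res_C f \<in> cfun.span b_B}"
      by (simp add: cfun.subspace_def res_add res_cscale res_zero cfun.span_zero cfun.span_add cfun.span_scale)
  qed
  then show ?thesis using assms by blast
qed

lemma span_dual_part: "cfun.span (dual_basis H b_B) = cfun.span b_B"
  by (rule span_dual_basis[OF part_finite part_independent part_supp])

text \<open>
  Suppose \<open>u\<^sup>k\<close> is not in \<open>C\<close>.  The indicator function \<open>g\<close> of its class is a complex combination of
  irreducible characters that vanishes on \<open>C\<close>.  Rational coordinates split \<open>g\<close> into integral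
  combinations, and complex independence of \<open>b\<close> forces each of them to vanish on \<open>C\<close>, in
  particular at \<open>u\<close>.  By Galois conjugation each vanishes at \<open>u\<^sup>k\<close>, but \<open>g\<close> does not.
\<close>

lemma powers_closed:
  assumes K: "\<And>\<theta> u k. \<lbrakk>\<theta> \<in> zfun.span (Irr H); u \<in> carrier H; k \<in> K; \<theta> u = 0\<rbrakk> \<Longrightarrow> \<theta> (u [^] k) = 0"
    and u: "u \<in> \<Union>\<C>" and k: "(k::nat) \<in> K"
  shows "u [^] k \<in> \<Union>\<C>"
proof (rule ccontr)
  assume notin: "u [^] k \<notin> \<Union>\<C>"
  have uc: "u \<in> carrier H" "u [^] k \<in> carrier H" using u C_carrier by auto
  define g where "g = (\<lambda>x. if x \<in> conj_class H (u [^] k) then 1 else 0 :: complex)"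
  have g: "g \<in> class_funs H"
    using cj_mem_iff[OF cj_conj_class[OF _ uc(2)]] uc cj_closed
    by (auto simp: g_def class_funs_def supp_on_def conj_class_def[of H "u [^] k"])
  have gC: "res_C g = 0"
  proof -
    have "x \<notin> \<Union>\<C>" if "x \<in> conj_class H (u [^] k)" for x
      using that notin cj_mem_iff[OF C_cj, of _ "u [^] k"] uc(2) by (auto simp: conj_class_def)
    then show ?thesis by (auto simp: res_def g_def fun_eq_iff)
  qed
  obtain a where a: "g = (\<Sum>\<chi>\<in>Irr H. cscale (a \<chi>) \<chi>)"
    using g class_funs_span cfun.span_finite[OF finite_Irr] by auto
  obtain Q :: "complex set" and \<gamma> and n where Q: "finite Q" "rat_independent Q \<gamma>"
    "\<And>\<chi>. \<chi> \<in> Irr H \<Longrightarrow> a \<chi> = (\<Sum>i\<in>Q. of_int (n \<chi> i) * \<gamma> i)"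
    by (rule rational_coordinates[OF finite_Irr, of a]) (rule that)
  define G where "G = (\<lambda>i. \<Sum>\<chi>\<in>Irr H. zscale (n \<chi> i) \<chi>)"
  have G: "G i \<in> zfun.span (Irr H)" for i
    unfolding G_def by (intro zfun.span_sum zfun.span_scale zfun.span_base)
  have gG: "g = (\<Sum>i\<in>Q. cscale (\<gamma> i) (G i))"
    unfolding a G_def by (rule combination_split[OF finite_Irr Q(3)])
  have "(\<Sum>i\<in>Q. cscale (\<gamma> i) (res_C (G i))) = 0" using gC gG by (simp add: res_sum res_cscale)
  moreover have "res_C (G i) \<in> zfun.span b" for i unfolding zspan_b using G by blast
  ultimately have "res_C (G i) = 0" if "i \<in> Q" for i
    using lattice_independent[OF independent Q(1,2), where w = "\<lambda>i. res_C (G i)"] that by blast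
  then have "G i u = 0" if "i \<in> Q" for i using that u by (metis res_def zero_fun_apply)
  then have "G i (u [^] k) = 0" if "i \<in> Q" for i using K[OF G uc(1) k] that by blast
  then have "g (u [^] k) = 0" unfolding gG by (simp add: sum_fun_apply cscale_def)
  moreover have "u [^] k \<in> conj_class H (u [^] k)" by (rule self_in_conj_class[OF uc(2)])
  ultimately show False by (simp add: g_def)
qed

text \<open>
  Splitting the coefficients of \<open>f\<close> into rational coordinates exhibits \<open>f\<close> as a combination of integral
  functions.  The hypotheses contain all Galois conjugates of the equation \<open>f u = f v\<close>, so by the
  descent for cyclotomic numbers each of the integral functions takes equal values at \<open>u\<close> and \<open>v\<close>.
\<close>

lemma rational_descent:
  assumes f: "f \<in> cfun.span b_B"
    and R: "R \<subseteq> \<Union>\<C> \<times> \<Union>\<C>"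
    and const: "\<And>u v k. \<lbrakk>(u, v) \<in> R; u [^] k \<in> \<Union>\<C>; v [^] k \<in> \<Union>\<C>\<rbrakk> \<Longrightarrow> f (u [^] (k::nat)) = f (v [^] k)"
  shows "f \<in> cfun.span {h \<in> zfun.span b_B. \<forall>(u, v)\<in>R. h u = h v}"
proof -
  show ?thesis
  proof (rule galois_exponents)
    fix K assume
      K1: "\<And>\<theta> u k. \<lbrakk>\<theta> \<in> zfun.span (Irr H); u \<in> carrier H; k \<in> K; \<theta> u = 0\<rbrakk> \<Longrightarrow> \<theta> (u [^] (k::nat)) = 0" and
      K2: "\<And>(Q :: complex set) \<gamma> \<theta> u v i. \<lbrakk>finite Q; rat_independent Q \<gamma>;
        \<And>i. i \<in> Q \<Longrightarrow> \<theta> i \<in> zfun.span (Irr H); u \<in> carrier H; v \<in> carrier H;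
        \<And>k. k \<in> K \<Longrightarrow> (\<Sum>i\<in>Q. \<gamma> i * (\<theta> i (u [^] k) - \<theta> i (v [^] k))) = 0; i \<in> Q\<rbrakk>
        \<Longrightarrow> \<theta> i u = \<theta> i v"
    obtain a where a: "f = (\<Sum>\<phi>\<in>b_B. cscale (a \<phi>) \<phi>)"
      using f cfun.span_finite[OF part_finite] by auto
    obtain Q :: "complex set" and \<gamma> and n where Q: "finite Q" "rat_independent Q \<gamma>"
      "\<And>\<phi>. \<phi> \<in> b_B \<Longrightarrow> a \<phi> = (\<Sum>i\<in>Q. of_int (n \<phi> i) * \<gamma> i)"
      by (rule rational_coordinates[OF part_finite, of a]) (rule that)
    define F where "F = (\<lambda>i. \<Sum>\<phi>\<in>b_B. zscale (n \<phi> i) \<phi>)"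
    have fF: "f = (\<Sum>i\<in>Q. cscale (\<gamma> i) (F i))"
      unfolding a F_def by (rule combination_split[OF part_finite Q(3)])
    have F: "F i \<in> zfun.span b_B" for i
      unfolding F_def by (intro zfun.span_sum zfun.span_scale zfun.span_base)
    then have "F i \<in> zfun.span b" for i using zfun.span_mono[OF part_subset] by blast
    then have "\<forall>i. \<exists>\<theta>. \<theta> \<in> zfun.span (Irr H) \<and> F i = res_C \<theta>" unfolding zspan_b by blast
    then obtain \<theta> where \<theta>: "\<And>i. \<theta> i \<in> zfun.span (Irr H)" "\<And>i. F i = res_C (\<theta> i)" by metis
    have F\<theta>: "F i x = \<theta> i x" if "x \<in> \<Union>\<C>" for i x using that \<theta>(2) by (simp add: res_def)
    have "F i u = F i v" if i: "i \<in> Q" and uv: "(u, v) \<in> R" for i u v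
    proof -
      have uC: "u \<in> \<Union>\<C>" "v \<in> \<Union>\<C>" using uv R by auto
      have "\<theta> i u = \<theta> i v"
      proof (rule K2[OF Q(1,2) _ _ _ _ i])
        show "\<theta> i \<in> zfun.span (Irr H)" for i by (rule \<theta>(1))
        show "u \<in> carrier H" "v \<in> carrier H" using uC C_carrier by auto
        fix k assume k: "k \<in> K"
        have pC: "u [^] k \<in> \<Union>\<C>" "v [^] k \<in> \<Union>\<C>"
          by (rule powers_closed[of K, OF _ uC(1) k] powers_closed[of K, OF _ uC(2) k], erule (3) K1)+
        have "(\<Sum>i\<in>Q. \<gamma> i * (\<theta> i (u [^] k) - \<theta> i (v [^] k))) = f (u [^] k) - f (v [^] k)"
          by (simp add: fF sum_fun_apply cscale_def F\<theta>[OF pC(1)] F\<theta>[OF pC(2)] sum_subtractf right_diff_distrib)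
        then show "(\<Sum>i\<in>Q. \<gamma> i * (\<theta> i (u [^] k) - \<theta> i (v [^] k))) = 0" using const[OF uv pC] by simp
      qed
      then show ?thesis using F\<theta> uC by simp
    qed
    then have "F i \<in> {h \<in> zfun.span b_B. \<forall>(u, v)\<in>R. h u = h v}" if "i \<in> Q" for i using F that by blast
    then show ?thesis unfolding fF by (intro cfun.span_sum cfun.span_scale) (blast intro: cfun.span_base)
  qed
qed

end

section \<open>Isometries between unions of blocks\<close>

lemma linear_on_add: "linear_on V T \<Longrightarrow> u \<in> V \<Longrightarrow> v \<in> V \<Longrightarrow> T (u + v) = T u + T v"
  and linear_on_scale: "linear_on V T \<Longrightarrow> v \<in> V \<Longrightarrow> T (cscale c v) = cscale c (T v)"
  by (auto simp: linear_on_def)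

lemma linear_on_zero:
  assumes "linear_on V T" "cfun.subspace V" shows "T 0 = 0"
proof -
  have "T (cscale 0 0) = cscale 0 (T 0)" using assms cfun.subspace_0 by (intro linear_on_scale)
  then show ?thesis by simp
qed

lemma linear_on_sum:
  assumes "linear_on V T" "cfun.subspace V" "\<And>i. i \<in> A \<Longrightarrow> f i \<in> V"
  shows "T (\<Sum>i\<in>A. f i) = (\<Sum>i\<in>A. T (f i))"
  using assms(3)
proof (induction A rule: infinite_finite_induct)
  case (insert x F)
  have "T (f x + (\<Sum>i\<in>F. f i)) = T (f x) + T (\<Sum>i\<in>F. f i)"
    using insert.prems by (intro linear_on_add[OF assms(1)] cfun.subspace_sum[OF assms(2)]) auto
  then show ?case using insert.IH insert.prems by (simp only: sum.insert[OF insert.hyps] insertI2)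
qed (simp_all only: not_False_eq_True sum.infinite sum.empty linear_on_zero[OF assms(1,2)])

lemma linear_on_combination:
  assumes "linear_on V T" "cfun.subspace V" "\<And>i. i \<in> A \<Longrightarrow> f i \<in> V"
  shows "T (\<Sum>i\<in>A. cscale (c i) (f i)) = (\<Sum>i\<in>A. cscale (c i) (T (f i)))"
proof -
  have "T (\<Sum>i\<in>A. cscale (c i) (f i)) = (\<Sum>i\<in>A. T (cscale (c i) (f i)))"
    using assms by (intro linear_on_sum) (auto intro: cfun.subspace_scale)
  also have "\<dots> = (\<Sum>i\<in>A. cscale (c i) (T (f i)))"
    using assms(3) by (intro sum.cong refl linear_on_scale[OF assms(1)])
  finally show ?thesis .
qed

locale block_isometry = src: block_part H \<C> b B + tgt: block_part H' \<C>' b' B'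
  for H :: "('a, 'm) monoid_scheme" and \<C> b B and H' :: "('b, 'n) monoid_scheme" and \<C>' b' B' +
  fixes I :: "('a \<Rightarrow> complex) \<Rightarrow> 'b \<Rightarrow> complex"
  assumes iso: "isometry H H' (cfun.span B) (cfun.span B') I"
    and image: "I ` cfun.span (basis_part \<C> b B) = cfun.span (basis_part \<C>' b' B')"
begin

lemma linear: "linear_on (cfun.span B) I"
  and I_herm: "u \<in> cfun.span B \<Longrightarrow> v \<in> cfun.span B \<Longrightarrow> herm H' (I u) (I v) = herm H u v"
  and I_in: "u \<in> cfun.span B \<Longrightarrow> I u \<in> cfun.span B'"
  using iso by (auto simp: isometry_def bij_betw_def)

lemma image_nondegenerate:
  assumes "u \<in> cfun.span (basis_part \<C>' b' B')"
    and "\<And>v. v \<in> cfun.span (basis_part \<C> b B) \<Longrightarrow> herm H' u (I v) = 0"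
  shows "u = 0"
proof (rule tgt.span_nondegenerate[OF tgt.part_supp assms(1)])
  fix \<theta> assume "\<theta> \<in> basis_part \<C>' b' B'"
  then have "\<theta> \<in> I ` cfun.span (basis_part \<C> b B)" unfolding image by (rule cfun.span_base)
  then show "herm H' u \<theta> = 0" using assms(2) by blast
qed

text \<open>
  Both sides lie in \<open>\<complex>b'\<^bsub>B'\<^esub>\<close>, so it suffices to compare their products with the elements \<open>I v\<close>, for \<open>v\<close>
  in \<open>\<complex>b\<^sub>B\<close>.  These elements vanish off \<open>C'\<close>, so restriction to \<open>C'\<close> does not affect the product, and the
  isometry carries the comparison to the first group, where \<open>v\<close> vanishes off \<open>C\<close>.
\<close>

lemma res_commute:
  assumes \<alpha>: "\<alpha> \<in> cfun.span B"
  shows "res (\<Union>\<C>') (I \<alpha>) = I (res (\<Union>\<C>) \<alpha>)"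
proof -
  have r: "res (\<Union>\<C>) \<alpha> \<in> cfun.span (basis_part \<C> b B)" by (rule src.res_in_part[OF \<alpha>])
  have rB: "res (\<Union>\<C>) \<alpha> \<in> cfun.span B" using r src.span_part_in_block by blast
  have Ir: "I (res (\<Union>\<C>) \<alpha>) \<in> cfun.span (basis_part \<C>' b' B')" using r image by blast
  have "res (\<Union>\<C>') (I \<alpha>) - I (res (\<Union>\<C>) \<alpha>) = 0"
  proof (rule image_nondegenerate)
    show "res (\<Union>\<C>') (I \<alpha>) - I (res (\<Union>\<C>) \<alpha>) \<in> cfun.span (basis_part \<C>' b' B')"
      using tgt.res_in_part[OF I_in[OF \<alpha>]] Ir by (rule cfun.span_diff)
    fix v assume v: "v \<in> cfun.span (basis_part \<C> b B)"
    have vB: "v \<in> cfun.span B" using v src.span_part_in_block by blast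
    have "I v \<in> cfun.span b'" using v image tgt.span_part_subset by blast
    then have "herm H' (res (\<Union>\<C>') (I \<alpha>)) (I v) = herm H' (I \<alpha>) (I v)"
      by (rule herm_res_left[OF tgt.span_res_fixed])
    also have "\<dots> = herm H \<alpha> v" by (rule I_herm[OF \<alpha> vB])
    also have "\<dots> = herm H (res (\<Union>\<C>) \<alpha>) v"
      using v src.span_part_subset by (intro herm_res_left[symmetric] src.span_res_fixed) blast
    also have "\<dots> = herm H' (I (res (\<Union>\<C>) \<alpha>)) (I v)" by (rule I_herm[OF rB vB, symmetric])
    finally show "herm H' (res (\<Union>\<C>') (I \<alpha>) - I (res (\<Union>\<C>) \<alpha>)) (I v) = 0"
      by (simp add: herm_diff_left)
  qed
  then show ?thesis by simp
qed

lemma adjoint_image: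
  assumes \<psi>: "\<psi> \<in> cfun.span (basis_part \<C> b B)"
  shows "adjoint H H' (cfun.span (basis_part \<C> b B))
    (cfun.span (dual_basis H (basis_part \<C> b B))) I (I \<psi>) = \<psi>"
  unfolding src.span_dual_part
proof (rule adjointI[OF \<psi>])
  show "herm H \<psi> \<chi> = herm H' (I \<psi>) (I \<chi>)" if "\<chi> \<in> cfun.span (basis_part \<C> b B)" for \<chi>
    using \<psi> that src.span_part_in_block by (intro I_herm[symmetric]) blast+
  show "cfun.subspace (cfun.span (basis_part \<C> b B))" by (rule cfun.subspace_span)
  show "u = 0" if "u \<in> cfun.span (basis_part \<C> b B)"
    "\<And>v. v \<in> cfun.span (basis_part \<C> b B) \<Longrightarrow> herm H u v = 0" for u
    using src.span_nondegenerate[OF src.part_supp that(1)] that(2) by (blast intro: cfun.span_base)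
qed

text \<open>
  The adjoint of an isometry is its inverse, so the inverse of the adjoint is the isometry itself.
\<close>

lemma adjoint_inverse:
  assumes \<psi>: "\<psi> \<in> cfun.span (basis_part \<C> b B)"
  shows "inv_into (cfun.span (basis_part \<C>' b' B'))
    (adjoint H H' (cfun.span (basis_part \<C> b B)) (cfun.span (dual_basis H (basis_part \<C> b B))) I) \<psi> = I \<psi>"
proof (rule inv_into_f_eq)
  show "inj_on (adjoint H H' (cfun.span (basis_part \<C> b B))
      (cfun.span (dual_basis H (basis_part \<C> b B))) I) (cfun.span (basis_part \<C>' b' B'))"
    unfolding image[symmetric] by (rule inj_onI) (auto simp: adjoint_image)
  show "I \<psi> \<in> cfun.span (basis_part \<C>' b' B')" using \<psi> image by blast
qed (rule adjoint_image[OF \<psi>])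

end

section \<open>MN-structures\<close>

text \<open>
  One of the two groups of the theorem, with its MN-structure and the choices of representatives.
\<close>

locale mn_system =
  fixes G :: "('a, 'm) monoid_scheme" and \<C> :: "'a set set" and b B :: "('a \<Rightarrow> complex) set"
    and M :: "'a mn_data" and rp :: "'a set \<Rightarrow> 'a" and E :: "'a set \<Rightarrow> 'a \<Rightarrow> 'a \<Rightarrow> 'a set"
    and \<Lambda>0 :: "'a set set"
  assumes grp: "group G" and finite_carrier: "finite (carrier G)"
    and classes: "\<C> \<subseteq> conj_classes G"
    and union: "block_union G \<C> b B"
    and mn: "mn_structure G \<C> b B M"
    and rep: "\<And>lam. lam \<in> mn_Lambda G M \<Longrightarrow> rp lam \<in> lam"
    and reps: "mn_reps G M rp E"
    and subset: "\<Lambda>0 \<subseteq> mn_Lambda G M"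
    and indep: "\<And>lam. lam \<in> \<Lambda>0 \<Longrightarrow> cfun.independent (mn_basis M (rp lam))"
    and zero: "\<And>lam \<chi>. \<lbrakk>lam \<in> mn_Lambda G M; lam \<notin> \<Lambda>0; \<chi> \<in> cfun.span B\<rbrakk> \<Longrightarrow> mn_r M (rp lam) \<chi> = 0"
begin

sublocale fin_grp G using grp finite_carrier by (simp add: fin_grp_def fin_grp_axioms_def)

lemma S_carrier: "mn_S M \<subseteq> carrier G"
  and A_sub: "mn_A M \<subseteq> mn_S M \<times> \<Union>\<C>"
  and A_bij: "bij_betw (\<lambda>(s, c). s \<otimes>\<^bsub>G\<^esub> c) (mn_A M) (carrier G)"
  and at_one: "mn_sub M \<one>\<^bsub>G\<^esub> = carrier G" "mn_block M \<one>\<^bsub>G\<^esub> = B"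
proof -
  show "mn_S M \<subseteq> carrier G" "mn_A M \<subseteq> mn_S M \<times> \<Union>\<C>"
    "bij_betw (\<lambda>(s, c). s \<otimes>\<^bsub>G\<^esub> c) (mn_A M) (carrier G)"
    "mn_sub M \<one>\<^bsub>G\<^esub> = carrier G" "mn_block M \<one>\<^bsub>G\<^esub> = B"
    by (insert mn[unfolded mn_structure_def], (elim conjE, assumption)+)
qed

lemma S_cj: assumes "g \<in> carrier G" "s \<in> mn_S M" shows "cj G g s \<in> mn_S M"
proof -
  have "\<forall>g\<in>carrier G. \<forall>s\<in>mn_S M. cj G g s \<in> mn_S M"
    by (insert mn[unfolded mn_structure_def], elim conjE, assumption)
  then show ?thesis using assms by blast
qed

lemma A_cj: "(s, c) \<in> mn_A M \<Longrightarrow> g \<in> carrier G \<Longrightarrow> (cj G g s, cj G g c) \<in> mn_A M"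
  and A_cj_mult: "(s, c) \<in> mn_A M \<Longrightarrow> g \<in> carrier G \<Longrightarrow>
    cj G g (s \<otimes>\<^bsub>G\<^esub> c) = cj G g s \<otimes>\<^bsub>G\<^esub> cj G g c"
proof -
  have "\<forall>(s, c)\<in>mn_A M. \<forall>g\<in>carrier G. (cj G g s, cj G g c) \<in> mn_A M \<and>
      cj G g (s \<otimes>\<^bsub>G\<^esub> c) = cj G g s \<otimes>\<^bsub>G\<^esub> cj G g c"
    by (insert mn[unfolded mn_structure_def], elim conjE, assumption)
  then show "(s, c) \<in> mn_A M \<Longrightarrow> g \<in> carrier G \<Longrightarrow> (cj G g s, cj G g c) \<in> mn_A M"
    and "(s, c) \<in> mn_A M \<Longrightarrow> g \<in> carrier G \<Longrightarrow>
      cj G g (s \<otimes>\<^bsub>G\<^esub> c) = cj G g s \<otimes>\<^bsub>G\<^esub> cj G g c" by fast+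
qed

lemma sub_grp: "s \<in> mn_S M \<Longrightarrow> subgroup (mn_sub M s) G"
  and sub_C: "s \<in> mn_S M \<Longrightarrow> mn_sub M s \<inter> \<Union>\<C> = {c \<in> \<Union>\<C>. (s, c) \<in> mn_A M}"
proof -
  have "\<forall>s\<in>mn_S M. subgroup (mn_sub M s) G \<and> (\<forall>h\<in>mn_sub M s. h \<otimes>\<^bsub>G\<^esub> s = s \<otimes>\<^bsub>G\<^esub> h) \<and>
      mn_sub M s \<inter> \<Union>\<C> = {c \<in> \<Union>\<C>. (s, c) \<in> mn_A M}"
    by (insert mn[unfolded mn_structure_def], elim conjE, assumption)
  then show "s \<in> mn_S M \<Longrightarrow> subgroup (mn_sub M s) G"
    and "s \<in> mn_S M \<Longrightarrow> mn_sub M s \<inter> \<Union>\<C> = {c \<in> \<Union>\<C>. (s, c) \<in> mn_A M}" by simp_all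
qed

lemma
  assumes "s \<in> mn_S M"
  shows mn_basis: "z_basis (mn_basis M s)
      (res (\<Union>(mn_classes G \<C> M s)) ` zfun.span (Irr (mn_grp G M s)))"
    and mn_union: "block_union (mn_grp G M s) (mn_classes G \<C> M s) (mn_basis M s) (mn_block M s)"
    and r_linear: "linear_on (cfun.span B) (mn_r M s)"
    and r_image: "mn_r M s ` cfun.span B \<subseteq> cfun.span (mn_block M s)"
    and r_value: "\<chi> \<in> cfun.span B \<Longrightarrow> (s, c) \<in> mn_A M \<Longrightarrow> mn_r M s \<chi> c = \<chi> (s \<otimes>\<^bsub>G\<^esub> c)"
proof -
  have "\<forall>s\<in>mn_S M.
       z_basis (mn_basis M s)
         (res (\<Union>(mn_classes G \<C> M s)) ` zfun.span (Irr (mn_grp G M s))) \<and>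
       block_union (mn_grp G M s) (mn_classes G \<C> M s) (mn_basis M s) (mn_block M s) \<and>
       linear_on (cfun.span B) (mn_r M s) \<and>
       mn_r M s ` cfun.span B \<subseteq> cfun.span (mn_block M s) \<and>
       (\<forall>\<chi>\<in>cfun.span B. \<forall>c. (s, c) \<in> mn_A M \<longrightarrow> mn_r M s \<chi> c = \<chi> (s \<otimes>\<^bsub>G\<^esub> c))"
    by (insert mn[unfolded mn_structure_def], elim conjE, assumption)
  note * = bspec[OF this assms]
  show "z_basis (mn_basis M s) (res (\<Union>(mn_classes G \<C> M s)) ` zfun.span (Irr (mn_grp G M s)))"
    "block_union (mn_grp G M s) (mn_classes G \<C> M s) (mn_basis M s) (mn_block M s)"
    "linear_on (cfun.span B) (mn_r M s)"
    "mn_r M s ` cfun.span B \<subseteq> cfun.span (mn_block M s)"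
    by (insert *, (elim conjE, assumption)+)
  show "\<chi> \<in> cfun.span B \<Longrightarrow> (s, c) \<in> mn_A M \<Longrightarrow> mn_r M s \<chi> c = \<chi> (s \<otimes>\<^bsub>G\<^esub> c)"
    using * by blast
qed

lemma C_carrier: "\<Union>\<C> \<subseteq> carrier G"
  using classes by (auto simp: conj_classes_def conj_class_def cj_def)

lemma C_cj: "g \<in> carrier G \<Longrightarrow> x \<in> \<Union>\<C> \<Longrightarrow> cj G g x \<in> \<Union>\<C>"
proof -
  assume g: "g \<in> carrier G" and "x \<in> \<Union>\<C>"
  then obtain c y where c: "c \<in> \<C>" "c = conj_class G y" "y \<in> carrier G" "x \<in> c"
    using classes by (auto simp: conj_classes_def)
  then have "cj G g x \<in> c" using cj_conj_class g by simp
  then show ?thesis using c(1) by blast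
qed

lemma Lambda_class:
  assumes "s \<in> mn_S M"
  shows "conj_class G s \<in> mn_Lambda G M"
    and "lam \<in> mn_Lambda G M \<Longrightarrow> s \<in> lam \<longleftrightarrow> lam = conj_class G s"
proof -
  have sc: "s \<in> carrier G" using assms S_carrier by blast
  show "conj_class G s \<in> mn_Lambda G M"
    using sc S_cj[OF _ assms] by (auto simp: mn_Lambda_def conj_classes_def conj_class_def)
  assume "lam \<in> mn_Lambda G M"
  then obtain y where "y \<in> carrier G" "lam = conj_class G y" by (auto simp: mn_Lambda_def conj_classes_def)
  then show "s \<in> lam \<longleftrightarrow> lam = conj_class G s"
    using conj_class_eqI self_in_conj_class[OF sc] by blast
qed

lemma rep_S: "lam \<in> mn_Lambda G M \<Longrightarrow> rp lam \<in> mn_S M"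
  using rep by (auto simp: mn_Lambda_def)

lemma finite_\<Lambda>0: "finite \<Lambda>0"
proof (rule finite_subset[OF subset])
  show "finite (mn_Lambda G M)" using finite_carrier by (simp add: mn_Lambda_def conj_classes_def)
qed

lemma grp_sub:
  assumes "s \<in> mn_S M"
  shows "fin_grp (mn_grp G M s)" and "mn_sub M s \<subseteq> carrier G"
    and "carrier (mn_grp G M s) = mn_sub M s"
    and "g \<in> mn_sub M s \<Longrightarrow> cj (mn_grp G M s) g x = cj G g x"
    and "x [^]\<^bsub>mn_grp G M s\<^esub> (k::nat) = x [^]\<^bsub>G\<^esub> k"
proof -
  note sg = sub_grp[OF assms]
  show sub: "mn_sub M s \<subseteq> carrier G" using subgroup.subset[OF sg] .
  have "group (mn_grp G M s)" unfolding mn_grp_def by (rule subgroup_imp_group[OF sg])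
  then show "fin_grp (mn_grp G M s)"
    using finite_subset[OF sub finite_carrier] by (simp add: fin_grp_def fin_grp_axioms_def mn_grp_def)
  show "carrier (mn_grp G M s) = mn_sub M s" by (simp add: mn_grp_def)
  show "cj (mn_grp G M s) g x = cj G g x" if "g \<in> mn_sub M s"
    using m_inv_consistent[OF sg that] by (simp add: cj_def mn_grp_def)
  show "x [^]\<^bsub>mn_grp G M s\<^esub> (k::nat) = x [^]\<^bsub>G\<^esub> k"
    by (induction k) (simp_all add: mn_grp_def nat_pow_def)
qed

lemma union_mn_classes:
  assumes "s \<in> mn_S M"
  shows "\<Union>(mn_classes G \<C> M s) = \<Union>\<C> \<inter> mn_sub M s"
proof -
  interpret H: fin_grp "mn_grp G M s" by (rule grp_sub(1)[OF assms])
  show ?thesis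
  proof (intro equalityI subsetI)
    fix x assume "x \<in> \<Union>(mn_classes G \<C> M s)"
    then obtain y g where y: "y \<in> mn_sub M s" "y \<in> \<Union>\<C>" "g \<in> mn_sub M s" "x = cj (mn_grp G M s) g y"
      by (auto simp: mn_classes_def conj_class_def grp_sub(3)[OF assms])
    have "x = cj G g y" using y(3,4) grp_sub(4)[OF assms] by simp
    then have "x \<in> \<Union>\<C>" using C_cj y grp_sub(2)[OF assms] by blast
    moreover have "x \<in> mn_sub M s"
      using y grp_sub(3)[OF assms] H.m_closed H.inv_closed by (auto simp: cj_def)
    ultimately show "x \<in> \<Union>\<C> \<inter> mn_sub M s" by blast
  next
    fix x assume x: "x \<in> \<Union>\<C> \<inter> mn_sub M s"
    then have "x \<in> carrier (mn_grp G M s)" by (simp add: grp_sub(3)[OF assms])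
    then have "x \<in> conj_class (mn_grp G M s) x"
      by (auto simp: conj_class_def cj_def intro!: image_eqI[of _ _ "\<one>\<^bsub>mn_grp G M s\<^esub>"])
    then show "x \<in> \<Union>(mn_classes G \<C> M s)" using x by (auto simp: mn_classes_def)
  qed
qed

lemma local_block:
  assumes lam: "lam \<in> \<Lambda>0"
  shows "block_part (mn_grp G M (rp lam)) (mn_classes G \<C> M (rp lam))
    (mn_basis M (rp lam)) (mn_block M (rp lam))"
proof -
  have S: "rp lam \<in> mn_S M" by (rule rep_S[OF subsetD[OF subset lam]])
  interpret H: fin_grp "mn_grp G M (rp lam)" by (rule grp_sub(1)[OF S])
  show ?thesis
  proof (intro block_part.intro block_part_axioms.intro)
    show "fin_grp (mn_grp G M (rp lam))" by (rule grp_sub(1)[OF S])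
    show "\<Union>(mn_classes G \<C> M (rp lam)) \<subseteq> carrier (mn_grp G M (rp lam))"
      using union_mn_classes[OF S] grp_sub(3)[OF S] by blast
    show "cj (mn_grp G M (rp lam)) g x \<in> \<Union>(mn_classes G \<C> M (rp lam))"
      if gx: "g \<in> carrier (mn_grp G M (rp lam))" "x \<in> \<Union>(mn_classes G \<C> M (rp lam))" for g x
    proof -
      have x: "x \<in> \<Union>\<C>" "x \<in> carrier (mn_grp G M (rp lam))" and g: "g \<in> mn_sub M (rp lam)"
        using gx union_mn_classes[OF S] grp_sub(3)[OF S] by auto
      have "cj (mn_grp G M (rp lam)) g x \<in> \<Union>\<C>"
        using C_cj x g grp_sub(2,4)[OF S] by (metis subsetD)
      moreover have "cj (mn_grp G M (rp lam)) g x \<in> carrier (mn_grp G M (rp lam))"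
        using x(2) gx(1) by (simp add: cj_def)
      ultimately show ?thesis unfolding union_mn_classes[OF S] grp_sub(3)[OF S] by blast
    qed
  qed (use mn_basis[OF S] mn_union[OF S] indep[OF lam] in auto)
qed

lemmas B_Irr = block_union_Irr[OF union]

lemma finite_B: "finite B" using finite_subset[OF B_Irr finite_Irr] .

lemma span_B_class_fun: "f \<in> cfun.span B \<Longrightarrow> f \<in> class_funs G"
  using cfun.span_minimal[OF subset_trans[OF B_Irr Irr_class_fun] subspace_class_fun] by blast

lemma mn_d_eq:
  assumes "s \<in> mn_S M"
  shows "mn_d \<C> M s \<chi> = res (\<Union>(mn_classes G \<C> M s)) (mn_r M s \<chi>)"
  by (simp add: mn_d_def union_mn_classes[OF assms])

lemma mn_d_value:
  assumes s: "s \<in> mn_S M" and \<chi>: "\<chi> \<in> cfun.span B" and c: "(s, c) \<in> mn_A M"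
  shows "mn_d \<C> M s \<chi> c = \<chi> (s \<otimes>\<^bsub>G\<^esub> c)"
proof -
  have "c \<in> \<Union>\<C>" using c A_sub by auto
  then have "c \<in> mn_sub M s" using c sub_C[OF s] by blast
  then show ?thesis using \<open>c \<in> \<Union>\<C>\<close> r_value[OF s \<chi> c] by (simp add: mn_d_def res_def)
qed

lemma mn_d_linear: "s \<in> mn_S M \<Longrightarrow> linear_on (cfun.span B) (mn_d \<C> M s)"
  using r_linear[of s] by (simp add: linear_on_def mn_d_def res_add res_cscale)

text \<open>
  Moving \<open>s\<close> to \<open>x\<close> by conjugation turns \<open>s \<cdot> c\<close> into \<open>x \<cdot> y\<close>, and \<open>\<chi>\<close> is a class function.
\<close>

lemma transporter_value:
  assumes \<chi>: "\<chi> \<in> cfun.span B" and sc: "(s, c) \<in> mn_A M" and x: "x \<in> mn_S M"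
    and y: "y \<in> transporter_set G x s c"
  shows "mn_d \<C> M x \<chi> y = \<chi> (s \<otimes>\<^bsub>G\<^esub> c)" and "(x, y) \<in> mn_A M"
proof -
  obtain t where t: "t \<in> carrier G" "cj G t s = x" "y = cj G t c" using y by (auto simp: transporter_set_def)
  show xy: "(x, y) \<in> mn_A M" using A_cj[OF sc t(1)] t by simp
  have "x \<otimes>\<^bsub>G\<^esub> y = cj G t (s \<otimes>\<^bsub>G\<^esub> c)" using A_cj_mult[OF sc t(1)] t by simp
  moreover have "s \<otimes>\<^bsub>G\<^esub> c \<in> carrier G" using sc A_sub S_carrier C_carrier by blast
  ultimately show "mn_d \<C> M x \<chi> y = \<chi> (s \<otimes>\<^bsub>G\<^esub> c)"
    using mn_d_value[OF x \<chi> xy] span_B_class_fun[OF \<chi>] t(1) by (simp add: class_funs_def)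
qed

lemma reps_props:
  assumes lam: "lam \<in> mn_Lambda G M" and sc: "(s, c) \<in> mn_A M" "s \<in> lam"
  shows "E lam s c \<subseteq> transporter_set G (rp lam) s c" and "E lam s c \<noteq> {}" and "finite (E lam s c)"
proof -
  have cr: "class_reps (mn_grp G M (rp lam)) (transporter_set G (rp lam) s c) (E lam s c)"
    using reps lam sc unfolding mn_reps_def by fast
  then show sub: "E lam s c \<subseteq> transporter_set G (rp lam) s c" by (simp add: class_reps_def)
  have "transporter_set G (rp lam) s c = (\<lambda>t. cj G t c) ` {t \<in> carrier G. cj G t s = rp lam}"
    by (auto simp: transporter_set_def)
  then show "finite (E lam s c)" using finite_subset[OF sub] finite_carrier by simp
  have "s \<in> mn_S M" using sc A_sub by blast
  then have "lam = conj_class G s" using Lambda_class(2) lam sc(2) by blast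
  then have "rp lam \<in> conj_class G s" using rep[OF lam] by simp
  then obtain t where "t \<in> carrier G" "cj G t s = rp lam" by (auto simp: conj_class_def)
  then have "cj G t c \<in> transporter_set G (rp lam) s c" by (auto simp: transporter_set_def)
  then show "E lam s c \<noteq> {}" using cr unfolding class_reps_def by blast
qed

text \<open>
  The summand for the class of the component of \<open>x\<close> in \<open>S\<close> is an average of numbers all equal to \<open>f x\<close>;
  the other summands are zero.  If that class is not in \<open>\<Lambda>\<^sub>0\<close>, the same computation shows \<open>f x = 0\<close>.
\<close>

lemma value_decomposition:
  assumes f: "f \<in> cfun.span B" and x: "x \<in> carrier G"
  shows "f x = (\<Sum>lam\<in>\<Lambda>0. mn_l G M E lam (mn_d \<C> M (rp lam) f) x)"
proof -
  obtain s c where parts: "mn_parts G M x = (s, c)" by fastforce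
  have "(s, c) = the_inv_into (mn_A M) (\<lambda>(s, c). s \<otimes>\<^bsub>G\<^esub> c) x" using parts by (simp add: mn_parts_def)
  then have sc: "(s, c) \<in> mn_A M" and x_eq: "s \<otimes>\<^bsub>G\<^esub> c = x"
    using A_bij x the_inv_into_into[of "\<lambda>(s, c). s \<otimes>\<^bsub>G\<^esub> c" "mn_A M" x "mn_A M"]
      f_the_inv_into_f[of "\<lambda>(s, c). s \<otimes>\<^bsub>G\<^esub> c" "mn_A M" x]
    by (auto simp: bij_betw_def split: prod.splits)
  have s: "s \<in> mn_S M" using sc A_sub by blast
  define lam1 where "lam1 = conj_class G s"
  have lam1: "lam1 \<in> mn_Lambda G M" "s \<in> lam1"
    unfolding lam1_def using Lambda_class[OF s] self_in_conj_class s S_carrier by blast+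
  have val: "mn_d \<C> M (rp lam1) f y = f x" if "y \<in> E lam1 s c" for y
    using transporter_value(1)[OF f sc rep_S[OF lam1(1)]] reps_props(1)[OF lam1(1) sc lam1(2)] that x_eq by blast
  have l1: "mn_l G M E lam1 (mn_d \<C> M (rp lam1) f) x = f x"
    using x parts lam1(2) val reps_props(2,3)[OF lam1(1) sc lam1(2)] by (simp add: mn_l_def)
  have l0: "mn_l G M E lam (mn_d \<C> M (rp lam) f) x = 0" if "lam \<in> \<Lambda>0" "lam \<noteq> lam1" for lam
  proof -
    have "s \<notin> lam" using that Lambda_class(2)[OF s] subset by (auto simp: lam1_def)
    then show ?thesis using parts by (simp add: mn_l_def)
  qed
  have "(\<Sum>lam\<in>\<Lambda>0. mn_l G M E lam (mn_d \<C> M (rp lam) f) x) = (\<Sum>lam\<in>\<Lambda>0. if lam = lam1 then f x else 0)"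
    using l0 l1 by (intro sum.cong refl) auto
  also have "\<dots> = (if lam1 \<in> \<Lambda>0 then f x else 0)" using finite_\<Lambda>0 by simp
  also have "\<dots> = f x"
  proof (cases "lam1 \<in> \<Lambda>0")
    case False
    obtain y where "y \<in> E lam1 s c" using reps_props(2)[OF lam1(1) sc lam1(2)] by blast
    then have "f x = mn_d \<C> M (rp lam1) f y" using val by simp
    also have "\<dots> = 0" using zero[OF lam1(1) False f] by (simp add: mn_d_def res_def)
    finally show ?thesis using False by simp
  qed simp
  finally show ?thesis by simp
qed

lemma mn_d_in_span:
  assumes lam: "lam \<in> \<Lambda>0" and \<chi>: "\<chi> \<in> cfun.span B"
  shows "mn_d \<C> M (rp lam) \<chi> \<in> cfun.span (mn_b G \<C> M (rp lam))"
proof -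
  have S: "rp lam \<in> mn_S M" by (rule rep_S[OF subsetD[OF subset lam]])
  interpret H: block_part "mn_grp G M (rp lam)" "mn_classes G \<C> M (rp lam)"
    "mn_basis M (rp lam)" "mn_block M (rp lam)" by (rule local_block[OF lam])
  show ?thesis unfolding mn_d_eq[OF S] mn_b_def using r_image[OF S] \<chi> by (intro H.res_in_part) blast
qed

text \<open>
  The elements of \<open>\<E>\<close> for a given \<open>y\<close> are conjugates of \<open>y\<close> under elements that commute with the
  representative \<open>x\<^sub>\<lambda>\<close>, and taking powers preserves this.  So \<open>d\<^sub>\<lambda> \<chi>\<close> has at the \<open>k\<close>-th powers of all these
  elements the common value \<open>\<chi>(x\<^sub>\<lambda> y\<^sup>k)\<close>, and the descent applies.
\<close>

lemma mn_d_in_const_span: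
  assumes lam: "lam \<in> \<Lambda>0" and \<chi>: "\<chi> \<in> cfun.span B"
  shows "mn_d \<C> M (rp lam) \<chi> \<in> cfun.span (mn_Zb_const G \<C> M rp E lam)"
proof -
  let ?x = "rp lam"
  have lamL: "lam \<in> mn_Lambda G M" using lam subset by blast
  have S: "?x \<in> mn_S M" using rep_S[OF lamL] .
  interpret H: block_part "mn_grp G M ?x" "mn_classes G \<C> M ?x" "mn_basis M ?x" "mn_block M ?x"
    by (rule local_block[OF lam])
  define R where "R = {(u, v). \<exists>y\<in>\<Union>\<C> \<inter> mn_sub M ?x. u \<in> E lam ?x y \<and> v \<in> E lam ?x y}"
  have pairs: "(?x, y) \<in> mn_A M" if "y \<in> \<Union>\<C> \<inter> mn_sub M ?x" for y
    using sub_C[OF S] that by blast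
  have in_T: "u \<in> transporter_set G ?x ?x y" if "y \<in> \<Union>\<C> \<inter> mn_sub M ?x" "u \<in> E lam ?x y" for u y
    using reps_props(1)[OF lamL pairs[OF that(1)] rep[OF lamL]] that(2) by blast
  have in_C: "u \<in> \<Union>(mn_classes G \<C> M ?x)" if "y \<in> \<Union>\<C> \<inter> mn_sub M ?x" "u \<in> E lam ?x y" for u y
  proof -
    have "(?x, u) \<in> mn_A M" by (rule transporter_value(2)[OF \<chi> pairs[OF that(1)] S in_T[OF that]])
    then show ?thesis using A_sub sub_C[OF S] unfolding union_mn_classes[OF S] by blast
  qed
  have power: "mn_d \<C> M ?x \<chi> (u [^]\<^bsub>G\<^esub> k) = \<chi> (?x \<otimes>\<^bsub>G\<^esub> y [^]\<^bsub>G\<^esub> k)"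
    if y: "y \<in> \<Union>\<C> \<inter> mn_sub M ?x" and u: "u \<in> E lam ?x y"
      and uk: "u [^]\<^bsub>G\<^esub> k \<in> \<Union>(mn_classes G \<C> M ?x)" for u y and k :: nat
  proof -
    obtain t where t: "t \<in> carrier G" "cj G t ?x = ?x" "u = cj G t y"
      using in_T[OF y u] by (auto simp: transporter_set_def)
    have c: "?x \<in> carrier G" "y \<in> carrier G" "y [^]\<^bsub>G\<^esub> k \<in> carrier G"
      using y S S_carrier grp_sub(2)[OF S] by auto
    have "(?x, u [^]\<^bsub>G\<^esub> k) \<in> mn_A M"
      using uk sub_C[OF S] unfolding union_mn_classes[OF S] by blast
    then have "mn_d \<C> M ?x \<chi> (u [^]\<^bsub>G\<^esub> k) = \<chi> (?x \<otimes>\<^bsub>G\<^esub> u [^]\<^bsub>G\<^esub> k)" by (rule mn_d_value[OF S \<chi>])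
    also have "?x \<otimes>\<^bsub>G\<^esub> u [^]\<^bsub>G\<^esub> k = cj G t ?x \<otimes>\<^bsub>G\<^esub> cj G t (y [^]\<^bsub>G\<^esub> k)"
      using t c by (simp add: cj_pow)
    also have "\<dots> = cj G t (?x \<otimes>\<^bsub>G\<^esub> y [^]\<^bsub>G\<^esub> k)" using t(1) c by (simp add: cj_mult)
    also have "\<chi> \<dots> = \<chi> (?x \<otimes>\<^bsub>G\<^esub> y [^]\<^bsub>G\<^esub> k)"
      using span_B_class_fun[OF \<chi>] t(1) c by (simp add: class_funs_def)
    finally show ?thesis .
  qed
  have "mn_d \<C> M ?x \<chi> \<in> cfun.span {h \<in> zfun.span (mn_b G \<C> M ?x). \<forall>(u, v)\<in>R. h u = h v}"
    unfolding mn_b_def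
  proof (rule H.rational_descent)
    show "mn_d \<C> M ?x \<chi> \<in> cfun.span H.b_B" using mn_d_in_span[OF lam \<chi>] by (simp add: mn_b_def)
    show "R \<subseteq> \<Union>(mn_classes G \<C> M ?x) \<times> \<Union>(mn_classes G \<C> M ?x)"
      using in_C unfolding R_def by blast
    show "mn_d \<C> M ?x \<chi> (u [^]\<^bsub>mn_grp G M ?x\<^esub> k) = mn_d \<C> M ?x \<chi> (v [^]\<^bsub>mn_grp G M ?x\<^esub> k)"
      if "(u, v) \<in> R" "u [^]\<^bsub>mn_grp G M ?x\<^esub> k \<in> \<Union>(mn_classes G \<C> M ?x)"
        "v [^]\<^bsub>mn_grp G M ?x\<^esub> k \<in> \<Union>(mn_classes G \<C> M ?x)" for u v and k :: nat
    proof -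
      obtain y where y: "y \<in> \<Union>\<C> \<inter> mn_sub M ?x" "u \<in> E lam ?x y" "v \<in> E lam ?x y"
        using \<open>(u, v) \<in> R\<close> unfolding R_def by blast
      show ?thesis
        using power[OF y(1,2)] power[OF y(1,3)] that(2,3) unfolding grp_sub(5)[OF S] by simp
    qed
  qed
  moreover have "{h \<in> zfun.span (mn_b G \<C> M ?x). \<forall>(u, v)\<in>R. h u = h v} = mn_Zb_const G \<C> M rp E lam"
    unfolding mn_Zb_const_def R_def by blast
  ultimately show ?thesis by simp
qed

text \<open>
  The adjoint is computed in the orthonormal basis \<open>B\<close> of its target.
\<close>

lemma mn_e_eq:
  assumes "s \<in> mn_S M"
  shows "mn_e G \<C> B M s \<Phi> = (\<Sum>\<chi>\<in>B. cscale (herm (mn_grp G M s) \<Phi> (mn_d \<C> M s \<chi>)) \<chi>)"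
  unfolding mn_e_def
proof (rule adjointI)
  let ?H = "mn_grp G M s"
  let ?\<psi> = "\<Sum>\<chi>\<in>B. cscale (herm ?H \<Phi> (mn_d \<C> M s \<chi>)) \<chi>"
  show "?\<psi> \<in> cfun.span B"
    by (intro cfun.span_sum cfun.span_scale cfun.span_base)
  show "cfun.subspace (cfun.span B)" by (rule cfun.subspace_span)
  show "u = 0" if "u \<in> cfun.span B" "\<And>v. v \<in> cfun.span B \<Longrightarrow> herm G u v = 0" for u
    using span_nondegenerate[OF subset_trans[OF B_Irr Irr_supp] that(1)] that(2) by (blast intro: cfun.span_base)
  fix \<chi> assume "\<chi> \<in> cfun.span B"
  then obtain a where a: "\<chi> = (\<Sum>\<theta>\<in>B. cscale (a \<theta>) \<theta>)" using cfun.span_finite[OF finite_B] by auto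
  have base: "herm G ?\<psi> \<theta> = herm ?H \<Phi> (mn_d \<C> M s \<theta>)" if \<theta>: "\<theta> \<in> B" for \<theta>
  proof -
    have "herm G ?\<psi> \<theta> = (\<Sum>\<chi>\<in>B. herm ?H \<Phi> (mn_d \<C> M s \<chi>) * (if \<chi> = \<theta> then 1 else 0))"
      unfolding herm_sum_left herm_scale_left
    proof (rule sum.cong[OF refl])
      fix \<chi> assume "\<chi> \<in> B"
      then have "\<chi> \<in> Irr G" "\<theta> \<in> Irr G" using \<theta> B_Irr by auto
      then show "herm ?H \<Phi> (mn_d \<C> M s \<chi>) * herm G \<chi> \<theta> =
          herm ?H \<Phi> (mn_d \<C> M s \<chi>) * (if \<chi> = \<theta> then 1 else 0)"
        by (simp add: Irr_orthonormal)
    qed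
    then show ?thesis using \<theta> finite_B by (simp add: if_distrib cong: if_cong)
  qed
  have "mn_d \<C> M s \<chi> = (\<Sum>\<theta>\<in>B. cscale (a \<theta>) (mn_d \<C> M s \<theta>))"
    unfolding a by (rule linear_on_combination[OF mn_d_linear[OF assms] cfun.subspace_span])
      (rule cfun.span_base)
  then show "herm G ?\<psi> \<chi> = herm ?H \<Phi> (mn_d \<C> M s \<chi>)"
    unfolding a herm_sum_right herm_scale_right using base by (simp add: herm_sum_right herm_scale_right)
qed

lemma mn_l_combination:
  "mn_l G M E lam (\<Sum>i\<in>A. cscale (c i) (f i)) x = (\<Sum>i\<in>A. c i * mn_l G M E lam (f i) x)"
proof (cases "mn_parts G M x")
  case (Pair s d)
  define N :: complex where "N = of_nat (card (E lam s d))"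
  have l: "mn_l G M E lam \<psi> x = (if x \<in> carrier G \<and> s \<in> lam then (\<Sum>y\<in>E lam s d. \<psi> y) / N else 0)" for \<psi>
    using Pair by (simp add: mn_l_def N_def)
  have "(\<Sum>y\<in>E lam s d. (\<Sum>i\<in>A. cscale (c i) (f i)) y) = (\<Sum>i\<in>A. c i * (\<Sum>y\<in>E lam s d. f i y))"
    by (simp add: sum_fun_apply cscale_def sum_distrib_left) (rule sum.swap)
  moreover have "(\<Sum>i\<in>A. c i * S i) / N = (\<Sum>i\<in>A. c i * (S i / N))" for S
    by (simp add: sum_divide_distrib)
  ultimately show ?thesis unfolding l by auto
qed

text \<open>
  In the expansion of \<open>d\<^sub>\<lambda> \<chi>\<close> in the basis \<open>bb\<close> only the members of \<open>bbC\<close> occur, because \<open>d\<^sub>\<lambda> \<chi>\<close> lies in their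
  complex span.
\<close>

lemma adapted_expand:
  assumes lam: "lam \<in> \<Lambda>0"
    and bb: "z_basis bb (zfun.span (mn_b G \<C> M (rp lam)))" "bbC \<subseteq> bb"
      "z_basis bbC (mn_Zb_const G \<C> M rp E lam)"
    and \<chi>: "\<chi> \<in> cfun.span B"
  shows "mn_d \<C> M (rp lam) \<chi> = (\<Sum>\<phi>\<in>bbC.
    cscale (herm (mn_grp G M (rp lam)) (mn_d \<C> M (rp lam) \<chi>) (dual_elt (mn_grp G M (rp lam)) bb \<phi>)) \<phi>)"
    and "bbC \<subseteq> cfun.span (mn_b G \<C> M (rp lam))"
proof -
  let ?H = "mn_grp G M (rp lam)" and ?b = "mn_b G \<C> M (rp lam)"
  interpret H: block_part ?H "mn_classes G \<C> M (rp lam)" "mn_basis M (rp lam)" "mn_block M (rp lam)"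
    by (rule local_block[OF lam])
  have b: "finite ?b" "cfun.independent ?b" "?b \<subseteq> supp_on ?H"
    using H.part_finite H.part_independent H.part_supp by (simp_all add: mn_b_def)
  have bb_sub: "bb \<subseteq> zfun.span ?b" using bb(1) zfun.span_superset by (fastforce simp: z_basis_def)
  have bb_c: "bb \<subseteq> cfun.span ?b" using bb_sub zspan_subset_cspan by blast
  then show "bbC \<subseteq> cfun.span ?b" using bb(2) by blast
  have i: "cfun.independent bb"
    using lattice_basis_independent[OF b(2) _ bb_sub] bb(1) by (simp add: z_basis_def)
  have sp: "bb \<subseteq> supp_on ?H"
    using bb_c cfun.span_minimal[OF b(3) subspace_supp_on] by blast
  have fi: "finite bb" by (rule H.finite_independent[OF i sp])
  note bb3 = fi i sp
  define d where "d = mn_d \<C> M (rp lam) \<chi>"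
  have dC: "d \<in> cfun.span bbC"
  proof -
    have "mn_Zb_const G \<C> M rp E lam \<subseteq> cfun.span bbC"
      using bb(3) zspan_subset_cspan by (auto simp: z_basis_def)
    then show ?thesis unfolding d_def
      using mn_d_in_const_span[OF lam \<chi>] cfun.span_minimal[OF _ cfun.subspace_span] by blast
  qed
  have zero: "herm ?H d (dual_elt ?H bb \<phi>) = 0" if \<phi>: "\<phi> \<in> bb - bbC" for \<phi>
  proof (rule herm_span_left_zero[OF dC])
    fix \<theta> assume "\<theta> \<in> bbC"
    then show "herm ?H \<theta> (dual_elt ?H bb \<phi>) = 0"
      using H.herm_dual_elt_right[OF bb3, of \<phi> \<theta>] \<phi> bb(2) by auto
  qed
  have "d \<in> cfun.span bb" using dC cfun.span_mono[OF bb(2)] by blast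
  then have "d = (\<Sum>\<phi>\<in>bb. cscale (herm ?H d (dual_elt ?H bb \<phi>)) \<phi>)" by (rule H.span_expand[OF bb3])
  also have "\<dots> = (\<Sum>\<phi>\<in>bbC. cscale (herm ?H d (dual_elt ?H bb \<phi>)) \<phi>)"
    using zero by (intro sum.mono_neutral_right fi bb(2) ballI) simp
  finally show "mn_d \<C> M (rp lam) \<chi> = (\<Sum>\<phi>\<in>bbC.
    cscale (herm ?H (mn_d \<C> M (rp lam) \<chi>) (dual_elt ?H bb \<phi>)) \<phi>)"
    unfolding d_def .
qed

end

section \<open>The kernel of the isometry\<close>

theorem theorem2p10:
  fixes G :: "('a, 'm) monoid_scheme" and G' :: "('b, 'n) monoid_scheme"
    and \<C> :: "'a set set" and \<C>' :: "'b set set"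
    and b B :: "('a \<Rightarrow> complex) set" and b' B' :: "('b \<Rightarrow> complex) set"
    and M :: "'a mn_data" and M' :: "'b mn_data"
    and rp :: "'a set \<Rightarrow> 'a" and rp' :: "'b set \<Rightarrow> 'b"
    and E :: "'a set \<Rightarrow> 'a \<Rightarrow> 'a \<Rightarrow> 'a set" and E' :: "'b set \<Rightarrow> 'b \<Rightarrow> 'b \<Rightarrow> 'b set"
    and \<Lambda>0 :: "'a set set" and \<Lambda>0' :: "'b set set"
    and \<sigma> :: "'a set \<Rightarrow> 'b set"
    and I :: "'a set \<Rightarrow> ('a \<Rightarrow> complex) \<Rightarrow> 'b \<Rightarrow> complex"
    and \<bb> \<bb>C :: "'a set \<Rightarrow> ('a \<Rightarrow> complex) set"
  assumes "group G" and "finite (carrier G)" and "group G'" and "finite (carrier G')"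
    and "\<C> \<subseteq> conj_classes G" and "\<C>' \<subseteq> conj_classes G'"
    and "z_basis b (res (\<Union>\<C>) ` zfun.span (Irr G))"
    and "z_basis b' (res (\<Union>\<C>') ` zfun.span (Irr G'))"
    and "block_union G \<C> b B" and "block_union G' \<C>' b' B'"
    and "mn_structure G \<C> b B M" and "mn_structure G' \<C>' b' B' M'"
    and "\<And>lam. lam \<in> mn_Lambda G M \<Longrightarrow> rp lam \<in> lam"
    and "\<And>lam'. lam' \<in> mn_Lambda G' M' \<Longrightarrow> rp' lam' \<in> lam'"
    and "mn_reps G M rp E" and "mn_reps G' M' rp' E'"
    and "\<Lambda>0 \<subseteq> mn_Lambda G M" and "\<Lambda>0' \<subseteq> mn_Lambda G' M'"
    \<comment> \<open>the bases possess dual bases\<close>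
    and "\<And>lam. lam \<in> \<Lambda>0 \<Longrightarrow> cfun.independent (mn_basis M (rp lam))"
    and "\<And>lam'. lam' \<in> \<Lambda>0' \<Longrightarrow> cfun.independent (mn_basis M' (rp' lam'))"
    \<comment> \<open>(2a)\<close>
    and "\<And>lam \<chi>. \<lbrakk>lam \<in> mn_Lambda G M; lam \<notin> \<Lambda>0; \<chi> \<in> cfun.span B\<rbrakk> \<Longrightarrow> mn_r M (rp lam) \<chi> = 0"
    and "\<And>lam' \<chi>'. \<lbrakk>lam' \<in> mn_Lambda G' M'; lam' \<notin> \<Lambda>0'; \<chi>' \<in> cfun.span B'\<rbrakk>
           \<Longrightarrow> mn_r M' (rp' lam') \<chi>' = 0"
    \<comment> \<open>(2b)\<close>
    and "bij_betw \<sigma> \<Lambda>0 \<Lambda>0'" and "{\<one>\<^bsub>G\<^esub>} \<in> \<Lambda>0" and "\<sigma> {\<one>\<^bsub>G\<^esub>} = {\<one>\<^bsub>G'\<^esub>}"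
    and "\<And>lam. lam \<in> \<Lambda>0 \<Longrightarrow>
           isometry (mn_grp G M (rp lam)) (mn_grp G' M' (rp' (\<sigma> lam)))
             (cfun.span (mn_block M (rp lam))) (cfun.span (mn_block M' (rp' (\<sigma> lam)))) (I lam)"
    and "\<And>lam \<chi>. \<lbrakk>lam \<in> \<Lambda>0; \<chi> \<in> cfun.span B\<rbrakk> \<Longrightarrow>
           I lam (mn_r M (rp lam) \<chi>) = mn_r M' (rp' (\<sigma> lam)) (I {\<one>\<^bsub>G\<^esub>} \<chi>)"
    \<comment> \<open>(3)\<close>
    and "\<And>lam. lam \<in> \<Lambda>0 \<Longrightarrow>
           I lam ` cfun.span (dual_basis (mn_grp G M (rp lam)) (mn_b G \<C> M (rp lam))) =
           cfun.span (dual_basis (mn_grp G' M' (rp' (\<sigma> lam))) (mn_b G' \<C>' M' (rp' (\<sigma> lam))))"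
    \<comment> \<open>choice of the adapted bases\<close>
    and "\<And>lam. lam \<in> \<Lambda>0 \<Longrightarrow> z_basis (\<bb> lam) (zfun.span (mn_b G \<C> M (rp lam)))"
    and "\<And>lam. lam \<in> \<Lambda>0 \<Longrightarrow> \<bb>C lam \<subseteq> \<bb> lam"
    and "\<And>lam. lam \<in> \<Lambda>0 \<Longrightarrow> z_basis (\<bb>C lam) (mn_Zb_const G \<C> M rp E lam)"
    and "x \<in> carrier G" and "x' \<in> carrier G'"
  shows "kernel_hat B (I {\<one>\<^bsub>G\<^esub>}) x x' =
    (\<Sum>lam\<in>\<Lambda>0. \<Sum>\<phi>\<in>\<bb>C lam.
       (let H = mn_grp G M (rp lam);
            H' = mn_grp G' M' (rp' (\<sigma> lam));
            b\<^sub>l = mn_b G \<C> M (rp lam);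
            b\<^sub>l' = mn_b G' \<C>' M' (rp' (\<sigma> lam));
            Jadj = adjoint H H' (cfun.span b\<^sub>l) (cfun.span (dual_basis H b\<^sub>l)) (I lam)
        in cnj (mn_e G \<C> B M (rp lam) (dual_elt H (\<bb> lam) \<phi>) x)
           * mn_l G' M' E' (\<sigma> lam) (inv_into (cfun.span b\<^sub>l') Jadj \<phi>) x'))"
proof -
  let ?one = "{\<one>\<^bsub>G\<^esub>}" and ?one' = "{\<one>\<^bsub>G'\<^esub>}"
  interpret S: mn_system G \<C> b B M rp E \<Lambda>0 by (rule mn_system.intro; fact assms)
  interpret S': mn_system G' \<C>' b' B' M' rp' E' \<Lambda>0' by (rule mn_system.intro; fact assms)
  note \<sigma> = assms(23)
  have \<sigma>_in: "\<sigma> lam \<in> \<Lambda>0'" if "lam \<in> \<Lambda>0" for lam using \<sigma> that by (auto simp: bij_betw_def)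
  have iso: "block_isometry (mn_grp G M (rp lam)) (mn_classes G \<C> M (rp lam))
      (mn_basis M (rp lam)) (mn_block M (rp lam))
      (mn_grp G' M' (rp' (\<sigma> lam))) (mn_classes G' \<C>' M' (rp' (\<sigma> lam)))
      (mn_basis M' (rp' (\<sigma> lam))) (mn_block M' (rp' (\<sigma> lam))) (I lam)" if lam: "lam \<in> \<Lambda>0" for lam
  proof -
    interpret X: block_part "mn_grp G M (rp lam)" "mn_classes G \<C> M (rp lam)"
      "mn_basis M (rp lam)" "mn_block M (rp lam)" by (rule S.local_block[OF lam])
    interpret X': block_part "mn_grp G' M' (rp' (\<sigma> lam))" "mn_classes G' \<C>' M' (rp' (\<sigma> lam))"
      "mn_basis M' (rp' (\<sigma> lam))" "mn_block M' (rp' (\<sigma> lam))" by (rule S'.local_block[OF \<sigma>_in[OF lam]])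
    show ?thesis
    proof (intro block_isometry.intro block_isometry_axioms.intro X.block_part_axioms X'.block_part_axioms)
      show "isometry (mn_grp G M (rp lam)) (mn_grp G' M' (rp' (\<sigma> lam)))
        (cfun.span (mn_block M (rp lam))) (cfun.span (mn_block M' (rp' (\<sigma> lam)))) (I lam)"
        by (rule assms(26)[OF lam])
      show "I lam ` cfun.span X.b_B = cfun.span X'.b_B"
        using assms(28)[OF lam] unfolding mn_b_def X.span_dual_part X'.span_dual_part .
    qed
  qed
  have one: "?one \<in> \<Lambda>0" "\<sigma> ?one = ?one'" by fact+
  have rp1: "rp ?one = \<one>\<^bsub>G\<^esub>" using S.rep[of ?one] one(1) S.subset by blast
  have rp1': "rp' (\<sigma> ?one) = \<one>\<^bsub>G'\<^esub>" using S'.rep[of ?one'] \<sigma>_in[OF one(1)] one(2) S'.subset by auto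
  have I1: "I ?one \<chi> \<in> cfun.span B'" if "\<chi> \<in> cfun.span B" for \<chi>
    using block_isometry.I_in[OF iso[OF one(1)], unfolded rp1 rp1' S.at_one(2) S'.at_one(2), OF that] .
  let ?H = "\<lambda>lam. mn_grp G M (rp lam)"
  let ?d = "\<lambda>lam. mn_d \<C> M (rp lam)"
  let ?\<Phi> = "\<lambda>lam. dual_elt (?H lam) (\<bb> lam)"
  let ?L = "\<lambda>lam \<phi>. mn_l G' M' E' (\<sigma> lam) (I lam \<phi>) x'"
  have d_I: "mn_d \<C>' M' (rp' (\<sigma> lam)) (I ?one \<chi>) = I lam (?d lam \<chi>)"
    if lam: "lam \<in> \<Lambda>0" and \<chi>: "\<chi> \<in> cfun.span B" for lam \<chi>
  proof -
    interpret X: block_isometry "?H lam" "mn_classes G \<C> M (rp lam)"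
      "mn_basis M (rp lam)" "mn_block M (rp lam)"
      "mn_grp G' M' (rp' (\<sigma> lam))" "mn_classes G' \<C>' M' (rp' (\<sigma> lam))"
      "mn_basis M' (rp' (\<sigma> lam))" "mn_block M' (rp' (\<sigma> lam))" "I lam" by (rule iso[OF lam])
    have s: "rp lam \<in> mn_S M" "rp' (\<sigma> lam) \<in> mn_S M'"
      using S.rep_S S'.rep_S lam \<sigma>_in[OF lam] S.subset S'.subset by blast+
    have r: "mn_r M (rp lam) \<chi> \<in> cfun.span (mn_block M (rp lam))" using S.r_image[OF s(1)] \<chi> by blast
    show ?thesis
      unfolding S.mn_d_eq[OF s(1)] S'.mn_d_eq[OF s(2)] X.res_commute[OF r, symmetric]
      by (simp only: assms(27)[OF lam \<chi>])
  qed
  have I_value: "I ?one \<chi> x' = (\<Sum>lam\<in>\<Lambda>0. \<Sum>\<phi>\<in>\<bb>C lam. herm (?H lam) (?d lam \<chi>) (?\<Phi> lam \<phi>) * ?L lam \<phi>)"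
    if \<chi>: "\<chi> \<in> cfun.span B" for \<chi>
  proof -
    have "I ?one \<chi> x' = (\<Sum>lam'\<in>\<Lambda>0'. mn_l G' M' E' lam' (mn_d \<C>' M' (rp' lam') (I ?one \<chi>)) x')"
      by (rule S'.value_decomposition[OF I1[OF \<chi>] assms(33)])
    also have "\<dots> = (\<Sum>lam\<in>\<Lambda>0. mn_l G' M' E' (\<sigma> lam) (mn_d \<C>' M' (rp' (\<sigma> lam)) (I ?one \<chi>)) x')"
      by (rule sum.reindex_bij_betw[OF \<sigma>, symmetric])
    also have "\<dots> = (\<Sum>lam\<in>\<Lambda>0. \<Sum>\<phi>\<in>\<bb>C lam. herm (?H lam) (?d lam \<chi>) (?\<Phi> lam \<phi>) * ?L lam \<phi>)"
    proof (rule sum.cong[OF refl])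
      fix lam assume lam: "lam \<in> \<Lambda>0"
      interpret X: block_isometry "?H lam" "mn_classes G \<C> M (rp lam)"
        "mn_basis M (rp lam)" "mn_block M (rp lam)"
        "mn_grp G' M' (rp' (\<sigma> lam))" "mn_classes G' \<C>' M' (rp' (\<sigma> lam))"
        "mn_basis M' (rp' (\<sigma> lam))" "mn_block M' (rp' (\<sigma> lam))" "I lam" by (rule iso[OF lam])
      note ex = S.adapted_expand[OF lam assms(29)[OF lam] assms(30)[OF lam] assms(31)[OF lam] \<chi>]
      have sub: "\<phi> \<in> cfun.span (mn_block M (rp lam))" if "\<phi> \<in> \<bb>C lam" for \<phi>
        using ex(2) that X.src.span_part_in_block unfolding mn_b_def by blast
      have "mn_d \<C>' M' (rp' (\<sigma> lam)) (I ?one \<chi>) = I lam (\<Sum>\<phi>\<in>\<bb>C lam.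
          cscale (herm (?H lam) (?d lam \<chi>) (?\<Phi> lam \<phi>)) \<phi>)"
        unfolding d_I[OF lam \<chi>] by (rule arg_cong[OF ex(1)])
      also have "\<dots> = (\<Sum>\<phi>\<in>\<bb>C lam. cscale (herm (?H lam) (?d lam \<chi>) (?\<Phi> lam \<phi>)) (I lam \<phi>))"
        by (rule linear_on_combination[OF X.linear cfun.subspace_span]) (rule sub)
      finally show "mn_l G' M' E' (\<sigma> lam) (mn_d \<C>' M' (rp' (\<sigma> lam)) (I ?one \<chi>)) x' =
          (\<Sum>\<phi>\<in>\<bb>C lam. herm (?H lam) (?d lam \<chi>) (?\<Phi> lam \<phi>) * ?L lam \<phi>)"
        by (simp only: S'.mn_l_combination)
    qed
    finally show ?thesis .
  qed
  have e: "cnj (mn_e G \<C> B M (rp lam) (?\<Phi> lam \<phi>) x) =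
      (\<Sum>\<chi>\<in>B. cnj (\<chi> x) * herm (?H lam) (?d lam \<chi>) (?\<Phi> lam \<phi>))" if lam: "lam \<in> \<Lambda>0" for lam \<phi>
  proof -
    have s: "rp lam \<in> mn_S M" using S.rep_S lam S.subset by blast
    show ?thesis unfolding S.mn_e_eq[OF s]
      by (simp add: sum_fun_apply cscale_def herm_cnj mult.commute)
  qed
  have Jinv: "inv_into (cfun.span (mn_b G' \<C>' M' (rp' (\<sigma> lam))))
      (adjoint (?H lam) (mn_grp G' M' (rp' (\<sigma> lam))) (cfun.span (mn_b G \<C> M (rp lam)))
        (cfun.span (dual_basis (?H lam) (mn_b G \<C> M (rp lam)))) (I lam)) \<phi> = I lam \<phi>"
    if lam: "lam \<in> \<Lambda>0" and \<phi>: "\<phi> \<in> \<bb>C lam" for lam \<phi>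
  proof -
    have "\<phi> \<in> cfun.span (mn_b G \<C> M (rp lam))"
      using S.adapted_expand(2)[OF lam assms(29)[OF lam] assms(30)[OF lam] assms(31)[OF lam] cfun.span_zero] \<phi>
      by blast
    then show ?thesis unfolding mn_b_def by (rule block_isometry.adjoint_inverse[OF iso[OF lam]])
  qed
  have "kernel_hat B (I ?one) x x' =
      (\<Sum>\<chi>\<in>B. \<Sum>lam\<in>\<Lambda>0. \<Sum>\<phi>\<in>\<bb>C lam. cnj (\<chi> x) * herm (?H lam) (?d lam \<chi>) (?\<Phi> lam \<phi>) * ?L lam \<phi>)"
    unfolding kernel_hat_def
    by (intro sum.cong refl) (simp add: I_value[OF cfun.span_base] sum_distrib_left mult.assoc)
  also have "\<dots> = (\<Sum>lam\<in>\<Lambda>0. \<Sum>\<chi>\<in>B. \<Sum>\<phi>\<in>\<bb>C lam. cnj (\<chi> x) * herm (?H lam) (?d lam \<chi>) (?\<Phi> lam \<phi>) * ?L lam \<phi>)"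
    by (rule sum.swap)
  also have "\<dots> = (\<Sum>lam\<in>\<Lambda>0. \<Sum>\<phi>\<in>\<bb>C lam. \<Sum>\<chi>\<in>B. cnj (\<chi> x) * herm (?H lam) (?d lam \<chi>) (?\<Phi> lam \<phi>) * ?L lam \<phi>)"
    by (rule sum.cong[OF refl sum.swap])
  also have "\<dots> = (\<Sum>lam\<in>\<Lambda>0. \<Sum>\<phi>\<in>\<bb>C lam. cnj (mn_e G \<C> B M (rp lam) (?\<Phi> lam \<phi>) x) * ?L lam \<phi>)"
    by (intro sum.cong refl) (simp add: e sum_distrib_right)
  finally show ?thesis
    unfolding Let_def by (simp add: Jinv cong: sum.cong)
qed

end
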